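(* Suppose that $(G,N,\theta)_{\mathcal H}\ge_c(H,M,\varphi)_{\mathcal H}$. Then there is an $\mathcal H$-equivariant bijection $\tau:\mathrm{Irr}(G|\theta^{\mathcal H})\to\mathrm{Irr}(H|\varphi^{\mathcal H})$ that preserves ratios of character degrees, i.e. $\chi(1)/\theta(1)=\tau(\chi)(1)/\varphi(1)$ for all $\chi$.
   Context: All groups are finite; $p$ is a fixed prime. $\mathbb Q^{\mathrm{ab}}\subseteq\mathbb C$ is generated by all roots of unity, $\mathcal G=\mathrm{Gal}(\mathbb Q^{\mathrm{ab}}/\mathbb Q)$, and $\mathcal H\le\mathcal G$ consists of those $\sigma$ for which there is an integer $f$ with $\sigma(\xi)=\xi^{p^f}$ for all roots of unity $\xi$ of order prime to $p$. For $N\trianglelefteq G$, $\theta\in\mathrm{Irr}(N)$, $g\in G$, $\sigma\in\mathcal G$: $\theta^{g\sigma}(n)=\sigma(\theta(gng^{-1}))$; $A_\theta$ is the stabilizer of $\theta$ in $A\le G\times\mathcal G$; $\theta^{\mathcal H}$ is the $\mathcal H$-orbit; $G_{\theta^{\mathcal H}}=\{g:\theta^g\in\theta^{\mathcal H}\}$; $\mathrm{Irr}(G|\theta^{\mathcal H})=\bigcup_{\sigma\in\mathcal H}\mathrm{Irr}(G|\theta^\sigma)$. $(G,N,\theta)_{\mathcal H}$ is an $\mathcal H$-triple if $N\trianglelefteq G$, $\theta\in\mathrm{Irr}(N)$ and $G_{\theta^{\mathcal H}}=G$. Projective representation $\mathcal P$ with factor set $\alpha$: $\mathcal P(x)\mathcal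 P(y)=\alpha(x,y)\mathcal P(xy)$. For $G$-invariant $\theta$, $\mathcal P$ (of $G$) is associated with $\theta$ if $\mathcal P_N$ is a representation affording $\theta$ and $\mathcal P(ng)=\mathcal P(n)\mathcal P(g)$, $\mathcal P(gn)=\mathcal P(g)\mathcal P(n)$ for $n\in N,g\in G$. $\mathcal Q\sim\mu\mathcal P$ means $\mathcal Q(x)=\mu(x)M^{-1}\mathcal P(x)M$ for all $x$, with $M$ fixed invertible. If $\mathcal P$ is a projective representation of $G_\theta$ associated with $\theta$ with entries in $\mathbb Q^{\mathrm{ab}}$ and $\theta^{x\sigma}=\theta$, set $\mathcal P^{x\sigma}(y)=\sigma(\mathcal P(xyx^{-1}))$ ($y\in G_\theta$, $\sigma$ entrywise), and let $\mu_{x\sigma}:G_\theta\to\mathbb C^\times$ be the unique function, constant on $N$-cosets with $\mu_{x\sigma}(1)=1$, such that $\mathcal P^{x\sigma}\sim\mu_{x\sigma}\mathcal P$. For $\mathcal H$-triples $(G,N,\theta)_{\mathcal H}$, $(H,M,\varphi)_{\mathcal H}$ with $H\le G$, $(G,N,\theta)_{\mathcal H}\ge_c(H,M,\varphi)_{\mathcal H}$ means: (i) $G=NH$, $N\cap H=M$, $\mathbf C_G(N)\subseteq H$; (ii) $(H\times\mathcal H)_\theta=(H\times\mathcal H)_\varphi$ (in particular $H_\theta=H_\varphi$); (iii) there are projective representations $\mathcal P$ of $G_\theta$ associated with $\theta$ and $\mathcal P'$ of $H_\varphi$ associated with $\varphi$, with entries in $\mathbb Q^{\mathrm{ab}}$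 and factor sets $\alpha,\alpha'$ taking root-of-unity values, with $\alpha=\alpha'$ on $H_\theta\times H_\theta$ and $\mathcal P(c)$, $\mathcal P'(c)$ equal to the same scalar for each $c\in\mathbf C_G(N)$; (iv) for every $a\in(H\times\mathcal H)_\theta$, $\mu_a$ (for $\mathcal P$) and $\mu'_a$ (for $\mathcal P'$) agree on $H_\theta$. *)

theory Defs
  imports "HOL-Algebra.Coset" "Jordan_Normal_Form.Matrix" "HOL-Computational_Algebra.Primes"
begin

definition root_of_unity :: "complex \<Rightarrow> bool" where
  "root_of_unity z \<longleftrightarrow> (\<exists>n::nat. n > 0 \<and> z ^ n = 1)"

definition subfield_C :: "complex set \<Rightarrow> bool" where
  "subfield_C S \<longleftrightarrow> 0 \<in> S \<and> 1 \<in> S \<and>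
     (\<forall>x\<in>S. \<forall>y\<in>S. x + y \<in> S \<and> x - y \<in> S \<and> x * y \<in> S) \<and>
     (\<forall>x\<in>S. x \<noteq> 0 \<longrightarrow> inverse x \<in> S)"

definition Qab :: "complex set" where
  "Qab = \<Inter>{S. subfield_C S \<and> {z. root_of_unity z} \<subseteq> S}"

text \<open>Gal(Q^ab/Q): field automorphisms of Q^ab, extended by the identity outside Q^ab
  (so that each automorphism is represented by a unique function).\<close>
definition GalQab :: "(complex \<Rightarrow> complex) set" where
  "GalQab = {\<sigma>. bij_betw \<sigma> Qab Qab \<and>
      (\<forall>x\<in>Qab. \<forall>y\<in>Qab. \<sigma> (x + y) = \<sigma> x + \<sigma> y \<and> \<sigma> (x * y) = \<sigma> x * \<sigma> y) \<and>
      (\<forall>x. x \<notin> Qab \<longrightarrow> \<sigma> x = x)}"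

text \<open>The subgroup H: sigma acts on roots of unity of order prime to p as the f-th power
  of the Frobenius xi -> xi^p, for an integer f (for f < 0 this means (sigma xi)^(p^(-f)) = xi).\<close>
definition Hgal :: "nat \<Rightarrow> (complex \<Rightarrow> complex) set" where
  "Hgal p = {\<sigma> \<in> GalQab. \<exists>f::int. \<forall>\<xi> (n::nat). n > 0 \<and> coprime n p \<and> \<xi> ^ n = 1 \<longrightarrow>
      (if f \<ge> 0 then \<sigma> \<xi> = \<xi> ^ (p ^ nat f) else (\<sigma> \<xi>) ^ (p ^ nat (- f)) = \<xi>)}"

definition mat_trace :: "complex mat \<Rightarrow> complex" where
  "mat_trace A = (\<Sum>i<dim_row A. A $$ (i, i))"

definition is_rep :: "('a, 'b) monoid_scheme \<Rightarrow> 'a set \<Rightarrow> nat \<Rightarrow> ('a \<Rightarrow> complex mat) \<Rightarrow> bool" where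
  "is_rep G K d \<rho> \<longleftrightarrow> (\<forall>x\<in>K. \<rho> x \<in> carrier_mat d d) \<and> \<rho> \<one>\<^bsub>G\<^esub> = 1\<^sub>m d \<and>
     (\<forall>x\<in>K. \<forall>y\<in>K. \<rho> (x \<otimes>\<^bsub>G\<^esub> y) = \<rho> x * \<rho> y)"

definition irreducible_rep :: "('a, 'b) monoid_scheme \<Rightarrow> 'a set \<Rightarrow> nat \<Rightarrow> ('a \<Rightarrow> complex mat) \<Rightarrow> bool" where
  "irreducible_rep G K d \<rho> \<longleftrightarrow> is_rep G K d \<rho> \<and> d > 0 \<and>
     \<not> (\<exists>W. W \<subseteq> carrier_vec d \<and> 0\<^sub>v d \<in> W \<and> (\<forall>v\<in>W. \<forall>w\<in>W. v + w \<in> W) \<and>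
           (\<forall>c. \<forall>v\<in>W. c \<cdot>\<^sub>v v \<in> W) \<and> W \<noteq> {0\<^sub>v d} \<and> W \<noteq> carrier_vec d \<and>
           (\<forall>x\<in>K. \<forall>w\<in>W. \<rho> x *\<^sub>v w \<in> W))"

definition char_of :: "'a set \<Rightarrow> ('a \<Rightarrow> complex mat) \<Rightarrow> ('a \<Rightarrow> complex)" where
  "char_of K \<rho> = (\<lambda>x. if x \<in> K then mat_trace (\<rho> x) else 0)"

definition Irr :: "('a, 'b) monoid_scheme \<Rightarrow> 'a set \<Rightarrow> ('a \<Rightarrow> complex) set" where
  "Irr G K = {\<chi>. \<exists>d \<rho>. irreducible_rep G K d \<rho> \<and> \<chi> = char_of K \<rho>}"

definition inner_prod :: "'a set \<Rightarrow> ('a \<Rightarrow> complex) \<Rightarrow> ('a \<Rightarrow> complex) \<Rightarrow> complex" where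
  "inner_prod K \<chi> \<psi> = (\<Sum>x\<in>K. \<chi> x * cnj (\<psi> x)) / of_nat (card K)"

definition Irr_over :: "('a, 'b) monoid_scheme \<Rightarrow> 'a set \<Rightarrow> 'a set \<Rightarrow> ('a \<Rightarrow> complex) \<Rightarrow> ('a \<Rightarrow> complex) set" where
  "Irr_over G K N \<theta> = {\<chi> \<in> Irr G K. inner_prod N \<chi> \<theta> \<noteq> 0}"

definition conj_char :: "('a, 'b) monoid_scheme \<Rightarrow> 'a set \<Rightarrow> 'a \<Rightarrow> (complex \<Rightarrow> complex) \<Rightarrow> ('a \<Rightarrow> complex) \<Rightarrow> ('a \<Rightarrow> complex)" where
  "conj_char G N g \<sigma> \<theta> = (\<lambda>n. if n \<in> N then \<sigma> (\<theta> (g \<otimes>\<^bsub>G\<^esub> n \<otimes>\<^bsub>G\<^esub> inv\<^bsub>G\<^esub> g)) else 0)"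

definition H_orbit :: "nat \<Rightarrow> ('a, 'b) monoid_scheme \<Rightarrow> 'a set \<Rightarrow> ('a \<Rightarrow> complex) \<Rightarrow> ('a \<Rightarrow> complex) set" where
  "H_orbit p G N \<theta> = {conj_char G N \<one>\<^bsub>G\<^esub> \<sigma> \<theta> | \<sigma>. \<sigma> \<in> Hgal p}"

definition stab :: "('a, 'b) monoid_scheme \<Rightarrow> 'a set \<Rightarrow> 'a set \<Rightarrow> ('a \<Rightarrow> complex) \<Rightarrow> 'a set" where
  "stab G K N \<theta> = {g \<in> K. conj_char G N g id \<theta> = \<theta>}"

definition stab_orbit :: "nat \<Rightarrow> ('a, 'b) monoid_scheme \<Rightarrow> 'a set \<Rightarrow> 'a set \<Rightarrow> ('a \<Rightarrow> complex) \<Rightarrow> 'a set" where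
  "stab_orbit p G K N \<theta> = {g \<in> K. conj_char G N g id \<theta> \<in> H_orbit p G N \<theta>}"

definition pair_stab :: "nat \<Rightarrow> ('a, 'b) monoid_scheme \<Rightarrow> 'a set \<Rightarrow> 'a set \<Rightarrow> ('a \<Rightarrow> complex) \<Rightarrow> ('a \<times> (complex \<Rightarrow> complex)) set" where
  "pair_stab p G K N \<theta> = {(h, \<sigma>). h \<in> K \<and> \<sigma> \<in> Hgal p \<and> conj_char G N h \<sigma> \<theta> = \<theta>}"

definition Irr_over_orbit :: "nat \<Rightarrow> ('a, 'b) monoid_scheme \<Rightarrow> 'a set \<Rightarrow> 'a set \<Rightarrow> ('a \<Rightarrow> complex) \<Rightarrow> ('a \<Rightarrow> complex) set" where
  "Irr_over_orbit p G K N \<theta> = (\<Union>\<sigma>\<in>Hgal p. Irr_over G K N (conj_char G N \<one>\<^bsub>G\<^esub> \<sigma> \<theta>))"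

definition H_triple :: "nat \<Rightarrow> ('a, 'b) monoid_scheme \<Rightarrow> 'a set \<Rightarrow> 'a set \<Rightarrow> ('a \<Rightarrow> complex) \<Rightarrow> bool" where
  "H_triple p G K N \<theta> \<longleftrightarrow> subgroup K G \<and> normal N (G\<lparr>carrier := K\<rparr>) \<and> \<theta> \<in> Irr G N \<and>
     stab_orbit p G K N \<theta> = K"

definition centralizer_set :: "('a, 'b) monoid_scheme \<Rightarrow> 'a set \<Rightarrow> 'a set" where
  "centralizer_set G N = {g \<in> carrier G. \<forall>n\<in>N. g \<otimes>\<^bsub>G\<^esub> n = n \<otimes>\<^bsub>G\<^esub> g}"

definition proj_rep :: "('a, 'b) monoid_scheme \<Rightarrow> 'a set \<Rightarrow> nat \<Rightarrow> ('a \<Rightarrow> complex mat) \<Rightarrow> ('a \<Rightarrow> 'a \<Rightarrow> complex) \<Rightarrow> bool" where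
  "proj_rep G K d P \<alpha> \<longleftrightarrow> (\<forall>x\<in>K. P x \<in> carrier_mat d d \<and> invertible_mat (P x)) \<and>
     (\<forall>x\<in>K. \<forall>y\<in>K. P x * P y = \<alpha> x y \<cdot>\<^sub>m P (x \<otimes>\<^bsub>G\<^esub> y))"

definition assoc_proj :: "('a, 'b) monoid_scheme \<Rightarrow> 'a set \<Rightarrow> 'a set \<Rightarrow> ('a \<Rightarrow> complex) \<Rightarrow> nat \<Rightarrow> ('a \<Rightarrow> complex mat) \<Rightarrow> ('a \<Rightarrow> 'a \<Rightarrow> complex) \<Rightarrow> bool" where
  "assoc_proj G K N \<theta> d P \<alpha> \<longleftrightarrow> proj_rep G K d P \<alpha> \<and> is_rep G N d P \<and>
     (\<forall>n\<in>N. mat_trace (P n) = \<theta> n) \<and>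
     (\<forall>n\<in>N. \<forall>g\<in>K. P (n \<otimes>\<^bsub>G\<^esub> g) = P n * P g \<and> P (g \<otimes>\<^bsub>G\<^esub> n) = P g * P n)"

definition entries_in_Qab :: "'a set \<Rightarrow> nat \<Rightarrow> ('a \<Rightarrow> complex mat) \<Rightarrow> bool" where
  "entries_in_Qab K d P \<longleftrightarrow> (\<forall>x\<in>K. \<forall>i<d. \<forall>j<d. P x $$ (i, j) \<in> Qab)"

definition root_of_unity_factor_set :: "'a set \<Rightarrow> ('a \<Rightarrow> 'a \<Rightarrow> complex) \<Rightarrow> bool" where
  "root_of_unity_factor_set K \<alpha> \<longleftrightarrow> (\<forall>x\<in>K. \<forall>y\<in>K. root_of_unity (\<alpha> x y))"

definition proj_conj :: "('a, 'b) monoid_scheme \<Rightarrow> 'a \<Rightarrow> (complex \<Rightarrow> complex) \<Rightarrow> ('a \<Rightarrow> complex mat) \<Rightarrow> ('a \<Rightarrow> complex mat)" where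
  "proj_conj G x \<sigma> P = (\<lambda>y. map_mat \<sigma> (P (x \<otimes>\<^bsub>G\<^esub> y \<otimes>\<^bsub>G\<^esub> inv\<^bsub>G\<^esub> x)))"

definition sim_mu :: "'a set \<Rightarrow> nat \<Rightarrow> ('a \<Rightarrow> complex mat) \<Rightarrow> ('a \<Rightarrow> complex) \<Rightarrow> ('a \<Rightarrow> complex mat) \<Rightarrow> bool" where
  "sim_mu K d Q \<mu> P \<longleftrightarrow> (\<exists>A B. A \<in> carrier_mat d d \<and> B \<in> carrier_mat d d \<and>
      A * B = 1\<^sub>m d \<and> B * A = 1\<^sub>m d \<and> (\<forall>x\<in>K. Q x = \<mu> x \<cdot>\<^sub>m (B * P x * A)))"

definition is_mu :: "('a, 'b) monoid_scheme \<Rightarrow> 'a set \<Rightarrow> 'a set \<Rightarrow> nat \<Rightarrow> ('a \<Rightarrow> complex mat) \<Rightarrow> 'a \<Rightarrow> (complex \<Rightarrow> complex) \<Rightarrow> ('a \<Rightarrow> complex) \<Rightarrow> bool" where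
  "is_mu G K N d P x \<sigma> \<mu> \<longleftrightarrow> (\<forall>y\<in>K. \<mu> y \<noteq> 0) \<and> (\<forall>y\<in>K. \<forall>n\<in>N. \<mu> (n \<otimes>\<^bsub>G\<^esub> y) = \<mu> y) \<and>
     \<mu> \<one>\<^bsub>G\<^esub> = 1 \<and> sim_mu K d (proj_conj G x \<sigma> P) \<mu> P"

definition central_order :: "nat \<Rightarrow> ('a, 'b) monoid_scheme \<Rightarrow> 'a set \<Rightarrow> ('a \<Rightarrow> complex) \<Rightarrow>
    'a set \<Rightarrow> 'a set \<Rightarrow> ('a \<Rightarrow> complex) \<Rightarrow> bool" where
  "central_order p G N \<theta> H M \<phi> \<longleftrightarrow>
     H_triple p G (carrier G) N \<theta> \<and> H_triple p G H M \<phi> \<and>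
     N <#>\<^bsub>G\<^esub> H = carrier G \<and> N \<inter> H = M \<and> centralizer_set G N \<subseteq> H \<and>
     pair_stab p G H N \<theta> = pair_stab p G H M \<phi> \<and>
     (\<exists>d P \<alpha> d' P' \<alpha>'.
        assoc_proj G (stab G (carrier G) N \<theta>) N \<theta> d P \<alpha> \<and>
        entries_in_Qab (stab G (carrier G) N \<theta>) d P \<and>
        root_of_unity_factor_set (stab G (carrier G) N \<theta>) \<alpha> \<and>
        assoc_proj G (stab G H M \<phi>) M \<phi> d' P' \<alpha>' \<and>
        entries_in_Qab (stab G H M \<phi>) d' P' \<and>
        root_of_unity_factor_set (stab G H M \<phi>) \<alpha>' \<and>
        (\<forall>x\<in>stab G H N \<theta>. \<forall>y\<in>stab G H N \<theta>. \<alpha> x y = \<alpha>' x y) \<and>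
        (\<forall>c\<in>centralizer_set G N. \<exists>\<zeta>. P c = \<zeta> \<cdot>\<^sub>m 1\<^sub>m d \<and> P' c = \<zeta> \<cdot>\<^sub>m 1\<^sub>m d') \<and>
        (\<forall>x \<sigma>. (x, \<sigma>) \<in> pair_stab p G H N \<theta> \<longrightarrow>
           (\<forall>\<mu> \<mu>'. is_mu G (stab G (carrier G) N \<theta>) N d P x \<sigma> \<mu> \<and>
                    is_mu G (stab G H M \<phi>) M d' P' x \<sigma> \<mu>' \<longrightarrow>
                    (\<forall>y\<in>stab G H N \<theta>. \<mu> y = \<mu>' y))))"

end

theory Submission
  imports Defs "Jordan_Normal_Form.Spectral_Radius"
begin

text \<open>Write \<open>T\<close> for the stabiliser of \<open>\<theta>\<close> in \<open>G\<close> and \<open>S\<close> for that of \<open>\<phi>\<close> in \<open>H\<close>. Irreducible characters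
  are, up to positive scalars, the primitive idempotents of the centre of the group algebra, and
  this description is purely algebraic. Multiplication by the idempotent of \<open>\<theta>\<close> maps the
  characters of \<open>G\<close> above \<open>\<theta>\<close> to those of \<open>T\<close> above \<open>\<theta>\<close> (Clifford), and the latter factor as
  \<open>x \<mapsto> q x * trace (P x)\<close>, where \<open>q\<close> runs through the primitive central idempotents of the twisted
  group algebra of \<open>T / N\<close> with the factor set of \<open>P\<close>. As \<open>T / N\<close> and \<open>S / M\<close> are isomorphic and the
  factor sets agree, restricting \<open>q\<close> to \<open>S\<close> matches the characters above \<open>\<theta>\<close> with those above \<open>\<phi>\<close>.

  By Schur's orthogonality relations \<open>q x\<close> is the average over \<open>n\<close> in \<open>N\<close> of
  \<open>\<psi> (x n) * trace (inverse (P (x n)))\<close>. A pair \<open>(h, \<sigma>)\<close> fixing \<open>\<theta>\<close> therefore turns \<open>q\<close> into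
  \<open>\<mu> x * \<sigma> (q (h x inv h))\<close>, and agreement of the two functions \<open>\<mu>\<close> on \<open>S\<close> makes the matching
  compatible with the Galois action wherever both sides are defined. It then extends to whole
  Galois orbits by \<open>\<tau> (\<sigma> \<chi>) = \<sigma> (\<tau> \<chi>)\<close>.\<close>

section \<open>Complex matrices\<close>

text \<open>The obstacle is that a representation affording an irreducible character is not given
  over \<open>Qab\<close>, so \<sigma> cannot be applied to its entries. It can be applied to
  character values and to polynomial identities between them. Hence characters are handled as
  functions satisfying convolution identities, and the only matrices conjugated by \<sigma> are
  those of \<open>P\<close> and \<open>P'\<close>, whose entries lie in \<open>Qab\<close> by
  hypothesis. For the same reason only the trace of a projective representation of
  \<open>T / N\<close> occurs, as the function q. A one-dimensional ideal fixes its character up to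
  a scalar, and the convolution square fixes it up to sign; positivity at the identity fixes the
  sign. A Galois automorphism need not preserve the set of characters above \<theta>. It maps one of
  them into this set exactly if some pair (g, \<sigma>) fixes \<theta>. As \<open>G\<close> is the
  product of \<open>N\<close> and \<open>H\<close> and \<open>N\<close> fixes \<theta>, g can be
  taken in \<open>H\<close>, where the equality of the pair stabilisers compares the condition with
  the one for \<phi>. So the same automorphisms are admissible on both sides, which is what the
  extension to orbits requires.\<close>

lemma mat_trace_mult_comm:
  assumes "A \<in> carrier_mat n m" "B \<in> carrier_mat m n"
  shows "mat_trace (A * B) = mat_trace (B * A)"
proof -
  have "mat_trace (A * B) = (\<Sum>i<n. \<Sum>j<m. A $$ (i,j) * B $$ (j,i))"
    using assms by (auto simp: mat_trace_def scalar_prod_def lessThan_atLeast0 intro!: sum.cong)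
  also have "\<dots> = (\<Sum>j<m. \<Sum>i<n. B $$ (j,i) * A $$ (i,j))"
    by (subst sum.swap) (simp add: mult.commute)
  also have "\<dots> = mat_trace (B * A)"
    using assms by (auto simp: mat_trace_def scalar_prod_def lessThan_atLeast0 intro!: sum.cong)
  finally show ?thesis .
qed

lemma mat_trace_conj:
  assumes "A \<in> carrier_mat d d" "B \<in> carrier_mat d d" "C \<in> carrier_mat d d" "B * A = 1\<^sub>m d"
  shows "mat_trace (A * C * B) = mat_trace C"
proof -
  have "mat_trace (A * C * B) = mat_trace (B * (A * C))"
    using assms by (intro mat_trace_mult_comm) auto
  also have "B * (A * C) = B * A * C" using assms by (intro assoc_mult_mat[symmetric]) auto
  finally show ?thesis using assms by simp
qed

lemma mat_trace_smult: "mat_trace (c \<cdot>\<^sub>m A) = c * mat_trace A" if "A \<in> carrier_mat d d"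
  using that by (auto simp: mat_trace_def sum_distrib_left)

lemma mat_trace_one [simp]: "mat_trace (1\<^sub>m d) = of_nat d"
  by (simp add: mat_trace_def)

section \<open>Sums of matrices over a finite set\<close>

definition msum :: "nat \<Rightarrow> ('g \<Rightarrow> complex mat) \<Rightarrow> 'g set \<Rightarrow> complex mat" where
  "msum d F S = mat d d (\<lambda>ij. \<Sum>g\<in>S. F g $$ ij)"

lemma msum_carrier [simp]: "msum d F S \<in> carrier_mat d d"
  by (simp add: msum_def)

lemma msum_index: "i < d \<Longrightarrow> j < d \<Longrightarrow> msum d F S $$ (i,j) = (\<Sum>g\<in>S. F g $$ (i,j))"
  by (simp add: msum_def)

lemma mult_msum:
  assumes "A \<in> carrier_mat d d" "\<And>g. g \<in> S \<Longrightarrow> F g \<in> carrier_mat d d"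
  shows "A * msum d F S = msum d (\<lambda>g. A * F g) S"
proof (rule eq_matI)
  fix i j assume "i < dim_row (msum d (\<lambda>g. A * F g) S)" "j < dim_col (msum d (\<lambda>g. A * F g) S)"
  then have ij: "i < d" "j < d" by (auto simp: msum_def)
  have "(A * msum d F S) $$ (i,j) = (\<Sum>k<d. A $$ (i,k) * (\<Sum>g\<in>S. F g $$ (k,j)))"
    using ij assms(1) by (auto simp: scalar_prod_def msum_def lessThan_atLeast0 intro!: sum.cong)
  also have "\<dots> = (\<Sum>g\<in>S. \<Sum>k<d. A $$ (i,k) * F g $$ (k,j))"
    by (simp add: sum_distrib_left) (rule sum.swap)
  also have "\<dots> = (\<Sum>g\<in>S. (A * F g) $$ (i,j))"
    using ij assms by (intro sum.cong) (auto simp: scalar_prod_def lessThan_atLeast0 dest!: assms(2) intro!: sum.cong)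
  finally show "(A * msum d F S) $$ (i,j) = msum d (\<lambda>g. A * F g) S $$ (i,j)"
    using ij by (simp add: msum_index)
qed (use assms in \<open>auto simp: msum_def\<close>)

lemma msum_mult:
  assumes "A \<in> carrier_mat d d" "\<And>g. g \<in> S \<Longrightarrow> F g \<in> carrier_mat d d"
  shows "msum d F S * A = msum d (\<lambda>g. F g * A) S"
proof (rule eq_matI)
  fix i j assume "i < dim_row (msum d (\<lambda>g. F g * A) S)" "j < dim_col (msum d (\<lambda>g. F g * A) S)"
  then have ij: "i < d" "j < d" by (auto simp: msum_def)
  have "(msum d F S * A) $$ (i,j) = (\<Sum>k<d. (\<Sum>g\<in>S. F g $$ (i,k)) * A $$ (k,j))"
    using ij assms(1) by (auto simp: scalar_prod_def msum_def lessThan_atLeast0 intro!: sum.cong)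
  also have "\<dots> = (\<Sum>g\<in>S. \<Sum>k<d. F g $$ (i,k) * A $$ (k,j))"
    by (simp add: sum_distrib_right) (rule sum.swap)
  also have "\<dots> = (\<Sum>g\<in>S. (F g * A) $$ (i,j))"
    using ij assms by (intro sum.cong) (auto simp: scalar_prod_def lessThan_atLeast0 dest!: assms(2) intro!: sum.cong)
  finally show "(msum d F S * A) $$ (i,j) = msum d (\<lambda>g. F g * A) S $$ (i,j)"
    using ij by (simp add: msum_index)
qed (use assms in \<open>auto simp: msum_def\<close>)

lemma trace_msum:
  assumes "\<And>g. g \<in> S \<Longrightarrow> F g \<in> carrier_mat d d"
  shows "mat_trace (msum d F S) = (\<Sum>g\<in>S. mat_trace (F g))"
proof -
  have "mat_trace (msum d F S) = (\<Sum>i<d. \<Sum>g\<in>S. F g $$ (i,i))"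
    by (simp add: mat_trace_def msum_def)
  also have "\<dots> = (\<Sum>g\<in>S. \<Sum>i<d. F g $$ (i,i))" by (rule sum.swap)
  also have "\<dots> = (\<Sum>g\<in>S. mat_trace (F g))"
    using assms by (intro sum.cong) (auto simp: mat_trace_def)
  finally show ?thesis .
qed

lemma msum_cong: "(\<And>g. g \<in> S \<Longrightarrow> F g = F' g) \<Longrightarrow> msum d F S = msum d F' S"
  by (auto simp: msum_def)

lemma msum_reindex: "inj_on h S \<Longrightarrow> msum d F (h ` S) = msum d (\<lambda>g. F (h g)) S"
  by (rule eq_matI) (auto simp: msum_def sum.reindex)

section \<open>Powers of matrices of finite order\<close>

lemma upper_triangular_mult:
  assumes "(A :: complex mat) \<in> carrier_mat n n" "B \<in> carrier_mat n n" "upper_triangular A" "upper_triangular B"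
  shows "upper_triangular (A * B)" and "i < n \<Longrightarrow> (A * B) $$ (i,i) = A $$ (i,i) * B $$ (i,i)"
proof -
  have z: "A $$ (i,j) = 0" "B $$ (i,j) = 0" if "j < i" "i < n" for i j
    using assms that by (auto simp: upper_triangular_def)
  show "upper_triangular (A * B)"
  proof (rule upper_triangularI)
    fix i j assume ij: "j < i" "i < dim_row (A * B)"
    then have "(A * B) $$ (i,j) = (\<Sum>k=0..<n. A $$ (i,k) * B $$ (k,j))"
      using assms(1,2) by (auto simp: scalar_prod_def)
    also have "\<dots> = 0"
    proof (intro sum.neutral ballI)
      fix k assume "k \<in> {0..<n}"
      then show "A $$ (i,k) * B $$ (k,j) = 0"
        using ij assms(1,2) z(1)[of k i] z(2)[of j k] by (cases "k < i") auto
    qed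
    finally show "(A * B) $$ (i,j) = 0" .
  qed
  show "(A * B) $$ (i,i) = A $$ (i,i) * B $$ (i,i)" if i: "i < n"
  proof -
    have "(A * B) $$ (i,i) = (\<Sum>k=0..<n. A $$ (i,k) * B $$ (k,i))"
      using assms(1,2) i by (auto simp: scalar_prod_def)
    also have "\<dots> = (\<Sum>k=0..<n. if k = i then A $$ (i,i) * B $$ (i,i) else 0)"
    proof (intro sum.cong refl)
      fix k assume "k \<in> {0..<n}"
      then show "A $$ (i,k) * B $$ (k,i) = (if k = i then A $$ (i,i) * B $$ (i,i) else 0)"
        using i z(1)[of k i] z(2)[of i k] by (cases k i rule: linorder_cases) auto
    qed
    finally show ?thesis using i by simp
  qed
qed

lemma upper_triangular_pow:
  assumes "(A :: complex mat) \<in> carrier_mat n n" "upper_triangular A"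
  shows "upper_triangular (A ^\<^sub>m k) \<and> (\<forall>i<n. (A ^\<^sub>m k) $$ (i,i) = (A $$ (i,i)) ^ k)"
proof (induction k)
  case 0 then show ?case using assms by (auto simp: upper_triangular_def)
next
  case (Suc k)
  have "A ^\<^sub>m k \<in> carrier_mat n n" using assms by auto
  with Suc upper_triangular_mult[of "A ^\<^sub>m k" n A] assms show ?case by auto
qed

text \<open>Over the complex numbers \<open>A\<close> is similar to a triangular matrix, whose
  powers carry the powers of its diagonal entries on the diagonal. One family \<open>l\<close> of
  eigenvalues serves all exponents at once, so that the traces of \<open>A\<close> and of its
  inverse can be compared.\<close>

lemma finite_order_traces:
  assumes A: "A \<in> carrier_mat n n" and Am: "A ^\<^sub>m m = 1\<^sub>m n"
  obtains l where "\<And>i. i < n \<Longrightarrow> l i ^ m = 1" "\<And>k. mat_trace (A ^\<^sub>m k) = (\<Sum>i<n. l i ^ k)"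
proof -
  from char_poly_factorized[OF A] obtain es where "char_poly A = (\<Prod>a\<leftarrow>es. [:- a, 1:])" by blast
  from schur_decomposition_exists[OF A this] obtain B where
    B: "B \<in> carrier_mat n n" "upper_triangular B" and "similar_mat A B" by blast
  then obtain P Q where w: "similar_mat_wit A B P Q" by (auto simp: similar_mat_def)
  note PQ = similar_mat_witD2[OF A w]
  have pw: "similar_mat_wit (A ^\<^sub>m k) (B ^\<^sub>m k) P Q" for k
    by (rule similar_mat_wit_pow[OF w])
  have tr: "mat_trace (A ^\<^sub>m k) = (\<Sum>i<n. (B $$ (i,i)) ^ k)" for k
  proof -
    have "A ^\<^sub>m k = P * (B ^\<^sub>m k) * Q" using pw[of k] A by (auto simp: similar_mat_wit_def Let_def)
    then have "mat_trace (A ^\<^sub>m k) = mat_trace (B ^\<^sub>m k)"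
      using mat_trace_conj[of P n Q "B ^\<^sub>m k"] PQ B by simp
    also have "\<dots> = (\<Sum>i<n. (B $$ (i,i)) ^ k)"
      using upper_triangular_pow[OF B, of k] B by (auto simp: mat_trace_def)
    finally show ?thesis .
  qed
  have "B ^\<^sub>m m = 1\<^sub>m n"
  proof -
    have "similar_mat_wit (B ^\<^sub>m m) (A ^\<^sub>m m) Q P" by (rule similar_mat_wit_sym[OF pw])
    then have "B ^\<^sub>m m = Q * (A ^\<^sub>m m) * P" using A B by (auto simp: similar_mat_wit_def Let_def)
    then show ?thesis using Am PQ by simp
  qed
  then have "(B $$ (i,i)) ^ m = 1" if "i < n" for i
    using upper_triangular_pow[OF B, of m] that by (metis index_one_mat(1))
  from that[OF this tr] show ?thesis .
qed

section \<open>Splitting reducible representations\<close>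

lemma mat_mult_index:
  assumes "A \<in> carrier_mat n m" "B \<in> carrier_mat m k" "i < n" "j < k"
  shows "(A * B) $$ (i,j) = (\<Sum>l<m. A $$ (i,l) * B $$ (l,j))"
  using assms by (auto simp: scalar_prod_def lessThan_atLeast0 intro!: sum.cong)

lemma inj_mat_inverse:
  assumes C: "(C :: complex mat) \<in> carrier_mat d d"
    and inj: "\<And>v. v \<in> carrier_vec d \<Longrightarrow> C *\<^sub>v v = 0\<^sub>v d \<Longrightarrow> v = 0\<^sub>v d"
  obtains D where "D \<in> carrier_mat d d" "C * D = 1\<^sub>m d" "D * C = 1\<^sub>m d"
proof -
  have "det C \<noteq> 0" using det_0_iff_vec_prod_zero_field[OF C] inj by blast
  from det_non_zero_imp_unit[OF C this, of "()"] that show ?thesis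
    by (auto simp: Units_def ring_mat_def)
qed

section \<open>Bases adapted to a subspace\<close>

definition vsubspace :: "nat \<Rightarrow> complex vec set \<Rightarrow> bool" where
  "vsubspace d W \<longleftrightarrow> W \<subseteq> carrier_vec d \<and> 0\<^sub>v d \<in> W \<and> (\<forall>v\<in>W. \<forall>w\<in>W. v + w \<in> W) \<and>
     (\<forall>c. \<forall>v\<in>W. c \<cdot>\<^sub>v v \<in> W)"

lemma mult_mat_vec_in_subspace:
  assumes A: "A \<in> carrier_mat d d" and W: "vsubspace d W" and c: "\<And>i. i < d \<Longrightarrow> col A i \<in> W"
    and v: "v \<in> carrier_vec d"
  shows "A *\<^sub>v v \<in> W"
proof -
  \<comment> \<open>The truncation of \<open>v\<close> to its first \<open>m\<close> coordinates;
    passing from \<open>m\<close> to \<open>Suc m\<close> adds a multiple of column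
    \<open>m\<close>.\<close>
  let ?u = "\<lambda>m. vec d (\<lambda>i. if i < m then v $ i else 0)"
  have "A *\<^sub>v ?u m \<in> W" if "m \<le> d" for m
    using that
  proof (induction m)
    case 0
    have "?u 0 = 0\<^sub>v d" by auto
    then have "A *\<^sub>v ?u 0 = 0\<^sub>v d" using A by (intro eq_vecI) auto
    then show ?case using W by (auto simp: vsubspace_def)
  next
    case (Suc m)
    have u: "?u (Suc m) = ?u m + v $ m \<cdot>\<^sub>v unit_vec d m"
      using Suc.prems by (intro eq_vecI) (auto simp: less_Suc_eq)
    have "A *\<^sub>v ?u (Suc m) = A *\<^sub>v ?u m + A *\<^sub>v (v $ m \<cdot>\<^sub>v unit_vec d m)"
      unfolding u using A by (intro mult_add_distrib_mat_vec) auto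
    also have "A *\<^sub>v (v $ m \<cdot>\<^sub>v unit_vec d m) = v $ m \<cdot>\<^sub>v (A *\<^sub>v unit_vec d m)"
      using A by (intro mult_mat_vec) auto
    also have "A *\<^sub>v unit_vec d m = col A m"
      using A Suc.prems by (intro eq_vecI) auto
    finally show ?case using Suc c[of m] W by (auto simp: vsubspace_def)
  qed
  from this[of d] have "A *\<^sub>v ?u d \<in> W" by simp
  moreover have "?u d = v" using v by auto
  ultimately show ?thesis by simp
qed

text \<open>The basis is chosen so as to have the largest possible set I of columns inside W: if some
  w in W had a nonzero coordinate outside I, the exchange of that column for w would enlarge I.\<close>
lemma adapted_basis:
  assumes W: "vsubspace d W" and W0: "W \<noteq> {0\<^sub>v d}" and W1: "W \<noteq> carrier_vec d"
  obtains A B I where "A \<in> carrier_mat d d" "B \<in> carrier_mat d d" "A * B = 1\<^sub>m d" "B * A = 1\<^sub>m d"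
    "I \<subseteq> {..<d}" "I \<noteq> {}" "I \<noteq> {..<d}" "\<And>i. i \<in> I \<Longrightarrow> col A i \<in> W"
    "\<And>w i. w \<in> W \<Longrightarrow> i < d \<Longrightarrow> i \<notin> I \<Longrightarrow> (B *\<^sub>v w) $ i = 0"
proof -
  define Q where "Q I \<longleftrightarrow> I \<subseteq> {..<d} \<and> (\<exists>A B. A \<in> carrier_mat d d \<and> B \<in> carrier_mat d d \<and>
    A * B = 1\<^sub>m d \<and> B * A = 1\<^sub>m d \<and> (\<forall>i\<in>I. col A i \<in> W))" for I
  have "Q {}" unfolding Q_def by (auto intro!: exI[of _ "1\<^sub>m d"])
  moreover have "\<forall>I. Q I \<longrightarrow> card I < Suc d"
    unfolding Q_def by (metis card_lessThan card_mono finite_lessThan le_imp_less_Suc)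
  ultimately obtain I where QI: "Q I" and max: "\<And>J. Q J \<Longrightarrow> card J \<le> card I"
    using ex_has_greatest_nat[of Q "{}" card "Suc d"] by (metis le_simps(2) less_imp_le)
  from QI obtain A B where I: "I \<subseteq> {..<d}" and A: "A \<in> carrier_mat d d" and B: "B \<in> carrier_mat d d"
    and AB: "A * B = 1\<^sub>m d" "B * A = 1\<^sub>m d" and col: "\<And>i. i \<in> I \<Longrightarrow> col A i \<in> W"
    unfolding Q_def by blast
  have finI: "finite I" using I finite_subset by blast
  have ABw: "A *\<^sub>v (B *\<^sub>v w) = w" if "w \<in> carrier_vec d" for w
    using that A B AB by (simp flip: assoc_mult_mat_vec)
  have coord: "(B *\<^sub>v w) $ j = 0" if w: "w \<in> W" and j: "j < d" "j \<notin> I" for w j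
  proof (rule ccontr)
    assume nz: "(B *\<^sub>v w) $ j \<noteq> 0"
    define c where "c = B *\<^sub>v w"
    have wd: "w \<in> carrier_vec d" using w W by (auto simp: vsubspace_def)
    have cd: "c \<in> carrier_vec d" using B wd unfolding c_def by auto
    \<comment> \<open>The identity with column \<open>j\<close> replaced by the coordinates of
      \<open>w\<close>. Then \<open>A * C\<close> is \<open>A\<close> with column \<open>j\<close>
      replaced by \<open>w\<close>, and \<open>C\<close> is injective because its diagonal entry at
      \<open>j\<close> is nonzero.\<close>
    define C where "C = mat d d (\<lambda>(i,l). if l = j then c $ i else if i = l then 1 else 0)"
    have C: "C \<in> carrier_mat d d" by (simp add: C_def)
    have Cv: "(C *\<^sub>v v) $ i = (if i = j then 0 else v $ i) + c $ i * v $ j"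
      if v: "v \<in> carrier_vec d" and i: "i < d" for v i
    proof -
      have "(C *\<^sub>v v) $ i = (\<Sum>l = 0..<d. (if l = j then c $ i else if i = l then 1 else 0) * v $ l)"
        using v i by (auto simp: C_def scalar_prod_def)
      also have "\<dots> = (\<Sum>l = 0..<d. (if l = j then c $ i * v $ j else 0) + (if l = i then (if i = j then 0 else v $ i) else 0))"
        by (rule sum.cong) auto
      also have "\<dots> = c $ i * v $ j + (if i = j then 0 else v $ i)"
        using i j by (simp add: sum.distrib)
      finally show ?thesis by simp
    qed
    have "v = 0\<^sub>v d" if v: "v \<in> carrier_vec d" and Cv0: "C *\<^sub>v v = 0\<^sub>v d" for v
    proof -
      have "c $ j * v $ j = 0" using Cv[OF v j(1)] Cv0 j by simp
      then have vj: "v $ j = 0" using nz c_def by simp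
      then have "v $ i = 0" if "i < d" for i using Cv[OF v that] Cv0 that by (auto split: if_splits)
      then show ?thesis using v by (intro eq_vecI) auto
    qed
    then obtain D where D: "D \<in> carrier_mat d d" "C * D = 1\<^sub>m d" "D * C = 1\<^sub>m d"
      using inj_mat_inverse[OF C] by blast
    have inv1: "A * C * (D * B) = 1\<^sub>m d"
    proof -
      have "A * C * (D * B) = A * (C * D) * B"
        using A B C D(1) by (simp add: assoc_mult_mat[of _ d d _ d _ d])
      then show ?thesis using A AB D by simp
    qed
    have inv2: "D * B * (A * C) = 1\<^sub>m d"
    proof -
      have "D * B * (A * C) = D * (B * A) * C"
        using A B C D(1) by (simp add: assoc_mult_mat[of _ d d _ d _ d])
      then show ?thesis using D AB by simp
    qed
    have colC: "col C i = (if i = j then c else unit_vec d i)" if "i < d" for i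
      using that cd by (auto simp: C_def intro!: eq_vecI)
    have "col (A * C) i \<in> W" if i: "i \<in> insert j I" for i
    proof -
      have id: "i < d" using i j I by auto
      have "col (A * C) i = A *\<^sub>v col C i" using A C id by (intro eq_vecI) auto
      also have "\<dots> = (if i = j then w else col A i)"
        using colC[OF id] ABw[OF wd] c_def A id by (auto intro!: eq_vecI)
      finally show ?thesis using w col i by auto
    qed
    then have "Q (insert j I)" unfolding Q_def using I j A B C D inv1 inv2
      by (intro conjI exI[of _ "A * C"] exI[of _ "D * B"]) auto
    then show False using max[of "insert j I"] finI j by simp
  qed
  have "I \<noteq> {}"
  proof
    assume "I = {}"
    then have "w = 0\<^sub>v d" if "w \<in> W" for w
    proof -
      have wd: "w \<in> carrier_vec d" using that W by (auto simp: vsubspace_def)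
      have "B *\<^sub>v w = 0\<^sub>v d" using coord[OF that] \<open>I = {}\<close> B by (intro eq_vecI) auto
      then have "w = A *\<^sub>v 0\<^sub>v d" using ABw[OF wd] by simp
      then show ?thesis using A by (auto intro!: eq_vecI)
    qed
    then show False using W0 W by (auto simp: vsubspace_def)
  qed
  moreover have "I \<noteq> {..<d}"
  proof
    assume "I = {..<d}"
    then have "A *\<^sub>v v \<in> W" if "v \<in> carrier_vec d" for v
      using mult_mat_vec_in_subspace[OF A W] col that by auto
    from this[of "B *\<^sub>v w" for w] have "w \<in> W" if "w \<in> carrier_vec d" for w
      using ABw[OF that] that B by (metis mult_mat_vec_carrier)
    then show False using W1 W by (auto simp: vsubspace_def)
  qed
  ultimately show ?thesis using that[OF A B AB I _ _ col coord] by blast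
qed

text \<open>By \<open>z\<close>, indices outside \<open>J\<close> contribute nothing to the entries
  in \<open>J\<close> of a product, so cutting the matrices down to \<open>J\<close> is
  multiplicative. The condition covers both diagonal blocks of a block triangular form: the right
  factor vanishes for one of them, the left factor for the other.\<close>

lemma sub_rep:
  fixes R :: "'a \<Rightarrow> complex mat"
  assumes rep: "is_rep G K d R" and K: "\<forall>x\<in>K. \<forall>y\<in>K. x \<otimes>\<^bsub>G\<^esub> y \<in> K" and one: "\<one>\<^bsub>G\<^esub> \<in> K"
    and J: "J \<subseteq> {..<d}"
    and z: "\<forall>x\<in>K. \<forall>y\<in>K. \<forall>i\<in>J. \<forall>j\<in>J. \<forall>l<d. l \<notin> J \<longrightarrow> R x $$ (i,l) * R y $$ (l,j) = 0"
  obtains \<rho> where "is_rep G K (card J) \<rho>" "\<And>x. mat_trace (\<rho> x) = (\<Sum>i\<in>J. R x $$ (i,i))"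
proof -
  have finJ: "finite J" using J finite_subset by blast
  then obtain e where e: "bij_betw e {0..<card J} J" using ex_bij_betw_nat_finite by blast
  have eJ: "e a \<in> J" "e a < d" if "a < card J" for a
    using e that J by (auto simp: bij_betw_def)
  define \<rho> where "\<rho> x = mat (card J) (card J) (\<lambda>(a,b). R x $$ (e a, e b))" for x
  have "is_rep G K (card J) \<rho>"
    unfolding is_rep_def
  proof (intro conjI ballI)
    show "\<rho> x \<in> carrier_mat (card J) (card J)" for x by (simp add: \<rho>_def)
    show "\<rho> \<one>\<^bsub>G\<^esub> = 1\<^sub>m (card J)"
    proof (rule eq_matI)
      fix a b assume "a < dim_row (1\<^sub>m (card J))" "b < dim_col (1\<^sub>m (card J))"
      then have ab: "a < card J" "b < card J" by auto
      have "e a = e b \<longleftrightarrow> a = b" using e ab by (auto simp: bij_betw_def inj_on_def)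
      then show "\<rho> \<one>\<^bsub>G\<^esub> $$ (a,b) = 1\<^sub>m (card J) $$ (a,b)"
        using ab rep eJ by (auto simp: \<rho>_def is_rep_def)
    qed (auto simp: \<rho>_def)
    fix x y assume xy: "x \<in> K" "y \<in> K"
    show "\<rho> (x \<otimes>\<^bsub>G\<^esub> y) = \<rho> x * \<rho> y"
    proof (rule eq_matI)
      fix a b assume "a < dim_row (\<rho> x * \<rho> y)" "b < dim_col (\<rho> x * \<rho> y)"
      then have ab: "a < card J" "b < card J" by (auto simp: \<rho>_def)
      have c: "R x \<in> carrier_mat d d" "R y \<in> carrier_mat d d" using rep xy by (auto simp: is_rep_def)
      have "R (x \<otimes>\<^bsub>G\<^esub> y) $$ (e a, e b) = (\<Sum>l<d. R x $$ (e a, l) * R y $$ (l, e b))"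
        using rep xy mat_mult_index[OF c eJ(2)[OF ab(1)] eJ(2)[OF ab(2)]]
        by (simp add: is_rep_def)
      also have "\<dots> = (\<Sum>l\<in>J. R x $$ (e a, l) * R y $$ (l, e b))"
        using J z xy eJ(1)[OF ab(1)] eJ(1)[OF ab(2)] by (intro sum.mono_neutral_right) auto
      also have "\<dots> = (\<Sum>l=0..<card J. R x $$ (e a, e l) * R y $$ (e l, e b))"
        using sum.reindex_bij_betw[OF e, of "\<lambda>l. R x $$ (e a, l) * R y $$ (l, e b)"] by simp
      also have "\<dots> = (\<rho> x * \<rho> y) $$ (a,b)"
        using ab by (auto simp: \<rho>_def scalar_prod_def)
      finally show "\<rho> (x \<otimes>\<^bsub>G\<^esub> y) $$ (a,b) = (\<rho> x * \<rho> y) $$ (a,b)"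
        using ab by (simp add: \<rho>_def)
    qed (auto simp: \<rho>_def)
  qed
  moreover have "mat_trace (\<rho> x) = (\<Sum>i\<in>J. R x $$ (i,i))" for x
    using sum.reindex_bij_betw[OF e, of "\<lambda>l. R x $$ (l, l)"]
    by (simp add: mat_trace_def \<rho>_def lessThan_atLeast0)
  ultimately show ?thesis using that by blast
qed

lemma is_rep_conj:
  assumes rep: "is_rep G K d \<rho>" and A: "A \<in> carrier_mat d d" and B: "B \<in> carrier_mat d d"
    and AB: "A * B = 1\<^sub>m d" "B * A = 1\<^sub>m d"
  shows "is_rep G K d (\<lambda>x. B * \<rho> x * A)"
  unfolding is_rep_def
proof (intro conjI ballI)
  show "B * \<rho> x * A \<in> carrier_mat d d" if "x \<in> K" for x
    using rep A B that by (auto simp: is_rep_def)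
  show "B * \<rho> \<one>\<^bsub>G\<^esub> * A = 1\<^sub>m d" using rep A B AB by (auto simp: is_rep_def)
  fix x y assume xy: "x \<in> K" "y \<in> K"
  have c: "\<rho> x \<in> carrier_mat d d" "\<rho> y \<in> carrier_mat d d" using rep xy by (auto simp: is_rep_def)
  have "B * \<rho> x * A * (B * \<rho> y * A) = B * \<rho> x * (A * B) * \<rho> y * A"
    using A B c by (simp add: assoc_mult_mat[of _ d d _ d _ d])
  also have "\<dots> = B * (\<rho> x * \<rho> y) * A"
    using A B c AB by (simp add: assoc_mult_mat[of _ d d _ d _ d])
  finally show "B * \<rho> (x \<otimes>\<^bsub>G\<^esub> y) * A = B * \<rho> x * A * (B * \<rho> y * A)"
    using rep xy by (simp add: is_rep_def)
qed

text \<open>In a basis adapted to an invariant subspace the matrices are block triangular. The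
  diagonal blocks are representations, on the subspace and on the quotient, and the trace sees only
  these blocks.\<close>

lemma reducible_split:
  assumes rep: "is_rep G K d \<rho>" and K: "\<forall>x\<in>K. \<forall>y\<in>K. x \<otimes>\<^bsub>G\<^esub> y \<in> K" and one: "\<one>\<^bsub>G\<^esub> \<in> K"
    and d: "d > 0" and red: "\<not> irreducible_rep G K d \<rho>"
  obtains d1 d2 \<rho>1 \<rho>2 where "is_rep G K d1 \<rho>1" "is_rep G K d2 \<rho>2" "0 < d1" "d1 < d" "0 < d2" "d2 < d"
    "\<And>x. x \<in> K \<Longrightarrow> mat_trace (\<rho> x) = mat_trace (\<rho>1 x) + mat_trace (\<rho>2 x)"
proof -
  obtain W where W: "vsubspace d W" "W \<noteq> {0\<^sub>v d}" "W \<noteq> carrier_vec d"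
    and inv: "\<And>x w. x \<in> K \<Longrightarrow> w \<in> W \<Longrightarrow> \<rho> x *\<^sub>v w \<in> W"
    using red rep d unfolding irreducible_rep_def vsubspace_def by blast
  obtain A B I where A: "A \<in> carrier_mat d d" and B: "B \<in> carrier_mat d d"
    and AB: "A * B = 1\<^sub>m d" "B * A = 1\<^sub>m d"
    and I: "I \<subseteq> {..<d}" "I \<noteq> {}" "I \<noteq> {..<d}" and col: "\<And>i. i \<in> I \<Longrightarrow> col A i \<in> W"
    and coord: "\<And>w i. w \<in> W \<Longrightarrow> i < d \<Longrightarrow> i \<notin> I \<Longrightarrow> (B *\<^sub>v w) $ i = 0"
    using adapted_basis[OF W] by metis
  define R where "R x = B * \<rho> x * A" for x
  have repR: "is_rep G K d R" unfolding R_def by (rule is_rep_conj[OF rep A B AB])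
  have R0: "R x $$ (i,j) = 0" if "x \<in> K" "i < d" "i \<notin> I" "j \<in> I" for x i j
  proof -
    have c: "\<rho> x \<in> carrier_mat d d" using rep that by (auto simp: is_rep_def)
    have "R x $$ (i,j) = (B * (\<rho> x * A)) $$ (i,j)"
      unfolding R_def using A B c by (simp add: assoc_mult_mat[of _ d d _ d _ d])
    also have "\<dots> = (B *\<^sub>v (\<rho> x *\<^sub>v col A j)) $ i"
      using A B c that I by (auto simp: col_mult2[of _ d d _ d])
    also have "\<dots> = 0" using coord inv col that by blast
    finally show ?thesis .
  qed
  let ?J = "{..<d} - I"
  obtain \<rho>1 where r1: "is_rep G K (card I) \<rho>1" "\<And>x. mat_trace (\<rho>1 x) = (\<Sum>i\<in>I. R x $$ (i,i))"
  proof (rule sub_rep[OF repR K one I(1)])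
    show "\<forall>x\<in>K. \<forall>y\<in>K. \<forall>i\<in>I. \<forall>j\<in>I. \<forall>l<d. l \<notin> I \<longrightarrow> R x $$ (i,l) * R y $$ (l,j) = 0"
      using R0 by auto
  qed blast
  obtain \<rho>2 where r2: "is_rep G K (card ?J) \<rho>2" "\<And>x. mat_trace (\<rho>2 x) = (\<Sum>i\<in>?J. R x $$ (i,i))"
  proof (rule sub_rep[OF repR K one])
    show "?J \<subseteq> {..<d}" by blast
    show "\<forall>x\<in>K. \<forall>y\<in>K. \<forall>i\<in>?J. \<forall>j\<in>?J. \<forall>l<d. l \<notin> ?J \<longrightarrow> R x $$ (i,l) * R y $$ (l,j) = 0"
      using R0 by auto
  qed blast
  have fin: "finite I" using I finite_subset by blast
  have tr: "mat_trace (\<rho> x) = mat_trace (\<rho>1 x) + mat_trace (\<rho>2 x)" if "x \<in> K" for x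
  proof -
    have c: "\<rho> x \<in> carrier_mat d d" using rep that by (auto simp: is_rep_def)
    have "mat_trace (\<rho> x) = mat_trace (R x)"
      unfolding R_def using mat_trace_conj[of B d A "\<rho> x"] A B AB c by simp
    also have "\<dots> = (\<Sum>i<d. R x $$ (i,i))" using A B c by (simp add: mat_trace_def R_def)
    also have "\<dots> = (\<Sum>i\<in>I. R x $$ (i,i)) + (\<Sum>i\<in>?J. R x $$ (i,i))"
      using sum.subset_diff[OF I(1), of "\<lambda>i. R x $$ (i,i)"] by simp
    finally show ?thesis using r1 r2 by simp
  qed
  have cI: "0 < card I" using fin I by (simp add: card_gt_0_iff)
  have cJ: "card I + card ?J = d"
    using I fin by (metis card_Diff_subset card_lessThan card_mono finite_lessThan le_add_diff_inverse)
  have "?J \<noteq> {}" using I by blast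
  then have "0 < card ?J" by (metis card_gt_0_iff finite_Diff finite_lessThan)
  with cI cJ show ?thesis using that[OF r1(1) r2(1) _ _ _ _ tr] by linarith
qed

section \<open>Schur's lemma and orthogonality relations\<close>

lemma sq_mult_carrier [simp]: "A \<in> carrier_mat d d \<Longrightarrow> B \<in> carrier_mat d d \<Longrightarrow> A * B \<in> carrier_mat d d"
  by (rule mult_carrier_mat)

lemma irreducible_invariant:
  assumes irr: "irreducible_rep G K d \<rho>" and W: "vsubspace d W"
    and inv: "\<And>x w. x \<in> K \<Longrightarrow> w \<in> W \<Longrightarrow> \<rho> x *\<^sub>v w \<in> W"
  shows "W = {0\<^sub>v d} \<or> W = carrier_vec d"
proof (rule ccontr)
  assume "\<not> ?thesis"
  then have "\<exists>W. W \<subseteq> carrier_vec d \<and> 0\<^sub>v d \<in> W \<and> (\<forall>v\<in>W. \<forall>w\<in>W. v + w \<in> W) \<and>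
      (\<forall>c. \<forall>v\<in>W. c \<cdot>\<^sub>v v \<in> W) \<and> W \<noteq> {0\<^sub>v d} \<and> W \<noteq> carrier_vec d \<and> (\<forall>x\<in>K. \<forall>w\<in>W. \<rho> x *\<^sub>v w \<in> W)"
    using W inv by (intro exI[of _ W]) (simp add: vsubspace_def)
  then show False using irr unfolding irreducible_rep_def by (elim conjE) (erule notE, assumption)
qed

text \<open>An eigenspace of \<open>A\<close> is nonzero and invariant under \<rho>, hence the whole
  space.\<close>

lemma schur_scalar:
  assumes irr: "irreducible_rep G K d \<rho>" and A: "A \<in> carrier_mat d d"
    and comm: "\<And>x. x \<in> K \<Longrightarrow> \<rho> x * A = A * \<rho> x"
  obtains c where "A = c \<cdot>\<^sub>m 1\<^sub>m d"
proof -
  have d: "d > 0" and rc: "\<And>x. x \<in> K \<Longrightarrow> \<rho> x \<in> carrier_mat d d"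
    using irr by (auto simp: irreducible_rep_def is_rep_def)
  obtain k v where v: "v \<in> carrier_vec d" "v \<noteq> 0\<^sub>v d" "A *\<^sub>v v = k \<cdot>\<^sub>v v"
    using spectrum_non_empty[OF A d] A by (auto simp: spectrum_def eigenvalue_def eigenvector_def)
  define W where "W = {v \<in> carrier_vec d. A *\<^sub>v v = k \<cdot>\<^sub>v v}"
  have 1: "W \<subseteq> carrier_vec d" "0\<^sub>v d \<in> W" using A by (auto simp: W_def intro!: eq_vecI)
  have 2: "v + w \<in> W" if "v \<in> W" "w \<in> W" for v w
    using that A by (auto simp: W_def mult_add_distrib_mat_vec smult_add_distrib_vec)
  have 3: "c \<cdot>\<^sub>v v \<in> W" if "v \<in> W" for c v
    using that A by (auto simp: W_def mult_mat_vec smult_smult_assoc mult.commute)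
  have 4: "\<rho> x *\<^sub>v w \<in> W" if "x \<in> K" "w \<in> W" for x w
  proof -
    have w: "w \<in> carrier_vec d" using that by (simp add: W_def)
    have "A *\<^sub>v (\<rho> x *\<^sub>v w) = \<rho> x *\<^sub>v (A *\<^sub>v w)"
      using assoc_mult_mat_vec[OF A rc[OF that(1)] w] assoc_mult_mat_vec[OF rc[OF that(1)] A w]
        comm[OF that(1)] by simp
    then show ?thesis using that A rc[OF that(1)] by (simp add: W_def mult_mat_vec)
  qed
  have "W \<noteq> {0\<^sub>v d}" using v by (auto simp: W_def)
  then have "W = carrier_vec d"
    using irreducible_invariant[OF irr _ 4] 1 2 3 by (auto simp: vsubspace_def)
  then have eig: "A *\<^sub>v w = k \<cdot>\<^sub>v w" if "w \<in> carrier_vec d" for w using that by (auto simp: W_def)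
  have "A = k \<cdot>\<^sub>m 1\<^sub>m d"
  proof (rule eq_matI)
    fix i j assume "i < dim_row (k \<cdot>\<^sub>m 1\<^sub>m d)" "j < dim_col (k \<cdot>\<^sub>m 1\<^sub>m d)"
    then have ij: "i < d" "j < d" by auto
    have "A $$ (i,j) = (A *\<^sub>v unit_vec d j) $ i" using A ij by auto
    also have "\<dots> = (k \<cdot>\<^sub>m 1\<^sub>m d) $$ (i,j)" using eig[of "unit_vec d j"] ij by auto
    finally show "A $$ (i,j) = (k \<cdot>\<^sub>m 1\<^sub>m d) $$ (i,j)" .
  qed (use A in auto)
  then show ?thesis using that by blast
qed

definition mat_unit :: "nat \<Rightarrow> nat \<Rightarrow> nat \<Rightarrow> complex mat" where
  "mat_unit d j k = mat d d (\<lambda>(a,b). if a = j \<and> b = k then 1 else 0)"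

lemma mat_unit_carrier [simp]: "mat_unit d j k \<in> carrier_mat d d"
  by (simp add: mat_unit_def)

lemma mat_trace_unit: "j < d \<Longrightarrow> k < d \<Longrightarrow> mat_trace (mat_unit d j k) = (if j = k then 1 else 0)"
  by (auto simp: mat_trace_def mat_unit_def intro!: sum.neutral)

text \<open>Matrix units extract single products of entries: put in place of the free matrix
  \<open>B\<close>, they turn the average in \<open>schur_rep\<close> into relations between matrix
  entries.\<close>

lemma mult_unit_mult_index:
  assumes A: "A \<in> carrier_mat n d" and C: "C \<in> carrier_mat d m" and "i < n" "j < d" "k < d" "l < m"
  shows "(A * mat_unit d j k * C) $$ (i,l) = A $$ (i,j) * C $$ (k,l)"
proof -
  have AU: "(A * mat_unit d j k) $$ (i,b) = (if b = k then A $$ (i,j) else 0)" if "b < d" for b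
  proof -
    have "(A * mat_unit d j k) $$ (i,b) = (\<Sum>a<d. A $$ (i,a) * mat_unit d j k $$ (a,b))"
      using assms that by (intro mat_mult_index) auto
    also have "\<dots> = (\<Sum>a<d. if a = j then (if b = k then A $$ (i,j) else 0) else 0)"
      using that by (intro sum.cong) (auto simp: mat_unit_def)
    finally show ?thesis using assms by simp
  qed
  have "(A * mat_unit d j k * C) $$ (i,l) = (\<Sum>b<d. (A * mat_unit d j k) $$ (i,b) * C $$ (b,l))"
    using assms by (intro mat_mult_index) auto
  also have "\<dots> = (\<Sum>b<d. if b = k then A $$ (i,j) * C $$ (k,l) else 0)"
    using AU by (intro sum.cong) auto
  finally show ?thesis using assms by simp
qed

lemma mat_trace_mult:
  assumes "A \<in> carrier_mat n m" "B \<in> carrier_mat m n"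
  shows "mat_trace (A * B) = (\<Sum>i<n. \<Sum>j<m. A $$ (i,j) * B $$ (j,i))"
proof -
  have "mat_trace (A * B) = (\<Sum>i<n. (A * B) $$ (i,i))" using assms by (simp add: mat_trace_def)
  also have "\<dots> = (\<Sum>i<n. \<Sum>j<m. A $$ (i,j) * B $$ (j,i))"
    using mat_mult_index[OF assms] by (intro sum.cong) auto
  finally show ?thesis .
qed

section \<open>Averages over subgroups of a finite group\<close>

locale fin_group = group G for G (structure) +
  assumes fin [simp]: "finite (carrier G)"
begin

lemma subgroup_finite: "subgroup K G \<Longrightarrow> finite K"
  using fin finite_subset subgroup.subset by blast

lemma subgroup_card: "subgroup K G \<Longrightarrow> card K > 0"
  using subgroup_finite subgroup.one_closed card_gt_0_iff by blast

lemma sum_mult_left: "subgroup K G \<Longrightarrow> h \<in> K \<Longrightarrow> (\<Sum>y\<in>K. f (h \<otimes> y)) = sum f K"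
  by (rule sum.reindex_bij_witness[where i = "\<lambda>y. inv h \<otimes> y" and j = "\<lambda>y. h \<otimes> y"])
    (auto simp: subgroup.m_closed subgroup.m_inv_closed subgroup.mem_carrier simp flip: m_assoc)

lemma sum_mult_right: "subgroup K G \<Longrightarrow> h \<in> K \<Longrightarrow> (\<Sum>y\<in>K. f (y \<otimes> h)) = sum f K"
  by (rule sum.reindex_bij_witness[where i = "\<lambda>y. y \<otimes> inv h" and j = "\<lambda>y. y \<otimes> h"])
    (auto simp: subgroup.m_closed subgroup.m_inv_closed subgroup.mem_carrier m_assoc)

lemma sum_inv: "subgroup K G \<Longrightarrow> (\<Sum>y\<in>K. f (inv y)) = sum f K"
  by (rule sum.reindex_bij_witness[where i = "\<lambda>y. inv y" and j = "\<lambda>y. inv y"])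
    (auto simp: subgroup.m_inv_closed subgroup.mem_carrier)

text \<open>Schur's lemma in averaged form, isolated as a property of its own. The orthogonality
  relations rest on it, and it passes along similarity; this is how it reaches the restriction of
  \<open>P\<close> to \<open>N\<close>, which is known only through its trace.\<close>

definition schur_rep :: "'a set \<Rightarrow> nat \<Rightarrow> ('a \<Rightarrow> complex mat) \<Rightarrow> bool" where
  "schur_rep K d P \<longleftrightarrow> is_rep G K d P \<and> d > 0 \<and> (\<forall>B\<in>carrier_mat d d.
     msum d (\<lambda>g. P g * B * P (inv g)) K = (of_nat (card K) * mat_trace B / of_nat d) \<cdot>\<^sub>m 1\<^sub>m d)"

lemma rep_inv:
  assumes "is_rep G K d \<rho>" "subgroup K G" "x \<in> K"
  shows "\<rho> x * \<rho> (inv x) = 1\<^sub>m d" "\<rho> (inv x) * \<rho> x = 1\<^sub>m d"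
proof -
  have "\<rho> (x \<otimes> inv x) = \<rho> x * \<rho> (inv x)" "\<rho> (inv x \<otimes> x) = \<rho> (inv x) * \<rho> x"
    using assms by (auto simp: is_rep_def subgroup.m_inv_closed)
  then show "\<rho> x * \<rho> (inv x) = 1\<^sub>m d" "\<rho> (inv x) * \<rho> x = 1\<^sub>m d"
    using assms by (auto simp: is_rep_def subgroup.mem_carrier)
qed

text \<open>Replacing \<open>g\<close> by \<open>h \<otimes> g\<close> moves \<open>P h\<close> out
  of the sum on the left and \<open>Q (inv h)\<close> out on the right. With \<open>P = Q\<close>
  this leads to Schur's lemma, with different representations to a comparison of the two.\<close>

lemma intertwiner_average:
  assumes P: "is_rep G K d P" and Q: "is_rep G K d Q" and K: "subgroup K G"
    and B: "B \<in> carrier_mat d d" and h: "h \<in> K"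
  shows "P h * msum d (\<lambda>g. P g * B * Q (inv g)) K = msum d (\<lambda>g. P g * B * Q (inv g)) K * Q h"
proof -
  let ?F = "\<lambda>g. P g * B * Q (inv g)"
  have c: "P g \<in> carrier_mat d d" "Q g \<in> carrier_mat d d" "Q (inv g) \<in> carrier_mat d d" if "g \<in> K" for g
    using P Q that K by (auto simp: is_rep_def subgroup.m_inv_closed)
  have "(\<otimes>) h ` K = K"
  proof
    show "K \<subseteq> (\<otimes>) h ` K"
    proof
      fix y assume y: "y \<in> K"
      then have "y = h \<otimes> (inv h \<otimes> y)" using h K
        by (simp add: subgroup.mem_carrier flip: m_assoc)
      then show "y \<in> (\<otimes>) h ` K" using h y K by (auto simp: subgroup.m_closed subgroup.m_inv_closed)
    qed
  qed (use h K in \<open>auto simp: subgroup.m_closed\<close>)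
  moreover have "inj_on ((\<otimes>) h) K"
    by (rule inj_on_inverseI[of _ "(\<otimes>) (inv h)"]) (use h K in \<open>simp add: subgroup.mem_carrier flip: m_assoc\<close>)
  ultimately have "msum d ?F K = msum d (\<lambda>g. ?F (h \<otimes> g)) K"
    using msum_reindex[of "(\<otimes>) h" K d ?F] by simp
  then have "msum d ?F K * Q h = msum d (\<lambda>g. ?F (h \<otimes> g) * Q h) K"
    using c[OF h] c[OF subgroup.m_closed[OF K h]] B by (simp add: msum_mult)
  also have "\<dots> = msum d (\<lambda>g. P h * ?F g) K"
  proof (rule msum_cong)
    fix g assume g: "g \<in> K"
    have "inv (h \<otimes> g) = inv g \<otimes> inv h" using g h K by (simp add: inv_mult_group subgroup.mem_carrier)
    then have "?F (h \<otimes> g) * Q h = P h * P g * B * (Q (inv g) * Q (inv h)) * Q h"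
      using P Q g h K by (simp add: is_rep_def subgroup.m_inv_closed)
    also have "\<dots> = P h * P g * B * Q (inv g) * (Q (inv h) * Q h)"
      using c[OF g] c[OF h] B by (simp add: assoc_mult_mat[of _ d d _ d _ d])
    also have "\<dots> = P h * ?F g"
      using c[OF g] c[OF h] B rep_inv[OF Q K h] by (simp add: assoc_mult_mat[of _ d d _ d _ d])
    finally show "?F (h \<otimes> g) * Q h = P h * ?F g" .
  qed
  also have "\<dots> = P h * msum d ?F K"
    using c h B by (intro mult_msum[symmetric]) auto
  finally show ?thesis by simp
qed

text \<open>The average commutes with \<rho> and is therefore scalar; its trace determines the
  scalar.\<close>

lemma irreducible_schur_rep:
  assumes irr: "irreducible_rep G K d \<rho>" and K: "subgroup K G"
  shows "schur_rep K d \<rho>"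
  unfolding schur_rep_def
proof (intro conjI ballI)
  show rep: "is_rep G K d \<rho>" and d: "d > 0" using irr by (auto simp: irreducible_rep_def)
  fix B :: "complex mat" assume B: "B \<in> carrier_mat d d"
  let ?X = "msum d (\<lambda>g. \<rho> g * B * \<rho> (inv g)) K"
  have c: "\<rho> g \<in> carrier_mat d d" "\<rho> (inv g) \<in> carrier_mat d d" if "g \<in> K" for g
    using rep that K by (auto simp: is_rep_def subgroup.m_inv_closed)
  have "\<rho> x * ?X = ?X * \<rho> x" if "x \<in> K" for x
    by (rule intertwiner_average[OF rep rep K B that])
  then obtain k where k: "?X = k \<cdot>\<^sub>m 1\<^sub>m d" using schur_scalar[OF irr msum_carrier] by blast
  have "mat_trace ?X = (\<Sum>g\<in>K. mat_trace (\<rho> g * B * \<rho> (inv g)))"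
    using c B by (intro trace_msum) auto
  also have "\<dots> = (\<Sum>g\<in>K. mat_trace B)"
    using c B rep_inv[OF rep K] by (intro sum.cong mat_trace_conj) auto
  finally have "k * of_nat d = of_nat (card K) * mat_trace B"
    by (simp add: k mat_trace_smult[of _ d])
  then have "k = of_nat (card K) * mat_trace B / of_nat d" using d by (simp add: field_simps)
  then show "?X = (of_nat (card K) * mat_trace B / of_nat d) \<cdot>\<^sub>m 1\<^sub>m d" using k by simp
qed

lemma schur_rep_entries:
  assumes P: "schur_rep K d P" and K: "subgroup K G" and "i < d" "j < d" "k < d" "l < d"
  shows "(\<Sum>g\<in>K. P g $$ (i,j) * P (inv g) $$ (k,l)) =
    (if i = l \<and> j = k then of_nat (card K) / of_nat d else 0)"
proof -
  have c: "P g \<in> carrier_mat d d" "P (inv g) \<in> carrier_mat d d" if "g \<in> K" for g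
    using P that K by (auto simp: schur_rep_def is_rep_def subgroup.m_inv_closed)
  have "(\<Sum>g\<in>K. P g $$ (i,j) * P (inv g) $$ (k,l)) = (\<Sum>g\<in>K. (P g * mat_unit d j k * P (inv g)) $$ (i,l))"
    using c assms by (intro sum.cong refl mult_unit_mult_index[symmetric]) auto
  also have "\<dots> = msum d (\<lambda>g. P g * mat_unit d j k * P (inv g)) K $$ (i,l)"
    using assms by (simp add: msum_index)
  also have "\<dots> = ((of_nat (card K) * mat_trace (mat_unit d j k) / of_nat d) \<cdot>\<^sub>m 1\<^sub>m d) $$ (i,l)"
    using P by (simp add: schur_rep_def)
  also have "\<dots> = (if i = l \<and> j = k then of_nat (card K) / of_nat d else 0)"
    using assms by (simp add: mat_trace_unit)
  finally show ?thesis .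
qed

lemma schur_trace_conj:
  assumes P: "schur_rep K d P" and K: "subgroup K G" and A: "A \<in> carrier_mat d d" and B: "B \<in> carrier_mat d d"
  shows "(\<Sum>g\<in>K. mat_trace (A * (P g * B * P (inv g)))) = of_nat (card K) / of_nat d * mat_trace A * mat_trace B"
proof -
  have c: "P g \<in> carrier_mat d d" "P (inv g) \<in> carrier_mat d d" if "g \<in> K" for g
    using P that K by (auto simp: schur_rep_def is_rep_def subgroup.m_inv_closed)
  have "(\<Sum>g\<in>K. mat_trace (A * (P g * B * P (inv g)))) = mat_trace (msum d (\<lambda>g. A * (P g * B * P (inv g))) K)"
    using c A B by (intro trace_msum[symmetric]) auto
  also have "msum d (\<lambda>g. A * (P g * B * P (inv g))) K = A * msum d (\<lambda>g. P g * B * P (inv g)) K"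
    using c A B by (intro mult_msum[symmetric]) auto
  also have "\<dots> = A * ((of_nat (card K) * mat_trace B / of_nat d) \<cdot>\<^sub>m 1\<^sub>m d)"
    using P B by (simp add: schur_rep_def)
  also have "\<dots> = (of_nat (card K) * mat_trace B / of_nat d) \<cdot>\<^sub>m A"
    using A by (simp add: mult_smult_distrib[of _ d d _ d])
  finally show ?thesis using A by (simp add: mat_trace_smult)
qed

text \<open>Orthogonality of matrix entries with free factors \<open>A\<close> and \<open>B\<close>.
  With values of a projective representation in their place it evaluates sums over cosets of
  \<open>N\<close>.\<close>

lemma schur_trace_prod:
  assumes P: "schur_rep K d P" and K: "subgroup K G" and A: "A \<in> carrier_mat d d" and B: "B \<in> carrier_mat d d"
  shows "(\<Sum>g\<in>K. mat_trace (P g * A) * mat_trace (P (inv g) * B)) = of_nat (card K) / of_nat d * mat_trace (A * B)"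
proof -
  let ?c = "of_nat (card K) / of_nat d :: complex"
  have c: "P g \<in> carrier_mat d d" "P (inv g) \<in> carrier_mat d d" if "g \<in> K" for g
    using P that K by (auto simp: schur_rep_def is_rep_def subgroup.m_inv_closed)
  have "(\<Sum>g\<in>K. mat_trace (P g * A) * mat_trace (P (inv g) * B)) =
    (\<Sum>g\<in>K. (\<Sum>i<d. \<Sum>j<d. P g $$ (i,j) * A $$ (j,i)) * (\<Sum>k<d. \<Sum>l<d. P (inv g) $$ (k,l) * B $$ (l,k)))"
    using c A B mat_trace_mult by (intro sum.cong refl arg_cong2[of _ _ _ _ "(*)"]) auto
  also have "\<dots> = (\<Sum>g\<in>K. \<Sum>i<d. \<Sum>k<d. \<Sum>j<d. \<Sum>l<d. (P g $$ (i,j) * P (inv g) $$ (k,l)) * (A $$ (j,i) * B $$ (l,k)))"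
    unfolding sum_product by (intro sum.cong refl) (simp add: mult_ac)
  also have "\<dots> = (\<Sum>i<d. \<Sum>k<d. \<Sum>j<d. \<Sum>l<d. (\<Sum>g\<in>K. P g $$ (i,j) * P (inv g) $$ (k,l)) * (A $$ (j,i) * B $$ (l,k)))"
    by (simp only: sum_distrib_right sum.swap[where A = K])
  also have "\<dots> = (\<Sum>i<d. \<Sum>k<d. \<Sum>j<d. \<Sum>l<d. if l = i then (if j = k then ?c * (A $$ (j,i) * B $$ (i,j)) else 0) else 0)"
    by (intro sum.cong refl, subst schur_rep_entries[OF P K]) auto
  also have "\<dots> = (\<Sum>i<d. \<Sum>j<d. ?c * (A $$ (j,i) * B $$ (i,j)))"
    by simp
  also have "\<dots> = ?c * (\<Sum>j<d. \<Sum>i<d. A $$ (j,i) * B $$ (i,j))"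
    by (subst sum.swap) (simp add: sum_distrib_left)
  finally show ?thesis using mat_trace_mult[OF A B] by simp
qed

text \<open>If all averaged intertwiners vanished, the sum of
  \<open>mat_trace (P g) * mat_trace (\<rho> (inv g))\<close> over \<open>K\<close> would be 0,
  while equality of the traces makes it \<open>card K\<close>. The kernel of a nonzero intertwiner
  \<open>X\<close> is invariant, hence 0 by irreducibility; the trace at \<one> equates the
  dimensions, so \<open>X\<close> is invertible.\<close>

lemma rep_similar_irreducible:
  assumes irr: "irreducible_rep G K d \<rho>" and K: "subgroup K G" and P: "is_rep G K d' P"
    and tr: "\<And>x. x \<in> K \<Longrightarrow> mat_trace (P x) = mat_trace (\<rho> x)"
  obtains X Y where "d' = d" "X \<in> carrier_mat d d" "Y \<in> carrier_mat d d" "X * Y = 1\<^sub>m d" "Y * X = 1\<^sub>m d"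
    "\<And>x. x \<in> K \<Longrightarrow> P x = X * \<rho> x * Y"
proof -
  have rep: "is_rep G K d \<rho>" and d: "d > 0" using irr by (auto simp: irreducible_rep_def)
  note sr = irreducible_schur_rep[OF irr K]
  have one: "\<one> \<in> K" using K by (rule subgroup.one_closed)
  have "of_nat d' = (of_nat d :: complex)" using tr[OF one] P rep by (simp add: is_rep_def)
  then have dd: "d' = d" by simp
  note P = P[unfolded dd]
  have c: "\<rho> g \<in> carrier_mat d d" "\<rho> (inv g) \<in> carrier_mat d d" "P g \<in> carrier_mat d d" if "g \<in> K" for g
    using rep P that K by (auto simp: is_rep_def subgroup.m_inv_closed)
  let ?X = "\<lambda>B. msum d (\<lambda>g. P g * B * \<rho> (inv g)) K"
  have "\<exists>B \<in> carrier_mat d d. ?X B \<noteq> 0\<^sub>m d d"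
  proof (rule ccontr)
    assume "\<not> ?thesis"
    then have X0: "?X B = 0\<^sub>m d d" if "B \<in> carrier_mat d d" for B using that by blast
    have z: "(\<Sum>g\<in>K. P g $$ (i,i) * \<rho> (inv g) $$ (l,l)) = 0" if "i < d" "l < d" for i l
    proof -
      have "(\<Sum>g\<in>K. P g $$ (i,i) * \<rho> (inv g) $$ (l,l)) = (\<Sum>g\<in>K. (P g * mat_unit d i l * \<rho> (inv g)) $$ (i,l))"
        using c that by (intro sum.cong refl mult_unit_mult_index[symmetric]) auto
      also have "\<dots> = ?X (mat_unit d i l) $$ (i,l)" using that by (simp add: msum_index)
      finally show ?thesis using X0[of "mat_unit d i l"] that by simp
    qed
    have "(\<Sum>g\<in>K. mat_trace (\<rho> g * 1\<^sub>m d) * mat_trace (\<rho> (inv g) * 1\<^sub>m d)) =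
      (\<Sum>g\<in>K. mat_trace (P g) * mat_trace (\<rho> (inv g)))"
      using c tr by (intro sum.cong) (auto simp: right_mult_one_mat[of _ d d])
    also have "\<dots> = (\<Sum>g\<in>K. \<Sum>i<d. \<Sum>l<d. P g $$ (i,i) * \<rho> (inv g) $$ (l,l))"
      by (intro sum.cong refl) (simp add: mat_trace_def sum_product carrier_matD[OF c(2)] carrier_matD[OF c(3)])
    also have "\<dots> = (\<Sum>i<d. \<Sum>l<d. \<Sum>g\<in>K. P g $$ (i,i) * \<rho> (inv g) $$ (l,l))"
      by (simp only: sum.swap[where A = K])
    also have "\<dots> = 0" using z by simp
    finally have "of_nat (card K) / of_nat d * mat_trace (1\<^sub>m d * 1\<^sub>m d :: complex mat) = 0"
      using schur_trace_prod[OF sr K, of "1\<^sub>m d" "1\<^sub>m d"] by simp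
    then show False using d subgroup_card[OF K] by simp
  qed
  then obtain B where B: "B \<in> carrier_mat d d" and Xnz: "?X B \<noteq> 0\<^sub>m d d" by blast
  define X where "X = ?X B"
  have X: "X \<in> carrier_mat d d" by (simp add: X_def)
  have PX: "P h * X = X * \<rho> h" if "h \<in> K" for h
    unfolding X_def by (rule intertwiner_average[OF P rep K B that])
  define W where "W = {v \<in> carrier_vec d. X *\<^sub>v v = 0\<^sub>v d}"
  have 1: "W \<subseteq> carrier_vec d" "0\<^sub>v d \<in> W" using X by (auto simp: W_def intro!: eq_vecI)
  have 2: "v + w \<in> W" if "v \<in> W" "w \<in> W" for v w
    using that X by (auto simp: W_def mult_add_distrib_mat_vec)
  have 3: "k \<cdot>\<^sub>v v \<in> W" if "v \<in> W" for k v
    using that X by (auto simp: W_def mult_mat_vec)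
  have 4: "\<rho> x *\<^sub>v w \<in> W" if "x \<in> K" "w \<in> W" for x w
  proof -
    have w: "w \<in> carrier_vec d" "X *\<^sub>v w = 0\<^sub>v d" using that by (auto simp: W_def)
    have "X *\<^sub>v (\<rho> x *\<^sub>v w) = P x *\<^sub>v (X *\<^sub>v w)"
      using assoc_mult_mat_vec[OF X c(1)[OF that(1)] w(1)] assoc_mult_mat_vec[OF c(3)[OF that(1)] X w(1)]
        PX[OF that(1)] by simp
    also have "\<dots> = 0\<^sub>v d" using w c[OF that(1)] by (auto intro!: eq_vecI)
    finally show ?thesis using w c[OF that(1)] by (simp add: W_def)
  qed
  have "W \<noteq> carrier_vec d"
  proof
    assume "W = carrier_vec d"
    then have "unit_vec d j \<in> W" for j by simp
    then have u: "X *\<^sub>v unit_vec d j = 0\<^sub>v d" for j unfolding W_def by blast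
    have "X $$ (i,j) = 0" if "i < d" "j < d" for i j
    proof -
      have "X $$ (i,j) = (X *\<^sub>v unit_vec d j) $ i" using X that by auto
      then show ?thesis using u that by simp
    qed
    then have "X = 0\<^sub>m d d" using X by (intro eq_matI) auto
    then show False using Xnz by (simp add: X_def)
  qed
  then have "W = {0\<^sub>v d}"
    using irreducible_invariant[OF irr _ 4] 1 2 3 by (auto simp: vsubspace_def)
  then have "v = 0\<^sub>v d" if "v \<in> carrier_vec d" "X *\<^sub>v v = 0\<^sub>v d" for v using that by (auto simp: W_def)
  then obtain Y where Y: "Y \<in> carrier_mat d d" "X * Y = 1\<^sub>m d" "Y * X = 1\<^sub>m d"
    using inj_mat_inverse[OF X] by blast
  have "P x = X * \<rho> x * Y" if "x \<in> K" for x
  proof -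
    have "X * \<rho> x * Y = P x * (X * Y)"
      using assoc_mult_mat[OF c(3)[OF that] X Y(1)] PX[OF that] by simp
    then show ?thesis using Y c[OF that] by simp
  qed
  then show ?thesis using that[OF dd X Y] by blast
qed

text \<open>Similarity with the irreducible representation carries the averaging property over,
  because \<open>Y * B * X\<close> has the same trace as \<open>B\<close>.\<close>

lemma schur_rep_if_same_char:
  assumes irr: "irreducible_rep G K d \<rho>" and K: "subgroup K G" and P: "is_rep G K d' P"
    and tr: "\<And>x. x \<in> K \<Longrightarrow> mat_trace (P x) = mat_trace (\<rho> x)"
  shows "schur_rep K d' P"
proof -
  obtain X Y where dd: "d' = d" and XY: "X \<in> carrier_mat d d" "Y \<in> carrier_mat d d" "X * Y = 1\<^sub>m d" "Y * X = 1\<^sub>m d"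
    and PX: "\<And>x. x \<in> K \<Longrightarrow> P x = X * \<rho> x * Y"
    using rep_similar_irreducible[OF irr K P tr] by metis
  have sr: "schur_rep K d \<rho>" by (rule irreducible_schur_rep[OF irr K])
  then have c: "\<rho> g \<in> carrier_mat d d" "\<rho> (inv g) \<in> carrier_mat d d" if "g \<in> K" for g
    using that K by (auto simp: schur_rep_def is_rep_def subgroup.m_inv_closed)
  have "msum d (\<lambda>g. P g * B * P (inv g)) K = (of_nat (card K) * mat_trace B / of_nat d) \<cdot>\<^sub>m 1\<^sub>m d"
    if B: "B \<in> carrier_mat d d" for B
  proof -
    let ?B = "Y * B * X"
    have B': "?B \<in> carrier_mat d d" using B XY by auto
    have "msum d (\<lambda>g. P g * B * P (inv g)) K = msum d (\<lambda>g. X * (\<rho> g * ?B * \<rho> (inv g)) * Y) K"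
    proof (rule msum_cong)
      fix g assume g: "g \<in> K"
      then show "P g * B * P (inv g) = X * (\<rho> g * ?B * \<rho> (inv g)) * Y"
        using PX[OF g] PX[of "inv g"] K XY(1,2) B c[OF g]
        by (simp add: subgroup.m_inv_closed assoc_mult_mat[of _ d d _ d _ d])
    qed
    also have "\<dots> = X * msum d (\<lambda>g. \<rho> g * ?B * \<rho> (inv g)) K * Y"
    proof -
      have "X * msum d (\<lambda>g. \<rho> g * ?B * \<rho> (inv g)) K = msum d (\<lambda>g. X * (\<rho> g * ?B * \<rho> (inv g))) K"
        using c B' XY by (intro mult_msum) auto
      also have "\<dots> * Y = msum d (\<lambda>g. X * (\<rho> g * ?B * \<rho> (inv g)) * Y) K"
        using c B' XY by (intro msum_mult) auto
      finally show ?thesis by simp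
    qed
    also have "\<dots> = X * ((of_nat (card K) * mat_trace ?B / of_nat d) \<cdot>\<^sub>m 1\<^sub>m d) * Y"
      using sr B' by (simp add: schur_rep_def)
    also have "mat_trace ?B = mat_trace B" using mat_trace_conj[of Y d X B] XY B by simp
    also have "X * ((of_nat (card K) * mat_trace B / of_nat d) \<cdot>\<^sub>m 1\<^sub>m d) * Y =
        (of_nat (card K) * mat_trace B / of_nat d) \<cdot>\<^sub>m 1\<^sub>m d"
      using XY by (simp add: mult_smult_distrib[of _ d d _ d] mult_smult_assoc_mat[of _ d d _ d])
    finally show ?thesis .
  qed
  then show ?thesis using P dd sr by (simp add: schur_rep_def)
qed

end

section \<open>The group algebra and irreducible characters\<close>

context fin_group
begin

section \<open>Convolution, conjugation and class functions\<close>

definition conv :: "('a \<Rightarrow> complex) \<Rightarrow> ('a \<Rightarrow> complex) \<Rightarrow> 'a \<Rightarrow> complex" where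
  "conv f g = (\<lambda>x. if x \<in> carrier G then \<Sum>y\<in>carrier G. f y * g (inv y \<otimes> x) else 0)"

definition cj :: "'a \<Rightarrow> ('a \<Rightarrow> complex) \<Rightarrow> 'a \<Rightarrow> complex" where
  "cj g f = (\<lambda>x. if x \<in> carrier G then f (g \<otimes> x \<otimes> inv g) else 0)"

text \<open>The centre of the group algebra of \<open>K\<close>, its elements extended by zero to
  \<open>G\<close>. In this way \<open>G\<close>, its subgroups and all their characters share one
  convolution.\<close>

definition ZC :: "'a set \<Rightarrow> ('a \<Rightarrow> complex) set" where
  "ZC K = {f. (\<forall>x. x \<notin> K \<longrightarrow> f x = 0) \<and> (\<forall>k\<in>K. \<forall>x\<in>K. f (k \<otimes> x \<otimes> inv k) = f x)}"

lemma inv_mult_cancel [simp]: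
  assumes "g \<in> carrier G" "z \<in> carrier G"
  shows "inv g \<otimes> (g \<otimes> z) = z" "g \<otimes> (inv g \<otimes> z) = z"
  using assms by (simp_all flip: m_assoc)

lemma sum_G_left: "h \<in> carrier G \<Longrightarrow> (\<Sum>y\<in>carrier G. f (h \<otimes> y)) = sum f (carrier G)"
  by (rule sum_mult_left[OF subgroup_self])

lemma sum_G_right: "h \<in> carrier G \<Longrightarrow> (\<Sum>y\<in>carrier G. f (y \<otimes> h)) = sum f (carrier G)"
  by (rule sum_mult_right[OF subgroup_self])

lemma sum_G_inv: "(\<Sum>y\<in>carrier G. f (inv y)) = sum f (carrier G)"
  by (rule sum_inv[OF subgroup_self])

lemma conv_outside [simp]: "x \<notin> carrier G \<Longrightarrow> conv f g x = 0"
  by (simp add: conv_def)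

lemma cj_outside [simp]: "x \<notin> carrier G \<Longrightarrow> cj g f x = 0"
  by (simp add: cj_def)

lemma conv_alt: "x \<in> carrier G \<Longrightarrow> conv f g x = (\<Sum>y\<in>carrier G. f (x \<otimes> inv y) * g y)"
proof -
  assume x: "x \<in> carrier G"
  have "conv f g x = (\<Sum>y\<in>carrier G. f (x \<otimes> y) * g (inv (x \<otimes> y) \<otimes> x))"
    using x sum_G_left[OF x, of "\<lambda>y. f y * g (inv y \<otimes> x)"] by (simp add: conv_def)
  also have "\<dots> = (\<Sum>y\<in>carrier G. f (x \<otimes> y) * g (inv y))"
    using x by (intro sum.cong refl) (simp add: inv_mult_group m_assoc)
  also have "\<dots> = (\<Sum>y\<in>carrier G. f (x \<otimes> inv y) * g (inv (inv y)))"
    by (rule sum_G_inv[symmetric])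
  finally show "conv f g x = (\<Sum>y\<in>carrier G. f (x \<otimes> inv y) * g y)" by simp
qed

lemma conv_assoc: "conv (conv f g) h = conv f (conv g h)"
proof
  fix x
  show "conv (conv f g) h x = conv f (conv g h) x"
  proof (cases "x \<in> carrier G")
    case x: True
    have "conv (conv f g) h x = (\<Sum>y\<in>carrier G. \<Sum>z\<in>carrier G. f z * g (inv z \<otimes> y) * h (inv y \<otimes> x))"
      using x by (auto simp: conv_def sum_distrib_right intro!: sum.cong)
    also have "\<dots> = (\<Sum>z\<in>carrier G. \<Sum>y\<in>carrier G. f z * g (inv z \<otimes> y) * h (inv y \<otimes> x))"
      by (rule sum.swap)
    also have "\<dots> = (\<Sum>z\<in>carrier G. \<Sum>y\<in>carrier G. f z * (g y * h (inv y \<otimes> (inv z \<otimes> x))))"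
    proof (rule sum.cong[OF refl])
      fix z assume z: "z \<in> carrier G"
      have "(\<Sum>y\<in>carrier G. f z * g (inv z \<otimes> y) * h (inv y \<otimes> x)) =
        (\<Sum>y\<in>carrier G. f z * g (inv z \<otimes> (z \<otimes> y)) * h (inv (z \<otimes> y) \<otimes> x))"
        by (rule sum_G_left[OF z, symmetric])
      also have "\<dots> = (\<Sum>y\<in>carrier G. f z * (g y * h (inv y \<otimes> (inv z \<otimes> x))))"
      proof (intro sum.cong refl)
        fix y assume y: "y \<in> carrier G"
        have "inv z \<otimes> (z \<otimes> y) = y" using y z by (simp flip: m_assoc)
        moreover have "inv (z \<otimes> y) \<otimes> x = inv y \<otimes> (inv z \<otimes> x)"
          using x y z by (simp add: inv_mult_group m_assoc)
        ultimately show "f z * g (inv z \<otimes> (z \<otimes> y)) * h (inv (z \<otimes> y) \<otimes> x) = f z * (g y * h (inv y \<otimes> (inv z \<otimes> x)))"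
          by simp
      qed
      finally show "(\<Sum>y\<in>carrier G. f z * g (inv z \<otimes> y) * h (inv y \<otimes> x)) =
        (\<Sum>y\<in>carrier G. f z * (g y * h (inv y \<otimes> (inv z \<otimes> x))))" .
    qed
    also have "\<dots> = conv f (conv g h) x"
      using x by (auto simp: conv_def sum_distrib_left intro!: sum.cong)
    finally show ?thesis .
  next
    case False
    then show ?thesis by simp
  qed
qed

lemma conv_scale_left: "conv (\<lambda>x. c * f x) g = (\<lambda>x. c * conv f g x)"
  by (auto simp: conv_def sum_distrib_left mult.assoc)

lemma conv_scale_right: "conv f (\<lambda>x. c * g x) = (\<lambda>x. c * conv f g x)"
  by (auto simp: conv_def sum_distrib_left mult_ac)

lemma conv_sum_left: "conv (\<lambda>x. \<Sum>i\<in>I. F i x) g = (\<lambda>x. \<Sum>i\<in>I. conv (F i) g x)"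
  by (rule ext) (auto simp: conv_def sum_distrib_right intro: sum.swap)

lemma conv_sum_right: "conv f (\<lambda>x. \<Sum>i\<in>I. F i x) = (\<lambda>x. \<Sum>i\<in>I. conv f (F i) x)"
  by (rule ext) (auto simp: conv_def sum_distrib_left intro: sum.swap)

lemma conv_zero [simp]: "conv (\<lambda>x. 0) g = (\<lambda>x. 0)" "conv f (\<lambda>x. 0) = (\<lambda>x. 0)"
  by (auto simp: conv_def)

lemma cj_conv: "g \<in> carrier G \<Longrightarrow> cj g (conv f h) = conv (cj g f) (cj g h)"
proof
  fix x assume g: "g \<in> carrier G"
  show "cj g (conv f h) x = conv (cj g f) (cj g h) x"
  proof (cases "x \<in> carrier G")
    case x: True
    have gi: "inv g \<in> carrier G" using g by simp
    let ?F = "\<lambda>y. f y * h (inv y \<otimes> (g \<otimes> x \<otimes> inv g))"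
    have "cj g (conv f h) x = sum ?F (carrier G)"
      using g x by (simp add: cj_def conv_def)
    also have "\<dots> = (\<Sum>y\<in>carrier G. ?F (g \<otimes> y))"
      by (rule sum_G_left[OF g, symmetric])
    also have "\<dots> = (\<Sum>y\<in>carrier G. ?F (g \<otimes> (y \<otimes> inv g)))"
      by (rule sum_G_right[OF gi, symmetric])
    also have "\<dots> = conv (cj g f) (cj g h) x"
    proof -
      have "?F (g \<otimes> (y \<otimes> inv g)) = cj g f y * cj g h (inv y \<otimes> x)" if y: "y \<in> carrier G" for y
      proof -
        have "inv (g \<otimes> (y \<otimes> inv g)) \<otimes> (g \<otimes> x \<otimes> inv g) = g \<otimes> (inv y \<otimes> x) \<otimes> inv g"
          using g x y by (simp add: inv_mult_group m_assoc)
        then show ?thesis using g x y by (simp add: cj_def m_assoc)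
      qed
      then show ?thesis using x by (simp add: conv_def)
    qed
    finally show ?thesis .
  qed simp
qed

lemma cj_cj: "a \<in> carrier G \<Longrightarrow> b \<in> carrier G \<Longrightarrow> cj a (cj b f) = cj (b \<otimes> a) f"
  by (rule ext) (simp add: cj_def inv_mult_group m_assoc)

lemma cj_scale: "cj g (\<lambda>x. c * f x) = (\<lambda>x. c * cj g f x)"
  by (auto simp: cj_def)

lemma cj_sum: "cj g (\<lambda>x. \<Sum>i\<in>I. F i x) = (\<lambda>x. \<Sum>i\<in>I. cj g (F i) x)"
  by (auto simp: cj_def)

lemma conj_mem_iff:
  assumes "subgroup K G" "k \<in> K" "x \<in> carrier G"
  shows "k \<otimes> x \<otimes> inv k \<in> K \<longleftrightarrow> x \<in> K"
proof
  assume a: "k \<otimes> x \<otimes> inv k \<in> K"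
  have kc: "k \<in> carrier G" using assms by (meson subgroup.mem_carrier)
  have "inv k \<otimes> (k \<otimes> x \<otimes> inv k) \<otimes> k = x"
    using assms kc by (simp add: m_assoc)
  then show "x \<in> K" using a assms
    by (metis subgroup.m_closed subgroup.m_inv_closed)
qed (use assms in \<open>auto simp: subgroup.m_closed subgroup.m_inv_closed\<close>)

lemma ZC_invariant:
  assumes "f \<in> ZC K" "subgroup K G" "k \<in> K" "x \<in> carrier G"
  shows "f (k \<otimes> x \<otimes> inv k) = f x"
  using assms conj_mem_iff[of K k x] by (cases "x \<in> K") (auto simp: ZC_def)

lemma ZC_outside: "f \<in> ZC K \<Longrightarrow> x \<notin> K \<Longrightarrow> f x = 0"
  by (auto simp: ZC_def)

lemma ZC_cj:
  assumes "f \<in> ZC K" "subgroup K G" "k \<in> K"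
  shows "cj k f = f"
proof
  fix x show "cj k f x = f x"
    using ZC_invariant[OF assms, of x] ZC_outside[OF assms(1), of x] subgroup.subset[OF assms(2)]
    by (auto simp: cj_def)
qed

lemma ZC_I:
  assumes "subgroup K G" "\<And>x. x \<notin> K \<Longrightarrow> f x = 0" "\<And>k. k \<in> K \<Longrightarrow> cj k f = f"
  shows "f \<in> ZC K"
  unfolding ZC_def
proof (intro CollectI conjI allI impI ballI)
  fix k x assume kx: "k \<in> K" "x \<in> K"
  then have "x \<in> carrier G" using assms(1) by (meson subgroup.mem_carrier)
  then show "f (k \<otimes> x \<otimes> inv k) = f x" using fun_cong[OF assms(3)[OF kx(1)], of x] by (simp add: cj_def)
qed (use assms in auto)

lemma conv_commute:
  assumes K: "subgroup K G" and f: "\<And>k. k \<in> K \<Longrightarrow> cj k f = f" and g: "\<And>x. x \<notin> K \<Longrightarrow> g x = 0"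
  shows "conv f g = conv g f"
proof
  fix x
  show "conv f g x = conv g f x"
  proof (cases "x \<in> carrier G")
    case x: True
    have "conv f g x = (\<Sum>y\<in>carrier G. f (x \<otimes> inv y) * g y)" by (rule conv_alt[OF x])
    also have "\<dots> = (\<Sum>y\<in>carrier G. g y * f (inv y \<otimes> x))"
    proof (intro sum.cong refl)
      fix y assume y: "y \<in> carrier G"
      show "f (x \<otimes> inv y) * g y = g y * f (inv y \<otimes> x)"
      proof (cases "y \<in> K")
        case True
        then have "cj y f (inv y \<otimes> x) = f (inv y \<otimes> x)" using f by simp
        moreover have "y \<otimes> (inv y \<otimes> x) \<otimes> inv y = x \<otimes> inv y" using x y by (simp flip: m_assoc)
        ultimately show ?thesis using x y by (simp add: cj_def)
      qed (simp add: g)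
    qed
    also have "\<dots> = conv g f x" using x by (simp add: conv_def)
    finally show ?thesis .
  qed simp
qed

lemma ZC_commute: "subgroup K G \<Longrightarrow> f \<in> ZC K \<Longrightarrow> g \<in> ZC K \<Longrightarrow> conv f g = conv g f"
  by (rule conv_commute) (auto simp: ZC_cj ZC_outside)

lemma conv_supported:
  assumes K: "subgroup K G" and f: "\<And>x. x \<notin> K \<Longrightarrow> f x = 0" and g: "\<And>x. x \<notin> K \<Longrightarrow> g x = 0" and x: "x \<notin> K"
  shows "conv f g x = 0"
proof -
  have "f y * g (inv y \<otimes> x) = 0" if "y \<in> carrier G" "x \<in> carrier G" for y
  proof (cases "y \<in> K \<and> inv y \<otimes> x \<in> K")
    case True
    then have "y \<otimes> (inv y \<otimes> x) \<in> K" using K by (meson subgroup.m_closed)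
    then show ?thesis using that x by simp
  qed (use f g in auto)
  then show ?thesis by (simp add: conv_def)
qed

lemma ZC_conv:
  assumes K: "subgroup K G" and f: "f \<in> ZC K" and g: "g \<in> ZC K"
  shows "conv f g \<in> ZC K"
proof (rule ZC_I[OF K])
  show "conv f g x = 0" if "x \<notin> K" for x
    by (rule conv_supported[OF K _ _ that]) (use f g in \<open>auto simp: ZC_outside\<close>)
  show "cj k (conv f g) = conv f g" if "k \<in> K" for k
    using cj_conv[of k f g] ZC_cj[OF f K that] ZC_cj[OF g K that] subgroup.mem_carrier[OF K that] by simp
qed

lemma conv_on_subgroup:
  assumes K: "subgroup K G" and f: "\<And>x. x \<notin> K \<Longrightarrow> f x = 0" and x: "x \<in> carrier G"
  shows "conv f g x = (\<Sum>y\<in>K. f y * g (inv y \<otimes> x))"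
  unfolding conv_def using x subgroup.subset[OF K] f
  by (auto intro!: sum.mono_neutral_right)

lemma conv_on_subgroup_right:
  assumes K: "subgroup K G" and g: "\<And>x. x \<notin> K \<Longrightarrow> g x = 0" and x: "x \<in> carrier G"
  shows "conv f g x = (\<Sum>y\<in>K. f (x \<otimes> inv y) * g y)"
  unfolding conv_alt[OF x] using subgroup.subset[OF K] g
  by (auto intro!: sum.mono_neutral_right)

text \<open>Up to the positive factor \<open>card K / \<chi> 1\<close>, such a function is an idempotent
  spanning a one-dimensional ideal of the centre of the group algebra.\<close>
definition irrfun :: "'a set \<Rightarrow> ('a \<Rightarrow> complex) \<Rightarrow> bool" where
  "irrfun K \<chi> \<longleftrightarrow> \<chi> \<in> ZC K \<and> (\<exists>r::real. r > 0 \<and> \<chi> \<one> = of_real r) \<and>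
     conv \<chi> \<chi> = (\<lambda>x. of_nat (card K) / \<chi> \<one> * \<chi> x) \<and> (\<forall>f\<in>ZC K. \<exists>c. conv \<chi> f = (\<lambda>x. c * \<chi> x))"

section \<open>One-dimensional ideals of the centre and class sums\<close>

lemma irrfunD:
  assumes "irrfun K \<chi>"
  shows "\<chi> \<in> ZC K" "\<chi> \<one> \<noteq> 0" "conv \<chi> \<chi> = (\<lambda>x. of_nat (card K) / \<chi> \<one> * \<chi> x)"
    "f \<in> ZC K \<Longrightarrow> \<exists>c. conv \<chi> f = (\<lambda>x. c * \<chi> x)"
  using assms by (auto simp: irrfun_def)

text \<open>The product lies in both ideals, so if it is nonzero, \<chi> is a multiple of \<psi> by
  some \<open>k\<close>. Both convolution squares take the value \<open>card K\<close> at \<one>,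
  whence \<open>k * k = 1\<close>, and positivity at \<one> excludes -1.\<close>

lemma irrfun_eq:
  assumes K: "subgroup K G" and a: "irrfun K \<chi>" and b: "irrfun K \<psi>" and nz: "conv \<chi> \<psi> \<noteq> (\<lambda>x. 0)"
  shows "\<chi> = \<psi>"
proof -
  note A = irrfunD[OF a] and B = irrfunD[OF b]
  obtain c where c: "conv \<chi> \<psi> = (\<lambda>x. c * \<chi> x)" using A(4)[OF B(1)] by blast
  obtain c' where c': "conv \<psi> \<chi> = (\<lambda>x. c' * \<psi> x)" using B(4)[OF A(1)] by blast
  have eq: "(\<lambda>x. c * \<chi> x) = (\<lambda>x. c' * \<psi> x)"
    using ZC_commute[OF K A(1) B(1)] c c' by simp
  have "c \<noteq> 0" using nz c by auto
  define k where "k = c' / c"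
  have k: "\<chi> = (\<lambda>x. k * \<psi> x)"
  proof
    fix x have "c * \<chi> x = c' * \<psi> x" using eq by (rule fun_cong)
    then show "\<chi> x = k * \<psi> x" using \<open>c \<noteq> 0\<close> by (simp add: k_def field_simps)
  qed
  have k1: "\<chi> \<one> = k * \<psi> \<one>" using k by simp
  then have k0: "k \<noteq> 0" using A(2) by auto
  have "conv \<chi> \<chi> \<one> = k * k * conv \<psi> \<psi> \<one>"
    unfolding k by (simp add: conv_scale_left conv_scale_right)
  then have "of_nat (card K) = k * k * of_nat (card K)"
    using A(2,3) B(2,3) by simp
  then have kk: "k * k = 1" using subgroup_card[OF K] by simp
  obtain r where r: "r > 0" "\<chi> \<one> = of_real r" using a by (auto simp: irrfun_def)
  obtain s where s: "s > 0" "\<psi> \<one> = of_real s" using b by (auto simp: irrfun_def)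
  have "k \<noteq> -1"
  proof
    assume "k = -1"
    then have "complex_of_real r = complex_of_real (- s)" using k1 r s by simp
    then have "r = - s" by (simp only: of_real_eq_iff)
    then show False using r s by simp
  qed
  with kk have "k = 1" by (metis square_eq_1_iff)
  then show ?thesis using k by simp
qed

text \<open>As \<open>f\<close> is constant on classes, \<open>y\<close> may be replaced by its
  conjugates; after averaging over the conjugating elements, \<open>FE\<close> splits off
  \<open>\<chi> x\<close>. \<open>FE\<close> says that the central character is multiplicative on
  class sums. It replaces the quantifier over all \<open>f\<close> by equations between the values
  of \<chi>, which a field automorphism respects.\<close>

lemma ideal_from_class_sums:
  assumes K: "subgroup K G" and chi: "\<chi> \<in> ZC K" and nz: "\<chi> \<one> \<noteq> 0"
    and FE: "\<And>x y. x \<in> K \<Longrightarrow> y \<in> K \<Longrightarrow> (\<Sum>g\<in>K. \<chi> (x \<otimes> (g \<otimes> y \<otimes> inv g))) = of_nat (card K) / \<chi> \<one> * \<chi> x * \<chi> y"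
    and f: "f \<in> ZC K"
  shows "\<exists>c. conv \<chi> f = (\<lambda>x. c * \<chi> x)"
proof -
  have cK: "of_nat (card K) \<noteq> (0::complex)" using subgroup_card[OF K] by simp
  \<comment> \<open>The scalar is forced by evaluating \<open>conv \<chi> f\<close> at
    \<one>.\<close>
  define c where "c = (\<Sum>y\<in>K. f (inv y) * \<chi> y) / \<chi> \<one>"
  have "conv \<chi> f x = c * \<chi> x" for x
  proof (cases "x \<in> K")
    case x: True
    then have xc: "x \<in> carrier G" using K by (meson subgroup.mem_carrier)
    have conj: "(\<Sum>y\<in>K. \<chi> (x \<otimes> y) * f (inv y)) = (\<Sum>y\<in>K. \<chi> (x \<otimes> (g \<otimes> y \<otimes> inv g)) * f (inv y))" if g: "g \<in> K" for g
    proof -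
      have gi: "inv g \<in> K" using g K by (simp add: subgroup.m_inv_closed)
      have gc: "g \<in> carrier G" using g K by (meson subgroup.mem_carrier)
      have "(\<Sum>y\<in>K. \<chi> (x \<otimes> y) * f (inv y)) = (\<Sum>y\<in>K. \<chi> (x \<otimes> (g \<otimes> y)) * f (inv (g \<otimes> y)))"
        by (rule sum_mult_left[OF K g, symmetric])
      also have "\<dots> = (\<Sum>y\<in>K. \<chi> (x \<otimes> (g \<otimes> (y \<otimes> inv g))) * f (inv (g \<otimes> (y \<otimes> inv g))))"
        by (rule sum_mult_right[OF K gi, symmetric])
      also have "\<dots> = (\<Sum>y\<in>K. \<chi> (x \<otimes> (g \<otimes> y \<otimes> inv g)) * f (inv y))"
      proof (intro sum.cong refl)
        fix y assume y: "y \<in> K"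
        then have yc: "y \<in> carrier G" "inv y \<in> carrier G" using subgroup.mem_carrier[OF K] by auto
        have e1: "g \<otimes> (y \<otimes> inv g) = g \<otimes> y \<otimes> inv g" using yc gc by (simp add: m_assoc)
        have e2: "inv (g \<otimes> (y \<otimes> inv g)) = g \<otimes> inv y \<otimes> inv g"
          using yc gc by (simp add: inv_mult_group m_assoc)
        show "\<chi> (x \<otimes> (g \<otimes> (y \<otimes> inv g))) * f (inv (g \<otimes> (y \<otimes> inv g))) = \<chi> (x \<otimes> (g \<otimes> y \<otimes> inv g)) * f (inv y)"
          by (simp only: e2 ZC_invariant[OF f K g yc(2)]) (simp only: e1)
      qed
      finally show ?thesis .
    qed
    have "conv \<chi> f x = (\<Sum>y\<in>K. \<chi> (x \<otimes> inv y) * f y)"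
      by (rule conv_on_subgroup_right[OF K _ xc]) (use f in \<open>auto simp: ZC_outside\<close>)
    also have "\<dots> = (\<Sum>y\<in>K. \<chi> (x \<otimes> inv (inv y)) * f (inv y))"
      by (rule sum_inv[OF K, symmetric])
    also have "\<dots> = (\<Sum>y\<in>K. \<chi> (x \<otimes> y) * f (inv y))"
      using K by (intro sum.cong refl) (simp add: subgroup.mem_carrier)
    finally have "of_nat (card K) * conv \<chi> f x = (\<Sum>g\<in>K. \<Sum>y\<in>K. \<chi> (x \<otimes> (g \<otimes> y \<otimes> inv g)) * f (inv y))"
      by (simp flip: conj)
    also have "\<dots> = (\<Sum>y\<in>K. (\<Sum>g\<in>K. \<chi> (x \<otimes> (g \<otimes> y \<otimes> inv g))) * f (inv y))"
      by (subst sum.swap) (simp add: sum_distrib_right)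
    also have "\<dots> = (\<Sum>y\<in>K. of_nat (card K) * (f (inv y) * \<chi> y / \<chi> \<one> * \<chi> x))"
      using FE[OF x] by (intro sum.cong refl) simp
    also have "\<dots> = of_nat (card K) * (c * \<chi> x)"
      by (simp add: c_def sum_distrib_left sum_distrib_right sum_divide_distrib)
    finally show ?thesis using cK by simp
  next
    case False
    then show ?thesis using ZC_outside[OF chi] ZC_outside[OF ZC_conv[OF K chi f]] by simp
  qed
  then show ?thesis by blast
qed

text \<open>The converse of \<open>ideal_from_class_sums\<close>: the ideal property is applied to
  the sum of all conjugates of a point mass, and evaluation at \<one> identifies the scalar.\<close>

lemma irrfun_class_sums:
  assumes K: "subgroup K G" and irr: "irrfun K \<chi>" and x: "x \<in> K" and y: "y \<in> K"
  shows "(\<Sum>g\<in>K. \<chi> (x \<otimes> (g \<otimes> y \<otimes> inv g))) = of_nat (card K) / \<chi> \<one> * \<chi> x * \<chi> y"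
proof -
  note chi = irrfunD[OF irr]
  have yc: "y \<in> carrier G" "inv y \<in> K" "inv y \<in> carrier G" using y subgroup.mem_carrier[OF K] subgroup.m_inv_closed[OF K] by auto
  \<comment> \<open>The mass sits at \<open>inv y\<close> because convolution with it on the right
    replaces the argument \<open>x\<close> by \<open>x \<otimes> y\<close>.\<close>
  define \<delta> where "\<delta> z = (if z = inv y then 1 else 0 :: complex)" for z
  define f where "f z = (\<Sum>g\<in>K. cj g \<delta> z)" for z
  have ff: "f = (\<lambda>z. \<Sum>g\<in>K. cj g \<delta> z)" by (rule ext) (simp add: f_def)
  have Kc: "k \<in> carrier G" if "k \<in> K" for k using that K by (meson subgroup.mem_carrier)
  have "f \<in> ZC K"
  proof (rule ZC_I[OF K])
    fix z assume z: "z \<notin> K"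
    show "f z = 0" unfolding f_def
    proof (rule sum.neutral, intro ballI)
      fix g assume g: "g \<in> K"
      show "cj g \<delta> z = 0"
        using z conj_mem_iff[OF K g, of z] yc by (auto simp: cj_def \<delta>_def)
    qed
  next
    fix k assume k: "k \<in> K"
    show "cj k f = f"
    proof
      fix z
      have "cj k f z = (\<Sum>g\<in>K. cj (g \<otimes> k) \<delta> z)"
        unfolding ff cj_sum using cj_cj[OF Kc[OF k] Kc] by simp
      also have "\<dots> = f z" unfolding f_def by (rule sum_mult_right[OF K k])
      finally show "cj k f z = f z" .
    qed
  qed
  then obtain c where c: "conv \<chi> f = (\<lambda>x. c * \<chi> x)" using chi(4) by blast
  have val: "conv \<chi> f x = (\<Sum>g\<in>K. \<chi> (x \<otimes> (g \<otimes> y \<otimes> inv g)))" if x: "x \<in> K" for x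
  proof -
    have xc: "x \<in> carrier G" using Kc x .
    have one: "conv \<chi> (cj g \<delta>) x = \<chi> (x \<otimes> (inv g \<otimes> y \<otimes> inv (inv g)))" if g: "g \<in> K" for g
    proof -
      have gc: "g \<in> carrier G" using Kc g .
      have "conv \<chi> (cj g \<delta>) x = (\<Sum>z\<in>carrier G. \<chi> (x \<otimes> inv z) * cj g \<delta> z)" by (rule conv_alt[OF xc])
      also have "\<dots> = (\<Sum>z\<in>carrier G. if z = inv g \<otimes> inv y \<otimes> g then \<chi> (x \<otimes> inv z) else 0)"
      proof (intro sum.cong refl)
        fix z assume z: "z \<in> carrier G"
        have "g \<otimes> z \<otimes> inv g = inv y \<longleftrightarrow> z = inv g \<otimes> inv y \<otimes> g"
        proof
          assume "g \<otimes> z \<otimes> inv g = inv y"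
          then have "inv g \<otimes> (g \<otimes> z \<otimes> inv g) \<otimes> g = inv g \<otimes> inv y \<otimes> g" by simp
          moreover have "inv g \<otimes> (g \<otimes> z \<otimes> inv g) \<otimes> g = (inv g \<otimes> g) \<otimes> z \<otimes> (inv g \<otimes> g)"
            using gc z by (simp add: m_assoc del: l_inv r_inv)
          ultimately show "z = inv g \<otimes> inv y \<otimes> g" using gc z by simp
        next
          assume "z = inv g \<otimes> inv y \<otimes> g"
          then have "g \<otimes> z \<otimes> inv g = (g \<otimes> inv g) \<otimes> inv y \<otimes> (g \<otimes> inv g)"
            using gc yc by (simp add: m_assoc del: l_inv r_inv)
          then show "g \<otimes> z \<otimes> inv g = inv y" using gc yc by simp
        qed
        then show "\<chi> (x \<otimes> inv z) * cj g \<delta> z = (if z = inv g \<otimes> inv y \<otimes> g then \<chi> (x \<otimes> inv z) else 0)"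
          using z by (simp add: cj_def \<delta>_def)
      qed
      also have "\<dots> = \<chi> (x \<otimes> inv (inv g \<otimes> inv y \<otimes> g))" using gc yc by simp
      finally show ?thesis using gc yc by (simp add: inv_mult_group m_assoc)
    qed
    have "conv \<chi> f x = (\<Sum>g\<in>K. \<chi> (x \<otimes> (inv g \<otimes> y \<otimes> inv (inv g))))"
      unfolding ff conv_sum_right using one by simp
    also have "\<dots> = (\<Sum>g\<in>K. \<chi> (x \<otimes> (g \<otimes> y \<otimes> inv g)))"
      by (rule sum_inv[OF K])
    finally show ?thesis .
  qed
  have one: "\<one> \<in> K" using K by (rule subgroup.one_closed)
  have "c * \<chi> \<one> = (\<Sum>g\<in>K. \<chi> (\<one> \<otimes> (g \<otimes> y \<otimes> inv g)))" using val[OF one] c by simp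
  also have "\<dots> = (\<Sum>g\<in>K. \<chi> y)"
    using Kc yc ZC_invariant[OF chi(1) K] by (intro sum.cong refl) simp
  finally have "c = of_nat (card K) / \<chi> \<one> * \<chi> y" using chi(2) by (simp add: field_simps)
  then show ?thesis using val[OF x] c by (simp add: mult_ac)
qed

text \<open>Schur's relation for conjugates, \<open>schur_trace_conj\<close>, gives the class sum
  identity; the one for products, \<open>schur_trace_prod\<close>, gives the convolution
  square.\<close>

lemma char_of_irrfun:
  assumes irr: "irreducible_rep G K d \<rho>" and K: "subgroup K G"
  shows "irrfun K (char_of K \<rho>)" and "char_of K \<rho> \<one> = of_nat d"
proof -
  let ?\<chi> = "char_of K \<rho>"
  have rep: "is_rep G K d \<rho>" and d: "d > 0" using irr by (auto simp: irreducible_rep_def)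
  note sr = irreducible_schur_rep[OF irr K]
  have c: "\<rho> g \<in> carrier_mat d d" if "g \<in> K" for g using rep that by (auto simp: is_rep_def)
  have mult: "\<rho> (x \<otimes> y) = \<rho> x * \<rho> y" if "x \<in> K" "y \<in> K" for x y using rep that by (auto simp: is_rep_def)
  note cl = subgroup.m_closed[OF K] subgroup.m_inv_closed[OF K] subgroup.one_closed[OF K]
  show one: "?\<chi> \<one> = of_nat d" using rep cl by (simp add: char_of_def is_rep_def)
  have Z: "?\<chi> \<in> ZC K"
  proof -
    have "?\<chi> (k \<otimes> x \<otimes> inv k) = ?\<chi> x" if "k \<in> K" "x \<in> K" for k x
      using that cl mult c rep_inv[OF rep K that(1)] mat_trace_conj[of "\<rho> k" d "\<rho> (inv k)" "\<rho> x"]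
      by (simp add: char_of_def)
    then show ?thesis by (auto simp: ZC_def char_of_def)
  qed
  have FE: "(\<Sum>g\<in>K. ?\<chi> (x \<otimes> (g \<otimes> y \<otimes> inv g))) = of_nat (card K) / ?\<chi> \<one> * ?\<chi> x * ?\<chi> y"
    if "x \<in> K" "y \<in> K" for x y
  proof -
    have "(\<Sum>g\<in>K. ?\<chi> (x \<otimes> (g \<otimes> y \<otimes> inv g))) = (\<Sum>g\<in>K. mat_trace (\<rho> x * (\<rho> g * \<rho> y * \<rho> (inv g))))"
      using that cl mult by (intro sum.cong refl) (simp add: char_of_def)
    also have "\<dots> = of_nat (card K) / of_nat d * mat_trace (\<rho> x) * mat_trace (\<rho> y)"
      by (rule schur_trace_conj[OF sr K c c]) (use that in auto)
    finally show ?thesis using one that by (simp add: char_of_def)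
  qed
  have CV: "conv ?\<chi> ?\<chi> x = of_nat (card K) / ?\<chi> \<one> * ?\<chi> x" for x
  proof (cases "x \<in> K")
    case x: True
    then have "conv ?\<chi> ?\<chi> x = (\<Sum>y\<in>K. ?\<chi> y * ?\<chi> (inv y \<otimes> x))"
      using subgroup.mem_carrier[OF K x] by (intro conv_on_subgroup[OF K]) (auto simp: char_of_def)
    also have "\<dots> = (\<Sum>y\<in>K. mat_trace (\<rho> y * 1\<^sub>m d) * mat_trace (\<rho> (inv y) * \<rho> x))"
      using x cl mult by (intro sum.cong refl) (simp add: char_of_def right_mult_one_mat[OF c])
    also have "\<dots> = of_nat (card K) / of_nat d * mat_trace (1\<^sub>m d * \<rho> x)"
      by (rule schur_trace_prod[OF sr K]) (use c x in auto)
    finally show ?thesis using one x c[OF x] by (simp add: char_of_def)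
  next
    case False
    then show ?thesis using ZC_outside[OF Z] ZC_outside[OF ZC_conv[OF K Z Z]] by simp
  qed
  have nz: "?\<chi> \<one> \<noteq> 0" using one d by simp
  show "irrfun K ?\<chi>"
    unfolding irrfun_def
  proof (intro conjI ballI Z)
    show "\<exists>r::real. r > 0 \<and> ?\<chi> \<one> = of_real r" using one d by (intro exI[of _ "real d"]) simp
    show "conv ?\<chi> ?\<chi> = (\<lambda>x. of_nat (card K) / ?\<chi> \<one> * ?\<chi> x)" by (rule ext) (rule CV)
    show "\<exists>c. conv ?\<chi> f = (\<lambda>x. c * ?\<chi> x)" if "f \<in> ZC K" for f
      by (rule ideal_from_class_sums[OF K Z nz FE that])
  qed
qed

text \<open>A weighted sum of traces is additive under \<open>reducible_split\<close>, so it stays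
  nonzero on one of two representations of smaller degree; induction on the degree ends at an
  irreducible one.\<close>

lemma irreducible_constituent:
  assumes K: "subgroup K G" and rep: "is_rep G K d \<rho>" and nz: "(\<Sum>x\<in>K. f x * mat_trace (\<rho> x)) \<noteq> 0"
  obtains d' \<rho>' where "irreducible_rep G K d' \<rho>'" "(\<Sum>x\<in>K. f x * mat_trace (\<rho>' x)) \<noteq> 0"
proof -
  have "is_rep G K d \<rho> \<Longrightarrow> (\<Sum>x\<in>K. f x * mat_trace (\<rho> x)) \<noteq> 0 \<Longrightarrow>
    \<exists>d' \<rho>'. irreducible_rep G K d' \<rho>' \<and> (\<Sum>x\<in>K. f x * mat_trace (\<rho>' x)) \<noteq> 0" for \<rho>
  proof (induction d arbitrary: \<rho> rule: less_induct)
    case (less d)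
    show ?case
    proof (cases "irreducible_rep G K d \<rho>")
      case False
      have "d > 0"
      proof (rule ccontr)
        assume "\<not> d > 0"
        then have "mat_trace (\<rho> x) = 0" if "x \<in> K" for x
          using less.prems(1) that by (auto simp: is_rep_def mat_trace_def)
        then show False using less.prems(2) by simp
      qed
      moreover have "\<forall>x\<in>K. \<forall>y\<in>K. x \<otimes> y \<in> K" "\<one> \<in> K"
        using K subgroup.m_closed subgroup.one_closed by auto
      ultimately obtain d1 d2 \<rho>1 \<rho>2 where r: "is_rep G K d1 \<rho>1" "is_rep G K d2 \<rho>2" "d1 < d" "d2 < d"
        and tr: "\<And>x. x \<in> K \<Longrightarrow> mat_trace (\<rho> x) = mat_trace (\<rho>1 x) + mat_trace (\<rho>2 x)"
        using reducible_split[OF less.prems(1) _ _ _ False] by metis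
      have "(\<Sum>x\<in>K. f x * mat_trace (\<rho> x)) = (\<Sum>x\<in>K. f x * mat_trace (\<rho>1 x)) + (\<Sum>x\<in>K. f x * mat_trace (\<rho>2 x))"
        using tr by (simp add: distrib_left sum.distrib)
      then have "(\<Sum>x\<in>K. f x * mat_trace (\<rho>1 x)) \<noteq> 0 \<or> (\<Sum>x\<in>K. f x * mat_trace (\<rho>2 x)) \<noteq> 0"
        using less.prems(2) by auto
      then show ?thesis using less.IH r by blast
    qed (use less.prems in blast)
  qed
  then show ?thesis using rep nz that by blast
qed

lemma regular_rep:
  assumes K: "subgroup K G"
  obtains \<rho> where "is_rep G K (card K) \<rho>"
    "\<And>x. x \<in> K \<Longrightarrow> mat_trace (\<rho> x) = (if x = \<one> then of_nat (card K) else 0)"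
proof -
  have finK: "finite K" by (rule subgroup_finite[OF K])
  obtain e where e: "bij_betw e {0..<card K} K" using ex_bij_betw_nat_finite[OF finK] by blast
  have eK: "e i \<in> K" if "i < card K" for i using e that by (auto simp: bij_betw_def)
  have einj: "e i = e j \<longleftrightarrow> i = j" if "i < card K" "j < card K" for i j
    using e that by (auto simp: bij_betw_def inj_on_def)
  note cl = subgroup.m_closed[OF K] subgroup.m_inv_closed[OF K] subgroup.one_closed[OF K]
  have Kc: "k \<in> carrier G" if "k \<in> K" for k using that K by (meson subgroup.mem_carrier)
  define \<rho> where "\<rho> x = mat (card K) (card K) (\<lambda>(i,j). if x \<otimes> e j = e i then 1 else 0 :: complex)" for x
  have "is_rep G K (card K) \<rho>"
    unfolding is_rep_def
  proof (intro conjI ballI)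
    show "\<rho> x \<in> carrier_mat (card K) (card K)" for x by (simp add: \<rho>_def)
    show "\<rho> \<one> = 1\<^sub>m (card K)"
      using einj eK Kc by (intro eq_matI) (auto simp: \<rho>_def)
    fix x y assume xy: "x \<in> K" "y \<in> K"
    show "\<rho> (x \<otimes> y) = \<rho> x * \<rho> y"
    proof (rule eq_matI)
      fix i j assume "i < dim_row (\<rho> x * \<rho> y)" "j < dim_col (\<rho> x * \<rho> y)"
      then have ij: "i < card K" "j < card K" by (auto simp: \<rho>_def)
      have "y \<otimes> e j \<in> K" using xy ij eK cl by simp
      then obtain l0 where l0: "l0 < card K" "y \<otimes> e j = e l0"
        using bij_betw_imp_surj_on[OF e] by (metis atLeastLessThan_iff imageE)
      have "(\<rho> x * \<rho> y) $$ (i,j) = (\<Sum>l<card K. \<rho> x $$ (i,l) * \<rho> y $$ (l,j))"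
        using ij by (intro mat_mult_index) (auto simp: \<rho>_def)
      also have "\<dots> = (\<Sum>l<card K. if l = l0 then (if x \<otimes> e l0 = e i then 1 else 0) else 0)"
        using ij l0 einj by (intro sum.cong) (auto simp: \<rho>_def)
      also have "\<dots> = (if x \<otimes> (y \<otimes> e j) = e i then 1 else 0)" using l0 by simp
      also have "\<dots> = \<rho> (x \<otimes> y) $$ (i,j)"
        using ij xy eK Kc by (simp add: \<rho>_def m_assoc)
      finally show "\<rho> (x \<otimes> y) $$ (i,j) = (\<rho> x * \<rho> y) $$ (i,j)" by simp
    qed (auto simp: \<rho>_def)
  qed
  moreover have "mat_trace (\<rho> x) = (if x = \<one> then of_nat (card K) else 0)" if "x \<in> K" for x
  proof -
    have "x \<otimes> e i = e i \<longleftrightarrow> x = \<one>" if "i < card K" for i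
      using Kc[OF \<open>x \<in> K\<close>] Kc[OF eK[OF that]] by (metis inv_closed l_one m_assoc r_inv r_one)
    then show ?thesis by (simp add: mat_trace_def \<rho>_def)
  qed
  ultimately show ?thesis using that by blast
qed

text \<open>That only irreducible characters satisfy \<open>irrfun\<close> comes from the regular
  representation: its trace pairs with \<chi> to \<open>\<chi> \<one> * of_nat (card K)\<close>,
  which is nonzero, so some irreducible representation has a character whose product with \<chi> is
  nonzero. By \<open>irrfun_eq\<close> this character is \<chi>.\<close>

theorem Irr_eq_irrfun:
  assumes K: "subgroup K G"
  shows "Irr G K = {\<chi>. irrfun K \<chi>}"
proof (intro equalityI subsetI)
  fix \<chi> assume "\<chi> \<in> Irr G K"
  then show "\<chi> \<in> {\<chi>. irrfun K \<chi>}" using char_of_irrfun[OF _ K] by (auto simp: Irr_def)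
next
  fix \<chi> assume "\<chi> \<in> {\<chi>. irrfun K \<chi>}"
  then have irr: "irrfun K \<chi>" by simp
  note chi = irrfunD[OF irr]
  note cl = subgroup.m_closed[OF K] subgroup.m_inv_closed[OF K] subgroup.one_closed[OF K]
  obtain R where R: "is_rep G K (card K) R"
    "\<And>x. x \<in> K \<Longrightarrow> mat_trace (R x) = (if x = \<one> then of_nat (card K) else 0)"
    using regular_rep[OF K] by blast
  have "(\<Sum>x\<in>K. \<chi> (inv x) * mat_trace (R x)) = (\<Sum>x\<in>K. if x = \<one> then \<chi> \<one> * of_nat (card K) else 0)"
    using R(2) by (intro sum.cong) auto
  also have "\<dots> = \<chi> \<one> * of_nat (card K)" using cl subgroup_finite[OF K] by simp
  also have "\<dots> \<noteq> 0" using chi subgroup_card[OF K] by simp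
  finally have "(\<Sum>x\<in>K. \<chi> (inv x) * mat_trace (R x)) \<noteq> 0" .
  then obtain d \<rho> where rho: "irreducible_rep G K d \<rho>" "(\<Sum>x\<in>K. \<chi> (inv x) * mat_trace (\<rho> x)) \<noteq> 0"
    using irreducible_constituent[OF K R(1), of "\<lambda>x. \<chi> (inv x)"] by blast
  have "conv (char_of K \<rho>) \<chi> \<one> = (\<Sum>x\<in>K. char_of K \<rho> x * \<chi> (inv x \<otimes> \<one>))"
    by (rule conv_on_subgroup[OF K]) (auto simp: char_of_def)
  also have "\<dots> = (\<Sum>x\<in>K. \<chi> (inv x) * mat_trace (\<rho> x))"
    using subgroup.mem_carrier[OF K] by (intro sum.cong) (auto simp: char_of_def)
  finally have "conv (char_of K \<rho>) \<chi> \<noteq> (\<lambda>x. 0)" using rho by auto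
  then have "char_of K \<rho> = \<chi>"
    by (rule irrfun_eq[OF K char_of_irrfun(1)[OF rho(1) K] irr])
  then show "\<chi> \<in> Irr G K" using rho(1) by (auto simp: Irr_def)
qed

end

section \<open>Clifford correspondence\<close>

context fin_group
begin

lemma conv_div_left: "conv (\<lambda>x. f x / c) g = (\<lambda>x. conv f g x / c)"
  using conv_scale_left[of "1 / c" f g] by simp

lemma conv_div_right: "conv f (\<lambda>x. g x / c) = (\<lambda>x. conv f g x / c)"
  using conv_scale_right[of f "1 / c" g] by simp

lemma cj_div: "cj g (\<lambda>x. f x / c) = (\<lambda>x. cj g f x / c)"
  by (auto simp: cj_def)

lemmas scale_simps = conv_scale_left conv_scale_right conv_div_left conv_div_right cj_scale cj_div

lemma cj_one: "(\<And>x. x \<notin> carrier G \<Longrightarrow> f x = 0) \<Longrightarrow> cj \<one> f = f"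
  by (rule ext) (simp add: cj_def)

end

locale clifford = fin_group G for G (structure) +
  fixes N :: "'a set" and \<theta> :: "'a \<Rightarrow> complex" and T :: "'a set"
  assumes N: "N \<lhd> G" and irr: "irrfun N \<theta>" and T_def: "T = {g \<in> carrier G. cj g \<theta> = \<theta>}"
begin

text \<open>The central idempotent of \<theta>. Functions being multiplied by \<open>conv\<close>,
  \<theta> enters without the complex conjugation of the usual coefficient formula.\<close>

definition e :: "'a \<Rightarrow> complex" where
  "e = (\<lambda>x. \<theta> \<one> / of_nat (card N) * \<theta> x)"

lemma N_sub: "subgroup N G"
  using N by (simp add: normal_imp_subgroup)

lemma N_conj: "g \<in> carrier G \<Longrightarrow> n \<in> N \<Longrightarrow> g \<otimes> n \<otimes> inv g \<in> N"
  using normal.inv_op_closed2[OF N] by blast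

lemma N_carrier: "n \<in> N \<Longrightarrow> n \<in> carrier G"
  by (rule subgroup.mem_carrier[OF N_sub])

lemma N_outside: "f \<in> ZC N \<Longrightarrow> x \<notin> carrier G \<Longrightarrow> f x = 0"
  using ZC_outside N_carrier by blast

lemma N_conj_bij: "g \<in> carrier G \<Longrightarrow> bij_betw (\<lambda>n. g \<otimes> n \<otimes> inv g) N N"
proof (rule bij_betw_byWitness[where f' = "\<lambda>n. inv g \<otimes> n \<otimes> g"])
  assume g: "g \<in> carrier G"
  show "(\<lambda>n. inv g \<otimes> n \<otimes> g) ` N \<subseteq> N" using N_conj[of "inv g"] g by auto
qed (use N_carrier N_conj in \<open>auto simp: m_assoc\<close>)

lemma N_conj_iff: "g \<in> carrier G \<Longrightarrow> x \<in> carrier G \<Longrightarrow> g \<otimes> x \<otimes> inv g \<in> N \<longleftrightarrow> x \<in> N"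
proof
  assume g: "g \<in> carrier G" and x: "x \<in> carrier G" and a: "g \<otimes> x \<otimes> inv g \<in> N"
  have "inv g \<otimes> (g \<otimes> x \<otimes> inv g) \<otimes> inv (inv g) \<in> N" by (rule N_conj[OF inv_closed[OF g] a])
  then show "x \<in> N" using g x by (simp add: m_assoc)
qed (rule N_conj)

lemma cj_ZC_N:
  assumes f: "f \<in> ZC N" and g: "g \<in> carrier G"
  shows "cj g f \<in> ZC N"
proof (rule ZC_I[OF N_sub])
  show "cj g f x = 0" if "x \<notin> N" for x
    using that N_conj_iff[OF g, of x] ZC_outside[OF f] by (auto simp: cj_def)
  fix k assume k: "k \<in> N"
  have kc: "k \<in> carrier G" by (rule N_carrier[OF k])
  let ?k = "g \<otimes> k \<otimes> inv g"
  have "cj k (cj g f) = cj (?k \<otimes> g) f" using g kc by (simp add: cj_cj m_assoc)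
  also have "\<dots> = cj g (cj ?k f)" using g kc by (simp add: cj_cj)
  also have "cj ?k f = f" by (rule ZC_cj[OF f N_sub N_conj[OF g k]])
  finally show "cj k (cj g f) = cj g f" .
qed

lemma cj_irrfun:
  assumes a: "irrfun N \<psi>" and g: "g \<in> carrier G"
  shows "irrfun N (cj g \<psi>)"
  unfolding irrfun_def
proof (intro conjI ballI)
  note A = irrfunD[OF a]
  show "cj g \<psi> \<in> ZC N" by (rule cj_ZC_N[OF A(1) g])
  have one: "cj g \<psi> \<one> = \<psi> \<one>" using g by (simp add: cj_def)
  show "\<exists>r::real. r > 0 \<and> cj g \<psi> \<one> = of_real r" using a one by (auto simp: irrfun_def)
  show "conv (cj g \<psi>) (cj g \<psi>) = (\<lambda>x. of_nat (card N) / cj g \<psi> \<one> * cj g \<psi> x)"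
    unfolding one using cj_conv[OF g, of \<psi> \<psi>] A(3) by (simp add: scale_simps)
  fix f assume f: "f \<in> ZC N"
  have "cj g (cj (inv g) f) = f"
    using g cj_one[OF N_outside[OF f]] by (simp add: cj_cj)
  moreover obtain c where "conv \<psi> (cj (inv g) f) = (\<lambda>x. c * \<psi> x)"
    using A(4)[OF cj_ZC_N[OF f inv_closed[OF g]]] by blast
  ultimately have "conv (cj g \<psi>) f = (\<lambda>x. c * cj g \<psi> x)"
    using cj_conv[OF g, of \<psi> "cj (inv g) f"] by (simp add: cj_scale)
  then show "\<exists>c. conv (cj g \<psi>) f = (\<lambda>x. c * cj g \<psi> x)" by blast
qed

lemma T_sub: "subgroup T G"
proof
  show "T \<subseteq> carrier G" by (auto simp: T_def)
  show "\<one> \<in> T" using cj_one[OF N_outside[OF irrfunD(1)[OF irr]]] by (simp add: T_def)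
  fix x assume x: "x \<in> T"
  then have xc: "x \<in> carrier G" and xt: "cj x \<theta> = \<theta>" by (auto simp: T_def)
  show "x \<otimes> y \<in> T" if "y \<in> T" for y
    using that xc xt cj_cj[of y x \<theta>] by (simp add: T_def)
  have "cj (inv x) \<theta> = cj (inv x) (cj x \<theta>)" using xt by simp
  also have "\<dots> = cj \<one> \<theta>" using xc by (simp add: cj_cj)
  also have "\<dots> = \<theta>" by (rule cj_one[OF N_outside[OF irrfunD(1)[OF irr]]])
  finally show "inv x \<in> T" using xc by (simp add: T_def)
qed

lemma T_carrier: "t \<in> T \<Longrightarrow> t \<in> carrier G"
  by (simp add: T_def)

lemma N_T: "n \<in> N \<Longrightarrow> n \<in> T"
  using ZC_cj[OF irrfunD(1)[OF irr] N_sub] N_carrier by (simp add: T_def)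

lemma e_ZC: "e \<in> ZC N"
  using irrfunD(1)[OF irr] by (auto simp: ZC_def e_def)

lemma e_outside: "x \<notin> N \<Longrightarrow> e x = 0"
  by (rule ZC_outside[OF e_ZC])

lemma cj_e: "t \<in> T \<Longrightarrow> cj t e = e"
  by (simp add: e_def scale_simps T_def)

lemma e_ZC_T: "e \<in> ZC T"
  by (rule ZC_I[OF T_sub]) (use e_outside N_T cj_e in blast)+

lemma cardN_nz: "of_nat (card N) \<noteq> (0::complex)"
  using subgroup_card[OF N_sub] by simp

lemma e_idem: "conv e e = e"
proof
  fix x
  have "conv e e x = (\<theta> \<one> / of_nat (card N)) * ((\<theta> \<one> / of_nat (card N)) * (of_nat (card N) / \<theta> \<one> * \<theta> x))"
    unfolding e_def conv_scale_left conv_scale_right irrfunD(3)[OF irr] ..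
  also have "\<dots> = e x" using cardN_nz irrfunD(2)[OF irr] by (simp add: e_def)
  finally show "conv e e x = e x" .
qed

lemma e_orthogonal:
  assumes g: "g \<in> carrier G" "g \<notin> T"
  shows "conv e (cj g e) = (\<lambda>x. 0)" "conv (cj g e) e = (\<lambda>x. 0)"
proof -
  have "conv \<theta> (cj g \<theta>) = (\<lambda>x. 0)"
    using irrfun_eq[OF N_sub irr cj_irrfun[OF irr g(1)]] g by (auto simp: T_def)
  then show 1: "conv e (cj g e) = (\<lambda>x. 0)"
    by (simp add: e_def scale_simps)
  show "conv (cj g e) e = (\<lambda>x. 0)"
    using 1 ZC_commute[OF N_sub e_ZC cj_ZC_N[OF e_ZC g(1)]] by simp
qed

text \<open>At one fixed point \<open>x\<close>, a right factor \<open>b\<close> acts like the left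
  factor \<open>cj (inv x) b\<close>, since \<open>x \<otimes> inv m\<close> is
  \<open>inv (x \<otimes> m \<otimes> inv x) \<otimes> x\<close>. If both \<open>a\<close> and
  \<open>b\<close> are \<open>e\<close> and \<open>x\<close> lies outside \<open>T\<close>, the two
  left factors are orthogonal idempotents, and the value is 0.\<close>

lemma sandwich:
  assumes x: "x \<in> carrier G"
  shows "conv a (conv f b) x = conv (conv (cj (inv x) b) a) f x"
proof -
  let ?c = "carrier G"
  have "conv a (conv f b) x = (\<Sum>n\<in>?c. \<Sum>m\<in>?c. a n * (f (inv n \<otimes> x \<otimes> inv m) * b m))"
    using x by (simp add: conv_def[of a] conv_alt sum_distrib_left)
  also have "\<dots> = (\<Sum>n\<in>?c. \<Sum>m\<in>?c. a n * (f (inv n \<otimes> (inv m \<otimes> x)) * b (inv x \<otimes> m \<otimes> x)))"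
  proof (rule sum.cong[OF refl])
    fix n assume n: "n \<in> ?c"
    let ?F = "\<lambda>m. a n * (f (inv n \<otimes> x \<otimes> inv m) * b m)"
    have ix: "inv x \<in> ?c" using x by simp
    have "sum ?F ?c = (\<Sum>m\<in>?c. ?F (inv x \<otimes> m))" by (rule sum_G_left[OF ix, symmetric])
    also have "\<dots> = (\<Sum>m\<in>?c. ?F (inv x \<otimes> (m \<otimes> x)))" by (rule sum_G_right[OF x, symmetric])
    also have "\<dots> = (\<Sum>m\<in>?c. a n * (f (inv n \<otimes> (inv m \<otimes> x)) * b (inv x \<otimes> m \<otimes> x)))"
      using n x by (intro sum.cong refl) (simp add: inv_mult_group m_assoc)
    finally show "sum ?F ?c = (\<Sum>m\<in>?c. a n * (f (inv n \<otimes> (inv m \<otimes> x)) * b (inv x \<otimes> m \<otimes> x)))" .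
  qed
  also have "\<dots> = (\<Sum>m\<in>?c. \<Sum>n\<in>?c. a n * (f (inv n \<otimes> (inv m \<otimes> x)) * b (inv x \<otimes> m \<otimes> x)))"
    by (rule sum.swap)
  also have "\<dots> = conv (cj (inv x) b) (conv a f) x"
    using x by (simp add: conv_def cj_def sum_distrib_left mult_ac)
  finally show ?thesis by (simp add: conv_assoc)
qed

lemma e_sandwich_outside:
  assumes x: "x \<notin> T"
  shows "conv e (conv f e) x = 0"
proof (cases "x \<in> carrier G")
  case True
  then have "inv x \<notin> T" using x subgroup.m_inv_closed[OF T_sub, of "inv x"] by auto
  then show ?thesis using sandwich[OF True, of e f e] e_orthogonal(2)[of "inv x"] True by simp
qed simp

section \<open>Induction from the stabiliser\<close>

definition ZCe :: "('a \<Rightarrow> complex) set" where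
  "ZCe = {f \<in> ZC T. conv e f = f}"

definition ind :: "('a \<Rightarrow> complex) \<Rightarrow> 'a \<Rightarrow> complex" where
  "ind f = (\<lambda>x. \<Sum>g\<in>carrier G. 1 / of_nat (card T) * cj g f x)"

lemma cardT_nz: "of_nat (card T) \<noteq> (0::complex)"
  using subgroup_card[OF T_sub] by simp

lemma ind_ZC: "ind f \<in> ZC (carrier G)"
proof (rule ZC_I[OF subgroup_self])
  show "ind f x = 0" if "x \<notin> carrier G" for x using that by (simp add: ind_def)
  fix k assume k: "k \<in> carrier G"
  show "cj k (ind f) = ind f"
  proof
    fix x
    have "cj k (ind f) x = (\<Sum>g\<in>carrier G. 1 / of_nat (card T) * cj (g \<otimes> k) f x)"
      using k by (simp add: ind_def cj_sum scale_simps cj_cj)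
    also have "\<dots> = ind f x" unfolding ind_def by (rule sum_G_right[OF k])
    finally show "cj k (ind f) x = ind f x" .
  qed
qed

text \<open>For \<open>g\<close> outside \<open>T\<close>, the summand \<open>cj g f\<close> has the
  left factor \<open>cj g e\<close>, which is orthogonal to \<open>e\<close>; the remaining
  \<open>card T\<close> summands all equal \<open>f\<close> and cancel the normalisation. So
  multiplication by \<open>e\<close> undoes \<open>ind\<close>.\<close>

lemma e_ind:
  assumes f: "f \<in> ZCe"
  shows "conv e (ind f) = f"
proof
  fix x
  have fT: "f \<in> ZC T" and ef: "conv e f = f" using f by (auto simp: ZCe_def)
  have "conv e (cj g f) = (if g \<in> T then f else (\<lambda>x. 0))" if g: "g \<in> carrier G" for g
  proof (cases "g \<in> T")
    case True
    then show ?thesis using ZC_cj[OF fT T_sub] ef by simp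
  next
    case False
    have "conv e (cj g f) = conv e (conv (cj g e) (cj g f))" using cj_conv[OF g, of e f] ef by simp
    also have "\<dots> = (\<lambda>x. 0)" using e_orthogonal(1)[OF g False] by (simp flip: conv_assoc)
    finally show ?thesis using False by simp
  qed
  then have "conv e (ind f) x = (\<Sum>g\<in>carrier G. if g \<in> T then 1 / of_nat (card T) * f x else 0)"
    unfolding ind_def conv_sum_right conv_scale_right by (intro sum.cong) auto
  also have "\<dots> = f x"
  proof -
    have "carrier G \<inter> T = T" using T_carrier by auto
    then show ?thesis using cardT_nz by (simp add: sum.If_cases)
  qed
  finally show "conv e (ind f) x = f x" .
qed

lemma commute_central: "f \<in> ZC (carrier G) \<Longrightarrow> (\<And>x. x \<notin> carrier G \<Longrightarrow> g x = 0) \<Longrightarrow> conv f g = conv g f"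
  by (rule conv_commute[OF subgroup_self]) (auto simp: ZC_cj[OF _ subgroup_self])

lemma e_outside_G: "x \<notin> carrier G \<Longrightarrow> e x = 0"
  using e_outside N_carrier by blast

text \<open>For central \<open>f\<close> the product with \<open>e\<close> equals \<open>f\<close>
  between two copies of \<open>e\<close>, which vanishes outside \<open>T\<close>.\<close>

lemma central_conv_e:
  assumes f: "f \<in> ZC (carrier G)"
  shows "conv f e \<in> ZCe"
proof -
  have comm: "conv f e = conv e f" by (rule commute_central[OF f e_outside_G])
  have ee: "conv e (conv f e) = conv f e"
    unfolding comm by (simp add: e_idem flip: conv_assoc)
  have "conv f e \<in> ZC T"
  proof (rule ZC_I[OF T_sub])
    show "conv f e x = 0" if "x \<notin> T" for x using e_sandwich_outside[OF that, of f] ee by simp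
    show "cj t (conv f e) = conv f e" if "t \<in> T" for t
      using cj_conv[OF T_carrier[OF that], of f e] cj_e[OF that]
        ZC_cj[OF f subgroup_self T_carrier[OF that]] by simp
  qed
  then show ?thesis using ee by (simp add: ZCe_def)
qed

lemma ZCe_I: "f \<in> ZC T \<Longrightarrow> conv e f \<in> ZCe"
  using ZC_conv[OF T_sub e_ZC_T] by (simp add: ZCe_def e_idem flip: conv_assoc)

lemma ind_one: "f \<in> ZC T \<Longrightarrow> ind f \<one> = of_nat (card (carrier G)) / of_nat (card T) * f \<one>"
  unfolding ind_def cj_def by simp

lemma conv_ind: "f \<in> ZC (carrier G) \<Longrightarrow> conv f (ind h) = ind (conv f h)"
proof
  fix x assume f: "f \<in> ZC (carrier G)"
  have "conv f (cj g h) = cj g (conv f h)" if "g \<in> carrier G" for g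
    using cj_conv[OF that, of f h] ZC_cj[OF f subgroup_self that] by simp
  then show "conv f (ind h) x = ind (conv f h) x"
    unfolding ind_def conv_sum_right conv_scale_right by (intro sum.cong) auto
qed

lemma ind_scale: "ind (\<lambda>x. c * f x) = (\<lambda>x. c * ind f x)"
  by (simp add: ind_def scale_simps sum_distrib_left mult_ac)

lemma ind_div: "ind (\<lambda>x. f x / c) = (\<lambda>x. ind f x / c)"
  using ind_scale[of "1 / c" f] by simp

text \<open>Not annihilating \<theta> is the algebraic form of lying above it;
  \<open>Irr_over_eq\<close> identifies this with a nonzero inner product.\<close>

definition over :: "('a \<Rightarrow> complex) set" where
  "over = {\<chi>. irrfun (carrier G) \<chi> \<and> conv \<chi> \<theta> \<noteq> (\<lambda>x. 0)}"

definition over_T :: "('a \<Rightarrow> complex) set" where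
  "over_T = {\<psi>. irrfun T \<psi> \<and> conv e \<psi> = \<psi>}"

lemma clifford_res:
  assumes "\<chi> \<in> over"
  shows "conv \<chi> e \<in> over_T" "ind (conv \<chi> e) = \<chi>"
    "conv \<chi> e \<one> = of_nat (card T) / of_nat (card (carrier G)) * \<chi> \<one>"
proof -
  have irrX: "irrfun (carrier G) \<chi>" and nz: "conv \<chi> \<theta> \<noteq> (\<lambda>x. 0)" using assms by (auto simp: over_def)
  note X = irrfunD[OF irrX]
  let ?\<psi> = "conv \<chi> e"
  have cG: "of_nat (card (carrier G)) \<noteq> (0::complex)" using one_closed by auto
  have psi: "?\<psi> \<in> ZCe" by (rule central_conv_e[OF X(1)])
  have psinz: "?\<psi> \<noteq> (\<lambda>x. 0)"
  proof
    assume "?\<psi> = (\<lambda>x. 0)"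
    then have "(\<theta> \<one> / of_nat (card N)) * conv \<chi> \<theta> x = 0" for x
      unfolding e_def conv_scale_right by (rule fun_cong)
    then show False using nz irrfunD(2)[OF irr] cardN_nz by auto
  qed
  have eZCe: "e \<in> ZCe" using e_ZC_T e_idem by (simp add: ZCe_def)
  \<comment> \<open>\<open>ind e\<close> is central, so it acts on \<chi> by a scalar.
    Multiplication by \<open>e\<close>, which turns \<open>ind e\<close> into \<open>e\<close>,
    shows that the scalar is 1.\<close>
  obtain c where c: "conv \<chi> (ind e) = (\<lambda>x. c * \<chi> x)" using X(4)[OF ind_ZC] by blast
  have "?\<psi> = conv (conv \<chi> (ind e)) e"
  proof -
    have "conv (ind e) e = conv e (ind e)" by (rule commute_central[OF ind_ZC e_outside_G])
    then show ?thesis using e_ind[OF eZCe] by (simp add: conv_assoc)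
  qed
  also have "\<dots> = (\<lambda>x. c * ?\<psi> x)" unfolding c conv_scale_left ..
  finally have "c = 1" using psinz by (metis (no_types, lifting) ext mult_cancel_right2)
  then show ind: "ind ?\<psi> = \<chi>" using c conv_ind[OF X(1), of e] by simp
  have "\<chi> \<one> = of_nat (card (carrier G)) / of_nat (card T) * ?\<psi> \<one>"
    using ind_one[of ?\<psi>] psi ind by (simp add: ZCe_def)
  then show one: "?\<psi> \<one> = of_nat (card T) / of_nat (card (carrier G)) * \<chi> \<one>"
    using cG cardT_nz by (simp add: field_simps)
  have comm: "conv e \<chi> = conv \<chi> e" by (rule commute_central[OF X(1) e_outside_G, symmetric])
  have "irrfun T ?\<psi>"
    unfolding irrfun_def
  proof (intro conjI ballI)
    show "?\<psi> \<in> ZC T" using psi by (simp add: ZCe_def)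
    obtain r where r: "r > 0" "\<chi> \<one> = of_real r" using irrX by (auto simp: irrfun_def)
    show "\<exists>r::real. r > 0 \<and> ?\<psi> \<one> = of_real r"
      using r one subgroup_card[OF T_sub] subgroup_card[OF subgroup_self]
      by (intro exI[of _ "real (card T) / real (card (carrier G)) * r"]) simp
    have "conv ?\<psi> ?\<psi> = conv \<chi> (conv (conv e \<chi>) e)" by (simp add: conv_assoc)
    also have "\<dots> = conv (conv \<chi> \<chi>) e" unfolding comm by (simp add: conv_assoc e_idem)
    also have "\<dots> = (\<lambda>x. of_nat (card (carrier G)) / \<chi> \<one> * ?\<psi> x)" unfolding X(3) conv_scale_left ..
    finally show "conv ?\<psi> ?\<psi> = (\<lambda>x. of_nat (card T) / ?\<psi> \<one> * ?\<psi> x)"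
      unfolding one using cardT_nz by simp
    fix f assume f: "f \<in> ZC T"
    \<comment> \<open>\<open>ind (conv e f)\<close> is central in the large algebra and its product
      with \<open>e\<close> is \<open>conv e f\<close>, so the ideal property of \<chi> yields the
      one of its Clifford correspondent.\<close>
    obtain c where c: "conv \<chi> (ind (conv e f)) = (\<lambda>x. c * \<chi> x)" using X(4)[OF ind_ZC] by blast
    have "conv ?\<psi> f = conv \<chi> (conv e (ind (conv e f)))" using e_ind[OF ZCe_I[OF f]] by (simp add: conv_assoc)
    also have "\<dots> = conv (conv \<chi> (ind (conv e f))) e"
    proof -
      have "conv (ind (conv e f)) e = conv e (ind (conv e f))" by (rule commute_central[OF ind_ZC e_outside_G])
      then show ?thesis by (simp add: conv_assoc)
    qed
    also have "\<dots> = (\<lambda>x. c * ?\<psi> x)" unfolding c conv_scale_left ..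
    finally show "\<exists>c. conv ?\<psi> f = (\<lambda>x. c * ?\<psi> x)" by blast
  qed
  then show "?\<psi> \<in> over_T" using psi by (simp add: over_T_def ZCe_def)
qed

text \<open>A central \<open>f\<close> of the large algebra acts on \<psi> through
  \<open>conv f e\<close>, which is central for \<open>T\<close>, and induction commutes with
  multiplication by \<open>f\<close>. This transports the ideal property upwards.\<close>

lemma clifford_ind:
  assumes "\<psi> \<in> over_T"
  shows "ind \<psi> \<in> over" "conv (ind \<psi>) e = \<psi>"
proof -
  have irrP: "irrfun T \<psi>" and ep: "conv e \<psi> = \<psi>" using assms by (auto simp: over_T_def)
  note P = irrfunD[OF irrP]
  let ?\<chi> = "ind \<psi>"
  have cG: "of_nat (card (carrier G)) \<noteq> (0::complex)" using one_closed by auto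
  have psi: "\<psi> \<in> ZCe" using P(1) ep by (simp add: ZCe_def)
  have chiZ: "?\<chi> \<in> ZC (carrier G)" by (rule ind_ZC)
  have comm: "conv e ?\<chi> = conv ?\<chi> e" by (rule commute_central[OF chiZ e_outside_G, symmetric])
  show res: "conv ?\<chi> e = \<psi>" using e_ind[OF psi] comm by simp
  have one: "?\<chi> \<one> = of_nat (card (carrier G)) / of_nat (card T) * \<psi> \<one>" by (rule ind_one[OF P(1)])
  have pout: "\<psi> x = 0" if "x \<notin> carrier G" for x using ZC_outside[OF P(1)] T_carrier that by blast
  have "irrfun (carrier G) ?\<chi>"
    unfolding irrfun_def
  proof (intro conjI ballI chiZ)
    obtain r where r: "r > 0" "\<psi> \<one> = of_real r" using irrP by (auto simp: irrfun_def)
    show "\<exists>r::real. r > 0 \<and> ?\<chi> \<one> = of_real r"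
      using r one subgroup_card[OF T_sub] subgroup_card[OF subgroup_self]
      by (intro exI[of _ "real (card (carrier G)) / real (card T) * r"]) simp
    have "conv ?\<chi> \<psi> = conv \<psi> \<psi>" using res ep by (metis conv_assoc)
    then have "conv ?\<chi> ?\<chi> = (\<lambda>x. of_nat (card T) / \<psi> \<one> * ?\<chi> x)"
      unfolding conv_ind[OF chiZ] P(3) by (simp add: ind_scale ind_div)
    then show "conv ?\<chi> ?\<chi> = (\<lambda>x. of_nat (card (carrier G)) / ?\<chi> \<one> * ?\<chi> x)"
      unfolding one using cG by simp
    fix f assume f: "f \<in> ZC (carrier G)"
    have fe: "conv f e \<in> ZC T" using central_conv_e[OF f] by (simp add: ZCe_def)
    obtain c where c: "conv \<psi> (conv f e) = (\<lambda>x. c * \<psi> x)" using P(4)[OF fe] by blast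
    have "conv f \<psi> = conv (conv f e) \<psi>" using ep by (simp add: conv_assoc)
    also have "\<dots> = conv \<psi> (conv f e)" by (rule ZC_commute[OF T_sub fe P(1)])
    finally have "conv f ?\<chi> = (\<lambda>x. c * ?\<chi> x)" unfolding conv_ind[OF f] c by (simp add: ind_scale)
    moreover have "conv ?\<chi> f = conv f ?\<chi>"
      by (rule commute_central[OF chiZ]) (use ZC_outside[OF f] in blast)
    ultimately show "\<exists>c. conv ?\<chi> f = (\<lambda>x. c * ?\<chi> x)" by auto
  qed
  moreover have "conv ?\<chi> \<theta> \<noteq> (\<lambda>x. 0)"
  proof
    assume "conv ?\<chi> \<theta> = (\<lambda>x. 0)"
    then have "conv ?\<chi> e \<one> = 0" by (simp add: e_def scale_simps)
    then show False using P(2) res by simp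
  qed
  ultimately show "?\<chi> \<in> over" by (simp add: over_def)
qed

text \<open>The central element \<open>ind e\<close> acts on \<open>\<chi>\<close> by a nonzero scalar, so every
  \<open>\<theta>'\<close> below \<open>\<chi>\<close> fails to be orthogonal to some conjugate of \<open>\<theta>\<close>.\<close>
lemma clifford_conjugate:
  assumes chi: "\<chi> \<in> over" and irr': "irrfun N \<theta>'" and nz: "conv \<chi> \<theta>' \<noteq> (\<lambda>x. 0)"
  obtains g where "g \<in> carrier G" "\<theta>' = cj g \<theta>"
proof -
  have X: "\<chi> \<in> ZC (carrier G)" using chi irrfunD(1) by (auto simp: over_def)
  have "conv \<chi> (ind e) = \<chi>" using clifford_res(2)[OF chi] conv_ind[OF X] by simp
  then have "conv \<chi> (conv (ind e) \<theta>') \<noteq> (\<lambda>x. 0)" using nz by (simp flip: conv_assoc)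
  then have "conv (ind e) \<theta>' \<noteq> (\<lambda>x. 0)" by auto
  then obtain x where "(\<Sum>g\<in>carrier G. 1 / of_nat (card T) * conv (cj g e) \<theta>' x) \<noteq> 0"
    unfolding ind_def conv_sum_left conv_scale_left by auto
  then obtain g where g: "g \<in> carrier G" and "1 / of_nat (card T) * conv (cj g e) \<theta>' x \<noteq> 0"
    by (rule sum.not_neutral_contains_not_neutral)
  then have "conv (cj g \<theta>) \<theta>' \<noteq> (\<lambda>x. 0)"
    by (auto simp: e_def scale_simps)
  then have "cj g \<theta> = \<theta>'" by (rule irrfun_eq[OF N_sub cj_irrfun[OF irr g] irr'])
  then show ?thesis using that g by blast
qed

end

section \<open>Twisted group algebras\<close>

text \<open>The centre of the twisted group algebra of \<open>T / N\<close> with factor set \<open>\<alpha>\<close>, its elements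
  being regarded as functions on \<open>T\<close> that are constant on cosets of \<open>N\<close>.\<close>
definition twcls :: "('a, 'b) monoid_scheme \<Rightarrow> 'a set \<Rightarrow> 'a set \<Rightarrow> ('a \<Rightarrow> 'a \<Rightarrow> complex) \<Rightarrow> ('a \<Rightarrow> complex) set" where
  "twcls G T N \<alpha> = {q. (\<forall>x. x \<notin> T \<longrightarrow> q x = 0) \<and> (\<forall>x\<in>T. \<forall>n\<in>N. q (n \<otimes>\<^bsub>G\<^esub> x) = q x) \<and>
     (\<forall>g\<in>T. \<forall>x\<in>T. q (g \<otimes>\<^bsub>G\<^esub> x \<otimes>\<^bsub>G\<^esub> inv\<^bsub>G\<^esub> g) * \<alpha> (g \<otimes>\<^bsub>G\<^esub> x \<otimes>\<^bsub>G\<^esub> inv\<^bsub>G\<^esub> g) g = \<alpha> g x * q x)}"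

text \<open>The sum runs over \<open>T\<close> instead of \<open>T / N\<close>, so on functions
  constant on cosets it is \<open>card N\<close> times the product of the twisted group algebra.
  Therefore \<open>card T\<close>, and not the index of \<open>N\<close>, appears in
  \<open>twirr\<close>, the counterpart of \<open>irrfun\<close>.\<close>

definition tw :: "('a, 'b) monoid_scheme \<Rightarrow> 'a set \<Rightarrow> ('a \<Rightarrow> 'a \<Rightarrow> complex) \<Rightarrow> ('a \<Rightarrow> complex) \<Rightarrow> ('a \<Rightarrow> complex) \<Rightarrow> 'a \<Rightarrow> complex" where
  "tw G T \<alpha> q1 q2 = (\<lambda>x. if x \<in> T then
     \<Sum>z\<in>T. q1 z * q2 (inv\<^bsub>G\<^esub> z \<otimes>\<^bsub>G\<^esub> x) * \<alpha> z (inv\<^bsub>G\<^esub> z \<otimes>\<^bsub>G\<^esub> x) else 0)"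

definition twirr :: "('a, 'b) monoid_scheme \<Rightarrow> 'a set \<Rightarrow> 'a set \<Rightarrow> ('a \<Rightarrow> 'a \<Rightarrow> complex) \<Rightarrow> ('a \<Rightarrow> complex) set" where
  "twirr G T N \<alpha> = {q \<in> twcls G T N \<alpha>. (\<exists>r::real. r > 0 \<and> q \<one>\<^bsub>G\<^esub> = of_real r) \<and>
     tw G T \<alpha> q q = (\<lambda>x. of_nat (card T) / q \<one>\<^bsub>G\<^esub> * q x) \<and>
     (\<forall>f\<in>twcls G T N \<alpha>. \<exists>c. tw G T \<alpha> q f = (\<lambda>x. c * q x))}"

lemma smult_cancel:
  assumes A: "(A :: complex mat) \<in> carrier_mat d d" "B \<in> carrier_mat d d" "A * B = 1\<^sub>m d" and d: "d > 0"
    and eq: "c \<cdot>\<^sub>m A = c' \<cdot>\<^sub>m A"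
  shows "c = c'"
proof -
  have "c \<cdot>\<^sub>m 1\<^sub>m d = (c \<cdot>\<^sub>m A) * B" "c' \<cdot>\<^sub>m 1\<^sub>m d = (c' \<cdot>\<^sub>m A) * B"
    using A by (simp_all add: mult_smult_assoc_mat[of _ d d _ d])
  then have "(c \<cdot>\<^sub>m 1\<^sub>m d :: complex mat) $$ (0,0) = (c' \<cdot>\<^sub>m 1\<^sub>m d) $$ (0,0)" using eq by simp
  then show ?thesis using d by simp
qed

lemma mat_inv_unique:
  assumes "(A :: complex mat) \<in> carrier_mat d d" "B \<in> carrier_mat d d" "C \<in> carrier_mat d d"
    "A * B = 1\<^sub>m d" "A * C = 1\<^sub>m d"
  shows "B = C"
proof -
  have BA: "B * A = 1\<^sub>m d" by (rule mat_mult_left_right_inverse[OF assms(1,2,4)])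
  have "B = B * (A * C)" using assms by simp
  also have "\<dots> = (B * A) * C" using assms by (intro assoc_mult_mat[symmetric]) auto
  finally show ?thesis using BA assms by simp
qed

locale char_data = clifford G N \<theta> T for G (structure) and N \<theta> T +
  fixes d :: nat and P :: "'a \<Rightarrow> complex mat" and \<alpha> :: "'a \<Rightarrow> 'a \<Rightarrow> complex"
  assumes assoc: "assoc_proj G T N \<theta> d P \<alpha>" and sr: "schur_rep N d P"
    and \<alpha>_nz: "\<And>x y. x \<in> T \<Longrightarrow> y \<in> T \<Longrightarrow> \<alpha> x y \<noteq> 0"
begin

section \<open>The projective representation and its factor set\<close>

lemma d_pos: "d > 0"
  using sr by (simp add: schur_rep_def)

lemma P_carrier [simp]: "x \<in> T \<Longrightarrow> P x \<in> carrier_mat d d"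
  using assoc by (simp add: assoc_proj_def proj_rep_def)

lemma P_mult: "x \<in> T \<Longrightarrow> y \<in> T \<Longrightarrow> P x * P y = \<alpha> x y \<cdot>\<^sub>m P (x \<otimes> y)"
  using assoc by (simp add: assoc_proj_def proj_rep_def)

lemma P_N_left: "n \<in> N \<Longrightarrow> x \<in> T \<Longrightarrow> P (n \<otimes> x) = P n * P x"
  using assoc by (simp add: assoc_proj_def)

lemma P_N_right: "n \<in> N \<Longrightarrow> x \<in> T \<Longrightarrow> P (x \<otimes> n) = P x * P n"
  using assoc by (simp add: assoc_proj_def)

lemma P_trace: "n \<in> N \<Longrightarrow> mat_trace (P n) = \<theta> n"
  using assoc by (simp add: assoc_proj_def)

lemma P_one: "P \<one> = 1\<^sub>m d"
  using assoc by (simp add: assoc_proj_def is_rep_def)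

lemma \<theta>_one: "\<theta> \<one> = of_nat d"
  using P_trace[OF subgroup.one_closed[OF N_sub]] P_one by simp

lemma T_closed [simp]: "x \<in> T \<Longrightarrow> y \<in> T \<Longrightarrow> x \<otimes> y \<in> T" "x \<in> T \<Longrightarrow> inv x \<in> T" "\<one> \<in> T"
  using T_sub by (auto intro: subgroup.m_closed subgroup.m_inv_closed subgroup.one_closed)

lemma N_closed: "x \<in> N \<Longrightarrow> y \<in> N \<Longrightarrow> x \<otimes> y \<in> N" "x \<in> N \<Longrightarrow> inv x \<in> N" "\<one> \<in> N"
  using N_sub by (auto intro: subgroup.m_closed subgroup.m_inv_closed subgroup.one_closed)

text \<open>The inverse matrix, written as a multiple of \<open>P (inv x)\<close> so that its
  entries lie in \<open>Qab\<close> together with those of \<open>P\<close> and the values of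
  \<alpha>.\<close>

definition Pinv :: "'a \<Rightarrow> complex mat" where
  "Pinv x = (1 / \<alpha> x (inv x)) \<cdot>\<^sub>m P (inv x)"

lemma Pinv_carrier [simp]: "x \<in> T \<Longrightarrow> Pinv x \<in> carrier_mat d d"
  by (simp add: Pinv_def)

lemma P_Pinv: "x \<in> T \<Longrightarrow> P x * Pinv x = 1\<^sub>m d"
proof -
  assume x: "x \<in> T"
  have "P x * Pinv x = (1 / \<alpha> x (inv x)) \<cdot>\<^sub>m (P x * P (inv x))"
    unfolding Pinv_def using x by (intro mult_smult_distrib[of _ d d _ d]) auto
  also have "\<dots> = (1 / \<alpha> x (inv x)) \<cdot>\<^sub>m (\<alpha> x (inv x) \<cdot>\<^sub>m 1\<^sub>m d)"
    using x P_mult[of x "inv x"] P_one T_carrier[OF x] by simp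
  finally show ?thesis using \<alpha>_nz[of x "inv x"] x by (auto intro!: eq_matI)
qed

lemma Pinv_P: "x \<in> T \<Longrightarrow> Pinv x * P x = 1\<^sub>m d"
  by (rule mat_mult_left_right_inverse[OF _ _ P_Pinv]) auto

lemma P_N_inv: "n \<in> N \<Longrightarrow> P n * P (inv n) = 1\<^sub>m d" "n \<in> N \<Longrightarrow> P (inv n) * P n = 1\<^sub>m d"
  using rep_inv[OF _ N_sub, of d P] sr by (auto simp: schur_rep_def)

lemma Pinv_mult_N: "x \<in> T \<Longrightarrow> n \<in> N \<Longrightarrow> Pinv (x \<otimes> n) = P (inv n) * Pinv x"
proof -
  assume x: "x \<in> T" and n: "n \<in> N"
  have nT: "n \<in> T" "inv n \<in> T" using n N_T N_closed by auto
  show ?thesis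
  proof (rule mat_inv_unique)
    show "P (x \<otimes> n) * Pinv (x \<otimes> n) = 1\<^sub>m d" using x nT by (simp add: P_Pinv)
    have "P (x \<otimes> n) * (P (inv n) * Pinv x) = P x * (P n * P (inv n)) * Pinv x"
      using x n nT by (simp add: P_N_right assoc_mult_mat[of _ d d _ d _ d])
    also have "\<dots> = 1\<^sub>m d" using x n P_N_inv(1)[OF n] by (simp add: P_Pinv right_mult_one_mat[OF P_carrier])
    finally show "P (x \<otimes> n) * (P (inv n) * Pinv x) = 1\<^sub>m d" .
  qed (use x nT in auto)
qed

lemma P_Pinv_conj:
  assumes A: "A \<in> carrier_mat d d" and B: "B \<in> carrier_mat d d"
    and AB: "A * B = 1\<^sub>m d" "B * A = 1\<^sub>m d" and x: "x \<in> T"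
  shows "B * P x * A * (B * Pinv x * A) = 1\<^sub>m d"
proof -
  have "B * P x * A * (B * Pinv x * A) = B * P x * (A * B) * Pinv x * A"
    using x A B by (simp add: assoc_mult_mat[of _ d d _ d _ d])
  also have "\<dots> = B * (P x * Pinv x) * A"
    unfolding AB(1) using x A B by (simp add: right_mult_one_mat[of _ d d] assoc_mult_mat[of _ d d _ d _ d])
  finally show ?thesis unfolding P_Pinv[OF x] using A B AB by (simp add: right_mult_one_mat[of _ d d])
qed

lemma P_smult_cancel: "x \<in> T \<Longrightarrow> c \<cdot>\<^sub>m P x = c' \<cdot>\<^sub>m P x \<Longrightarrow> c = c'"
  by (rule smult_cancel[OF P_carrier Pinv_carrier P_Pinv d_pos])

text \<open>Both sides are the scalar by which \<open>P n * P x * P y\<close> differs from the value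
  of \<open>P\<close> at the product. With the variants for other positions of \<open>n\<close>,
  \<alpha> becomes a function on cosets of \<open>N\<close> in both arguments.\<close>

lemma \<alpha>_N_left: "n \<in> N \<Longrightarrow> x \<in> T \<Longrightarrow> y \<in> T \<Longrightarrow> \<alpha> (n \<otimes> x) y = \<alpha> x y"
proof -
  assume n: "n \<in> N" and x: "x \<in> T" and y: "y \<in> T"
  have nT: "n \<in> T" by (rule N_T[OF n])
  have "\<alpha> (n \<otimes> x) y \<cdot>\<^sub>m P (n \<otimes> (x \<otimes> y)) = P (n \<otimes> x) * P y"
    using P_mult[of "n \<otimes> x" y] nT x y T_carrier by (simp add: m_assoc)
  also have "\<dots> = P n * (P x * P y)" using n nT x y by (simp add: P_N_left assoc_mult_mat[of _ d d _ d _ d])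
  also have "\<dots> = \<alpha> x y \<cdot>\<^sub>m (P n * P (x \<otimes> y))"
    using nT x y by (simp add: P_mult mult_smult_distrib[of _ d d _ d])
  also have "\<dots> = \<alpha> x y \<cdot>\<^sub>m P (n \<otimes> (x \<otimes> y))" using n x y by (simp add: P_N_left)
  finally show ?thesis using nT x y by (intro P_smult_cancel[of "n \<otimes> (x \<otimes> y)"]) auto
qed

lemma move_right: "x \<in> T \<Longrightarrow> n \<in> N \<Longrightarrow> \<exists>n'\<in>N. x \<otimes> n = n' \<otimes> x"
  by (rule bexI[of _ "x \<otimes> n \<otimes> inv x"]) (use N_conj T_carrier N_carrier in \<open>auto simp: m_assoc\<close>)

lemma move_left: "x \<in> T \<Longrightarrow> n \<in> N \<Longrightarrow> \<exists>n'\<in>N. n \<otimes> x = x \<otimes> n'"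
  using N_conj[of "inv x" n]
  by (intro bexI[of _ "inv x \<otimes> n \<otimes> x"]) (use T_carrier N_carrier in \<open>auto simp: m_assoc\<close>)

lemma \<alpha>_N_mid: "n \<in> N \<Longrightarrow> x \<in> T \<Longrightarrow> y \<in> T \<Longrightarrow> \<alpha> x (n \<otimes> y) = \<alpha> x y"
proof -
  assume n: "n \<in> N" and x: "x \<in> T" and y: "y \<in> T"
  have nT: "n \<in> T" by (rule N_T[OF n])
  obtain n' where n': "n' \<in> N" "x \<otimes> n = n' \<otimes> x" using move_right[OF x n] by blast
  have n'T: "n' \<in> T" by (rule N_T[OF n'(1)])
  have eq: "x \<otimes> (n \<otimes> y) = n' \<otimes> x \<otimes> y" using n'(2) x y nT T_carrier by (simp flip: m_assoc)
  have "\<alpha> x (n \<otimes> y) \<cdot>\<^sub>m P (x \<otimes> (n \<otimes> y)) = P x * P (n \<otimes> y)"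
    using P_mult[of x "n \<otimes> y"] nT x y by simp
  also have "\<dots> = P (x \<otimes> n) * P y"
    using n nT x y by (simp add: P_N_left P_N_right assoc_mult_mat[of _ d d _ d _ d])
  also have "\<dots> = \<alpha> (n' \<otimes> x) y \<cdot>\<^sub>m P (x \<otimes> (n \<otimes> y))"
    unfolding n' eq using n'T x y by (simp add: P_mult)
  also have "\<alpha> (n' \<otimes> x) y = \<alpha> x y" by (rule \<alpha>_N_left[OF n'(1) x y])
  finally show ?thesis using nT x y by (intro P_smult_cancel[of "x \<otimes> (n \<otimes> y)"]) auto
qed

lemma coset_right: "(\<And>n x. n \<in> N \<Longrightarrow> x \<in> T \<Longrightarrow> F (n \<otimes> x) = F x) \<Longrightarrow> x \<in> T \<Longrightarrow> n \<in> N \<Longrightarrow> F (x \<otimes> n) = F x"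
  using move_right[of x n] by auto

lemma \<alpha>_N_left': "n \<in> N \<Longrightarrow> x \<in> T \<Longrightarrow> y \<in> T \<Longrightarrow> \<alpha> (x \<otimes> n) y = \<alpha> x y"
  by (rule coset_right[of "\<lambda>x. \<alpha> x y"]) (auto simp: \<alpha>_N_left)

lemma \<alpha>_N_right: "n \<in> N \<Longrightarrow> x \<in> T \<Longrightarrow> y \<in> T \<Longrightarrow> \<alpha> x (y \<otimes> n) = \<alpha> x y"
  by (rule coset_right[of "\<lambda>y. \<alpha> x y"]) (auto simp: \<alpha>_N_mid)

section \<open>Traces of the projective representation and twisted class functions\<close>

definition tr :: "'a \<Rightarrow> complex" where
  "tr x = (if x \<in> T then mat_trace (P x) else 0)"

text \<open>For a projective representation the trace of the inverse differs from
  \<open>tr (inv x)\<close> by the factor \<open>\<alpha> x (inv x)\<close>, which is divided out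
  here.\<close>

definition str :: "'a \<Rightarrow> complex" where
  "str x = mat_trace (Pinv x)"

text \<open>Clifford theory writes the characters above \<open>\<theta>\<close> as traces of \<open>Q \<otimes> P\<close> with \<open>Q\<close> a
  projective representation of \<open>T / N\<close>; \<open>pt\<close> and \<open>qf\<close> pass between the trace of \<open>Q\<close> and that
  of \<open>Q \<otimes> P\<close>.\<close>
definition pt :: "('a \<Rightarrow> complex) \<Rightarrow> 'a \<Rightarrow> complex" where
  "pt q = (\<lambda>x. q x * tr x)"

definition qf :: "('a \<Rightarrow> complex) \<Rightarrow> 'a \<Rightarrow> complex" where
  "qf f = (\<lambda>x. if x \<in> T then (\<Sum>n\<in>N. f (x \<otimes> n) * str (x \<otimes> n)) / of_nat (card N) else 0)"

text \<open>\<open>tr\<close> may vanish at single points, so \<open>q\<close> cannot be recovered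
  from \<open>pt q\<close> by division. The mean of the product of \<open>tr\<close> and
  \<open>str\<close> over every coset is 1, however, and this makes \<open>qf\<close> a left inverse
  of \<open>pt\<close>.\<close>

lemma sum_tr_str: "x \<in> T \<Longrightarrow> (\<Sum>n\<in>N. tr (x \<otimes> n) * str (x \<otimes> n)) = of_nat (card N)"
proof -
  assume x: "x \<in> T"
  have "(\<Sum>n\<in>N. tr (x \<otimes> n) * str (x \<otimes> n)) = (\<Sum>n\<in>N. mat_trace (P n * P x) * mat_trace (P (inv n) * Pinv x))"
  proof (rule sum.cong[OF refl])
    fix n assume n: "n \<in> N"
    then have nT: "n \<in> T" by (rule N_T)
    show "tr (x \<otimes> n) * str (x \<otimes> n) = mat_trace (P n * P x) * mat_trace (P (inv n) * Pinv x)"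
      using x n nT mat_trace_mult_comm[of "P x" d d "P n"] by (simp add: tr_def str_def P_N_right Pinv_mult_N)
  qed
  also have "\<dots> = of_nat (card N) / of_nat d * mat_trace (P x * Pinv x)"
    by (rule schur_trace_prod[OF sr N_sub]) (use x in auto)
  finally show ?thesis using d_pos by (simp add: P_Pinv[OF x])
qed

lemma qf_pt:
  assumes out: "\<And>x. x \<notin> T \<Longrightarrow> q x = 0" and coset: "\<And>n x. n \<in> N \<Longrightarrow> x \<in> T \<Longrightarrow> q (n \<otimes> x) = q x"
  shows "qf (pt q) = q"
proof
  fix x show "qf (pt q) x = q x"
  proof (cases "x \<in> T")
    case True
    have "(\<Sum>n\<in>N. pt q (x \<otimes> n) * str (x \<otimes> n)) = q x * (\<Sum>n\<in>N. tr (x \<otimes> n) * str (x \<otimes> n))"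
      using coset_right[OF coset True] by (simp add: pt_def sum_distrib_left mult.assoc)
    then show ?thesis using True sum_tr_str[OF True] cardN_nz by (simp add: qf_def)
  next
    case False
    then show ?thesis using out by (simp add: qf_def)
  qed
qed

lemma twclsD:
  assumes "q \<in> twcls G T N \<alpha>"
  shows "x \<notin> T \<Longrightarrow> q x = 0" "x \<in> T \<Longrightarrow> n \<in> N \<Longrightarrow> q (n \<otimes> x) = q x"
    "g \<in> T \<Longrightarrow> x \<in> T \<Longrightarrow> q (g \<otimes> x \<otimes> inv g) * \<alpha> (g \<otimes> x \<otimes> inv g) g = \<alpha> g x * q x"
  using assms by (auto simp: twcls_def)

lemma P_conj:
  assumes g: "g \<in> T" and x: "x \<in> T"
  shows "\<alpha> (g \<otimes> x \<otimes> inv g) g \<cdot>\<^sub>m P (g \<otimes> x) = P (g \<otimes> x \<otimes> inv g) * P g"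
proof -
  have "g \<otimes> x \<otimes> inv g \<otimes> g = g \<otimes> x" using g x T_carrier by (simp add: m_assoc)
  then show ?thesis using P_mult[of "g \<otimes> x \<otimes> inv g" g] g x by simp
qed

text \<open>Under conjugation \<open>tr\<close> and \<open>str\<close> change by mutually inverse
  scalars, and \<open>str\<close> changes as the elements of \<open>twcls\<close> do. So
  \<open>tr\<close> turns a twisted class function into an ordinary one, and \<open>str\<close>
  produces the twisted behaviour from an ordinary one.\<close>

lemma tr_conj:
  assumes g: "g \<in> T" and x: "x \<in> T"
  shows "\<alpha> g x * tr (g \<otimes> x \<otimes> inv g) = \<alpha> (g \<otimes> x \<otimes> inv g) g * tr x"
    and "\<alpha> (g \<otimes> x \<otimes> inv g) g * str (g \<otimes> x \<otimes> inv g) = \<alpha> g x * str x"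
proof -
  let ?y = "g \<otimes> x \<otimes> inv g" and ?a = "\<alpha> g x" and ?b = "\<alpha> (g \<otimes> x \<otimes> inv g) g"
  have y: "?y \<in> T" using g x by simp
  have eq: "?a \<cdot>\<^sub>m (P ?y * P g) = ?b \<cdot>\<^sub>m (P g * P x)"
    unfolding P_conj[OF g x, symmetric] using g x by (auto simp: P_mult intro!: eq_matI)
  have "?a \<cdot>\<^sub>m P ?y = (?a \<cdot>\<^sub>m (P ?y * P g)) * Pinv g"
    using y g by (simp add: mult_smult_assoc_mat[of _ d d _ d] assoc_mult_mat[of _ d d _ d _ d] P_Pinv
        right_mult_one_mat[OF P_carrier])
  also have "\<dots> = ?b \<cdot>\<^sub>m (P g * P x * Pinv g)"
    unfolding eq using g x by (simp add: mult_smult_assoc_mat[of _ d d _ d])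
  finally have main: "?a \<cdot>\<^sub>m P ?y = ?b \<cdot>\<^sub>m (P g * P x * Pinv g)" .
  have "mat_trace (?a \<cdot>\<^sub>m P ?y) = ?b * mat_trace (P g * P x * Pinv g)"
    unfolding main using g x by (intro mat_trace_smult[of _ d]) auto
  also have "mat_trace (P g * P x * Pinv g) = mat_trace (P x)"
    using g x by (intro mat_trace_conj[of _ d]) (auto simp: Pinv_P)
  finally show "?a * tr ?y = ?b * tr x"
    using y x by (simp add: tr_def mat_trace_smult[OF P_carrier])
  have ab: "?a \<noteq> 0" "?b \<noteq> 0" using \<alpha>_nz g x y by auto
  have "Pinv ?y = (?a / ?b) \<cdot>\<^sub>m (P g * Pinv x * Pinv g)"
  proof (rule mat_inv_unique[OF _ _ _ P_Pinv[OF y]])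
    have PY: "P ?y = (?b / ?a) \<cdot>\<^sub>m (P g * P x * Pinv g)"
    proof -
      have "P ?y = (1 / ?a) \<cdot>\<^sub>m (?a \<cdot>\<^sub>m P ?y)" using ab by (auto intro!: eq_matI)
      also have "\<dots> = (?b / ?a) \<cdot>\<^sub>m (P g * P x * Pinv g)" unfolding main by (auto intro!: eq_matI)
      finally show ?thesis .
    qed
    have c: "P g * P x * Pinv g \<in> carrier_mat d d" "P g * Pinv x * Pinv g \<in> carrier_mat d d" using g x by auto
    have "P g * P x * Pinv g * (P g * Pinv x * Pinv g) = P g * P x * (Pinv g * P g) * Pinv x * Pinv g"
      using g x by (simp add: assoc_mult_mat[of _ d d _ d _ d])
    also have "\<dots> = P g * (P x * Pinv x) * Pinv g"
      using g x by (simp add: Pinv_P assoc_mult_mat[of _ d d _ d _ d] left_mult_one_mat[of _ d d])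
    also have "\<dots> = 1\<^sub>m d" using g x by (simp add: P_Pinv right_mult_one_mat[OF P_carrier])
    finally have one: "P g * P x * Pinv g * (P g * Pinv x * Pinv g) = 1\<^sub>m d" .
    show "P ?y * ((?a / ?b) \<cdot>\<^sub>m (P g * Pinv x * Pinv g)) = 1\<^sub>m d"
      unfolding PY using c one ab
      by (simp add: mult_smult_assoc_mat[of _ d d _ d] mult_smult_distrib[of _ d d _ d]) (auto intro!: eq_matI)
  qed (use g x y in auto)
  then have "str ?y = ?a / ?b * mat_trace (P g * Pinv x * Pinv g)"
    unfolding str_def using g x by (simp add: mat_trace_smult[of _ d])
  also have "mat_trace (P g * Pinv x * Pinv g) = str x"
    unfolding str_def using g x by (intro mat_trace_conj[of _ d]) (auto simp: Pinv_P)
  finally show "?b * str ?y = ?a * str x" using ab by simp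
qed

lemma pt_ZCe:
  assumes q: "q \<in> twcls G T N \<alpha>"
  shows "pt q \<in> ZCe"
proof -
  note Q = twclsD[OF q]
  have Z: "pt q \<in> ZC T"
    unfolding ZC_def
  proof (intro CollectI conjI allI impI ballI)
    show "pt q x = 0" if "x \<notin> T" for x using that by (simp add: pt_def tr_def)
    fix g x assume g: "g \<in> T" and x: "x \<in> T"
    let ?y = "g \<otimes> x \<otimes> inv g"
    have nz: "\<alpha> g x \<noteq> 0" "\<alpha> ?y g \<noteq> 0" using \<alpha>_nz g x by auto
    have "(\<alpha> g x * \<alpha> ?y g) * (q ?y * tr ?y) = (q ?y * \<alpha> ?y g) * (\<alpha> g x * tr ?y)" by simp
    also have "\<dots> = (\<alpha> g x * \<alpha> ?y g) * (q x * tr x)" unfolding Q(3)[OF g x] tr_conj(1)[OF g x] by simp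
    finally show "pt q ?y = pt q x" using nz by (simp add: pt_def)
  qed
  have "conv e (pt q) x = pt q x" for x
  proof (cases "x \<in> T")
    case x: True
    have "conv e (pt q) x = (\<Sum>n\<in>N. e n * pt q (inv n \<otimes> x))"
      by (rule conv_on_subgroup[OF N_sub e_outside T_carrier[OF x]])
    also have "\<dots> = (\<Sum>n\<in>N. of_nat d / of_nat (card N) * q x * (mat_trace (P n * 1\<^sub>m d) * mat_trace (P (inv n) * P x)))"
    proof (rule sum.cong[OF refl])
      fix n assume n: "n \<in> N"
      have ni: "inv n \<in> N" "inv n \<in> T" "n \<in> T" using n N_closed N_T by auto
      show "e n * pt q (inv n \<otimes> x) =
        of_nat d / of_nat (card N) * q x * (mat_trace (P n * 1\<^sub>m d) * mat_trace (P (inv n) * P x))"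
        using Q(2)[OF x ni(1)] ni x n P_trace[OF n]
        by (simp add: pt_def e_def tr_def \<theta>_one P_N_left right_mult_one_mat[OF P_carrier])
    qed
    also have "\<dots> = of_nat d / of_nat (card N) * q x * (of_nat (card N) / of_nat d * mat_trace (1\<^sub>m d * P x))"
      unfolding sum_distrib_left[symmetric] using x by (subst schur_trace_prod[OF sr N_sub]) auto
    also have "\<dots> = pt q x" using x d_pos cardN_nz by (simp add: pt_def tr_def left_mult_one_mat[OF P_carrier])
    finally show ?thesis .
  next
    case False
    then show ?thesis using ZC_outside[OF Z] ZC_outside[OF ZC_conv[OF T_sub e_ZC_T Z]] by simp
  qed
  then show ?thesis using Z by (auto simp: ZCe_def)
qed

lemma qf_twcls:
  assumes f: "f \<in> ZC T"
  shows "qf f \<in> twcls G T N \<alpha>"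
  unfolding twcls_def
proof (intro CollectI conjI allI impI ballI)
  show "qf f x = 0" if "x \<notin> T" for x using that by (simp add: qf_def)
  fix x n assume x: "x \<in> T" and n: "n \<in> N"
  obtain n' where n': "n' \<in> N" "n \<otimes> x = x \<otimes> n'" using move_left[OF x n] by blast
  have "(\<Sum>m\<in>N. f (x \<otimes> n' \<otimes> m) * str (x \<otimes> n' \<otimes> m)) = (\<Sum>m\<in>N. f (x \<otimes> (n' \<otimes> m)) * str (x \<otimes> (n' \<otimes> m)))"
    using x n' T_carrier N_carrier by (intro sum.cong refl) (simp add: m_assoc)
  also have "\<dots> = (\<Sum>m\<in>N. f (x \<otimes> m) * str (x \<otimes> m))"
    by (rule sum_mult_left[OF N_sub n'(1)])
  finally show "qf f (n \<otimes> x) = qf f x" using x n n' N_T by (simp add: qf_def)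
next
  fix g x assume g: "g \<in> T" and x: "x \<in> T"
  let ?y = "g \<otimes> x \<otimes> inv g"
  have gc: "g \<in> carrier G" and xc: "x \<in> carrier G" using g x T_carrier by auto
  have "(\<Sum>n\<in>N. f (?y \<otimes> n) * str (?y \<otimes> n)) * \<alpha> ?y g =
    (\<Sum>n\<in>N. f (?y \<otimes> (g \<otimes> n \<otimes> inv g)) * str (?y \<otimes> (g \<otimes> n \<otimes> inv g))) * \<alpha> ?y g"
    using sum.reindex_bij_betw[OF N_conj_bij[OF gc], of "\<lambda>n. f (?y \<otimes> n) * str (?y \<otimes> n)"] by simp
  also have "\<dots> = (\<Sum>n\<in>N. \<alpha> g x * (f (x \<otimes> n) * str (x \<otimes> n)))"
    unfolding sum_distrib_right
  proof (rule sum.cong[OF refl])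
    fix n assume n: "n \<in> N"
    have nc: "n \<in> carrier G" "n \<in> T" using n N_carrier N_T by auto
    have eq: "?y \<otimes> (g \<otimes> n \<otimes> inv g) = g \<otimes> (x \<otimes> n) \<otimes> inv g" using gc xc nc by (simp add: m_assoc)
    have xn: "x \<otimes> n \<in> T" using x nc by simp
    have a1: "\<alpha> g (x \<otimes> n) = \<alpha> g x" by (rule \<alpha>_N_right[OF n g x])
    have a2: "\<alpha> (g \<otimes> (x \<otimes> n) \<otimes> inv g) g = \<alpha> ?y g"
      unfolding eq[symmetric] using g x by (intro \<alpha>_N_left' N_conj[OF gc n]) auto
    have fi: "f (g \<otimes> (x \<otimes> n) \<otimes> inv g) = f (x \<otimes> n)"
      using f g xn by (simp add: ZC_def)
    show "f (?y \<otimes> (g \<otimes> n \<otimes> inv g)) * str (?y \<otimes> (g \<otimes> n \<otimes> inv g)) * \<alpha> ?y g =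
      \<alpha> g x * (f (x \<otimes> n) * str (x \<otimes> n))"
      unfolding eq fi using tr_conj(2)[OF g xn] unfolding a1 a2 by (simp add: mult_ac)
  qed
  finally show "qf f ?y * \<alpha> ?y g = \<alpha> g x * qf f x"
    using g x by (simp add: qf_def flip: sum_distrib_left)
qed

text \<open>Write \<open>f = e * f\<close> as an average over \<open>N\<close>, use invariance under conjugation by \<open>m\<close> in \<open>N\<close>
  and average over \<open>m\<close>; Schur's orthogonality then splits off the factor \<open>tr x\<close>.\<close>
lemma pt_qf:
  assumes f: "f \<in> ZCe"
  shows "pt (qf f) = f"
proof
  fix x
  have fZ: "f \<in> ZC T" and ef: "conv e f = f" using f by (auto simp: ZCe_def)
  show "pt (qf f) x = f x"
  proof (cases "x \<in> T")
    case x: True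
    have xc: "x \<in> carrier G" by (rule T_carrier[OF x])
    have fe: "conv f e = f" using ef ZC_commute[OF T_sub fZ e_ZC_T] by simp
    let ?c = "of_nat d / of_nat (card N) :: complex"
    have "f x = (\<Sum>n\<in>N. f (x \<otimes> inv n) * e n)"
    proof -
      have "conv f e x = (\<Sum>n\<in>N. f (x \<otimes> inv n) * e n)"
        by (rule conv_on_subgroup_right[OF N_sub e_outside xc])
      then show ?thesis using fe by simp
    qed
    also have "\<dots> = ?c * (\<Sum>n\<in>N. f (x \<otimes> inv n) * \<theta> n)"
      by (simp add: e_def \<theta>_one sum_distrib_left mult_ac)
    finally have f1: "f x = ?c * (\<Sum>n\<in>N. f (x \<otimes> inv n) * \<theta> n)" .
    have f2: "(\<Sum>n\<in>N. f (x \<otimes> inv n) * \<theta> n) =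
      (\<Sum>k\<in>N. f (x \<otimes> k) * mat_trace (Pinv (x \<otimes> k) * (P m * P x * P (inv m))))" if m: "m \<in> N" for m
    proof -
      have mc: "m \<in> carrier G" "m \<in> T" "inv m \<in> N" "inv m \<in> T" using m N_carrier N_T N_closed by auto
      \<comment> \<open>The substitution is chosen so that \<open>x \<otimes> inv (?h k)\<close> is
        the conjugate of \<open>x \<otimes> k\<close> by \<open>inv m\<close>, where
        \<open>f\<close> takes the same value as at \<open>x \<otimes> k\<close>. The value of
        \<theta> at \<open>?h k\<close> becomes the trace on the right.\<close>
      let ?h = "\<lambda>k. inv m \<otimes> inv k \<otimes> (inv x \<otimes> m \<otimes> x)"
      have xmx: "inv x \<otimes> m \<otimes> x \<in> N" using N_conj[of "inv x" m] m xc by simp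
      have bij: "bij_betw ?h N N"
      proof (rule bij_betw_byWitness[where f' = "\<lambda>n. inv x \<otimes> m \<otimes> x \<otimes> inv n \<otimes> inv m"])
        show "\<forall>a\<in>N. inv x \<otimes> m \<otimes> x \<otimes> inv (?h a) \<otimes> inv m = a"
          using xc mc N_carrier by (simp add: inv_mult_group m_assoc)
        show "\<forall>a\<in>N. ?h (inv x \<otimes> m \<otimes> x \<otimes> inv a \<otimes> inv m) = a"
          using xc mc N_carrier by (simp add: inv_mult_group m_assoc)
        show "?h ` N \<subseteq> N" using xmx m N_closed by auto
        show "(\<lambda>n. inv x \<otimes> m \<otimes> x \<otimes> inv n \<otimes> inv m) ` N \<subseteq> N" using xmx m N_closed by auto
      qed
      have "(\<Sum>n\<in>N. f (x \<otimes> inv n) * \<theta> n) = (\<Sum>k\<in>N. f (x \<otimes> inv (?h k)) * \<theta> (?h k))"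
        by (rule sum.reindex_bij_betw[OF bij, symmetric])
      also have "\<dots> = (\<Sum>k\<in>N. f (x \<otimes> k) * mat_trace (Pinv (x \<otimes> k) * (P m * P x * P (inv m))))"
      proof (rule sum.cong[OF refl])
        fix k assume k: "k \<in> N"
        have kc: "k \<in> carrier G" "k \<in> T" "inv k \<in> N" "inv k \<in> T" using k N_carrier N_T N_closed by auto
        have xk: "x \<otimes> k \<in> T" "x \<otimes> k \<in> carrier G" using x kc T_carrier by auto
        have "x \<otimes> inv (?h k) = inv m \<otimes> (x \<otimes> k) \<otimes> inv (inv m)"
          using xc mc kc by (simp add: inv_mult_group m_assoc)
        then have fk: "f (x \<otimes> inv (?h k)) = f (x \<otimes> k)"
          using ZC_invariant[OF fZ T_sub mc(4) xk(2)] by simp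
        have Ph: "P x * P (inv x \<otimes> m \<otimes> x) = P m * P x"
        proof -
          have "P x * P (inv x \<otimes> m \<otimes> x) = P (x \<otimes> (inv x \<otimes> m \<otimes> x))"
            using P_N_right[OF xmx x] by simp
          also have "x \<otimes> (inv x \<otimes> m \<otimes> x) = m \<otimes> x" using xc mc by (simp add: m_assoc)
          also have "P (m \<otimes> x) = P m * P x" by (rule P_N_left[OF m x])
          finally show ?thesis .
        qed
        have Pxm: "P (inv x \<otimes> m \<otimes> x) = Pinv x * (P m * P x)"
        proof -
          have c: "P (inv x \<otimes> m \<otimes> x) \<in> carrier_mat d d" using xmx N_T by simp
          have "Pinv x * (P m * P x) = (Pinv x * P x) * P (inv x \<otimes> m \<otimes> x)"
            unfolding Ph[symmetric] using x c by (intro assoc_mult_mat[of _ d d _ d _ d, symmetric]) auto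
          then show ?thesis using Pinv_P[OF x] c by simp
        qed
        have hk: "?h k \<in> N" using xmx m k N_closed by auto
        have "P (?h k) = P (inv m) * P (inv k) * (Pinv x * (P m * P x))"
          using P_N_left[OF N_closed(1)[OF mc(3) kc(3)] N_T[OF xmx]] P_N_left[OF mc(3) kc(4)] Pxm by simp
        then have "\<theta> (?h k) = mat_trace (P (inv m) * (Pinv (x \<otimes> k) * (P m * P x)))"
          using P_trace[OF hk] x mc kc Pinv_mult_N[OF x k] by (simp add: assoc_mult_mat[of _ d d _ d _ d])
        also have "\<dots> = mat_trace (Pinv (x \<otimes> k) * (P m * P x) * P (inv m))"
          by (rule mat_trace_mult_comm[of _ d d]) (use x mc xk in auto)
        also have "Pinv (x \<otimes> k) * (P m * P x) * P (inv m) = Pinv (x \<otimes> k) * (P m * P x * P (inv m))"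
          by (rule assoc_mult_mat[of _ d d _ d _ d]) (use x mc xk in auto)
        finally show "f (x \<otimes> inv (?h k)) * \<theta> (?h k) = f (x \<otimes> k) * mat_trace (Pinv (x \<otimes> k) * (P m * P x * P (inv m)))"
          unfolding fk by simp
      qed
      finally show ?thesis .
    qed
    have "of_nat (card N) * (\<Sum>n\<in>N. f (x \<otimes> inv n) * \<theta> n) = (\<Sum>m\<in>N. \<Sum>n\<in>N. f (x \<otimes> inv n) * \<theta> n)"
      by simp
    also have "\<dots> = (\<Sum>m\<in>N. \<Sum>k\<in>N. f (x \<otimes> k) * mat_trace (Pinv (x \<otimes> k) * (P m * P x * P (inv m))))"
      by (rule sum.cong[OF refl f2])
    also have "\<dots> = (\<Sum>k\<in>N. f (x \<otimes> k) * (\<Sum>m\<in>N. mat_trace (Pinv (x \<otimes> k) * (P m * P x * P (inv m)))))"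
      by (subst sum.swap) (simp add: sum_distrib_left)
    also have "\<dots> = (\<Sum>k\<in>N. f (x \<otimes> k) * (of_nat (card N) / of_nat d * str (x \<otimes> k) * tr x))"
      using x N_T by (intro sum.cong refl) (simp add: schur_trace_conj[OF sr N_sub, of "Pinv (x \<otimes> _)" "P x"] str_def tr_def)
    also have "\<dots> = of_nat (card N) * (1 / of_nat d * tr x * (\<Sum>k\<in>N. f (x \<otimes> k) * str (x \<otimes> k)))"
      by (simp add: sum_distrib_left mult_ac)
    finally have "(\<Sum>n\<in>N. f (x \<otimes> inv n) * \<theta> n) = 1 / of_nat d * tr x * (\<Sum>k\<in>N. f (x \<otimes> k) * str (x \<otimes> k))"
      by (rule mult_left_cancel[OF cardN_nz, THEN iffD1])
    then show ?thesis using f1 x d_pos by (simp add: pt_def qf_def)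
  next
    case False
    then show ?thesis using ZC_outside[OF fZ] by (simp add: pt_def tr_def)
  qed
qed

section \<open>Convolution and the twisted product\<close>

lemma tw_outside: "x \<notin> T \<Longrightarrow> tw G T \<alpha> q1 q2 x = 0"
  by (simp add: tw_def)

lemma tw_coset:
  assumes q1: "q1 \<in> twcls G T N \<alpha>" and q2: "q2 \<in> twcls G T N \<alpha>" and n: "n \<in> N" and x: "x \<in> T"
  shows "tw G T \<alpha> q1 q2 (n \<otimes> x) = tw G T \<alpha> q1 q2 x"
proof -
  have nT: "n \<in> T" by (rule N_T[OF n])
  have "q2 (inv z \<otimes> (n \<otimes> x)) = q2 (inv z \<otimes> x) \<and> \<alpha> z (inv z \<otimes> (n \<otimes> x)) = \<alpha> z (inv z \<otimes> x)" if z: "z \<in> T" for z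
  proof -
    have "inv z \<in> T" using z by simp
    then obtain n' where n': "n' \<in> N" "inv z \<otimes> n = n' \<otimes> inv z" using move_right[of "inv z" n] n by blast
    have "inv z \<otimes> (n \<otimes> x) = n' \<otimes> (inv z \<otimes> x)"
      using n' z x n N_carrier T_carrier by (simp flip: m_assoc)
    then show ?thesis using twclsD(2)[OF q2, of "inv z \<otimes> x" n'] \<alpha>_N_mid[of n' z "inv z \<otimes> x"] n' z x by simp
  qed
  then show ?thesis using x nT by (simp add: tw_def)
qed

text \<open>Averaging \<open>z\<close> over its coset of \<open>N\<close> leaves the values of
  \<open>q1\<close> and \<open>q2\<close> unchanged, and Schur's relation turns the product of two
  traces of \<open>P\<close> into the trace of one product. This produces \<alpha> and the factor
  \<open>1 / of_nat d\<close>.\<close>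

lemma conv_pt:
  assumes q1: "q1 \<in> twcls G T N \<alpha>" and q2: "q2 \<in> twcls G T N \<alpha>"
  shows "conv (pt q1) (pt q2) = (\<lambda>x. 1 / of_nat d * pt (tw G T \<alpha> q1 q2) x)"
proof
  fix x
  note Q1 = twclsD[OF q1] and Q2 = twclsD[OF q2]
  show "conv (pt q1) (pt q2) x = 1 / of_nat d * pt (tw G T \<alpha> q1 q2) x"
  proof (cases "x \<in> T")
    case x: True
    have "conv (pt q1) (pt q2) x = (\<Sum>z\<in>T. pt q1 z * pt q2 (inv z \<otimes> x))"
      by (rule conv_on_subgroup[OF T_sub _ T_carrier[OF x]]) (simp add: pt_def tr_def)
    then have "of_nat (card N) * conv (pt q1) (pt q2) x = (\<Sum>n\<in>N. \<Sum>z\<in>T. pt q1 z * pt q2 (inv z \<otimes> x))"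
      by simp
    also have "\<dots> = (\<Sum>n\<in>N. \<Sum>z\<in>T. pt q1 (z \<otimes> n) * pt q2 (inv (z \<otimes> n) \<otimes> x))"
      by (rule sum.cong[OF refl], rule sum_mult_right[OF T_sub N_T, symmetric])
    also have "\<dots> = (\<Sum>z\<in>T. \<Sum>n\<in>N. pt q1 (z \<otimes> n) * pt q2 (inv (z \<otimes> n) \<otimes> x))"
      by (rule sum.swap)
    also have "\<dots> = (\<Sum>z\<in>T. of_nat (card N) / of_nat d * (q1 z * q2 (inv z \<otimes> x) * \<alpha> z (inv z \<otimes> x) * tr x))"
    proof (rule sum.cong[OF refl])
      fix z assume z: "z \<in> T"
      let ?w = "inv z \<otimes> x"
      have w: "?w \<in> T" using z x by simp
      have zw: "z \<otimes> ?w = x" using z x T_carrier by simp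
      have "(\<Sum>n\<in>N. pt q1 (z \<otimes> n) * pt q2 (inv (z \<otimes> n) \<otimes> x)) =
        (\<Sum>n\<in>N. q1 z * q2 ?w * (mat_trace (P n * P z) * mat_trace (P (inv n) * P ?w)))"
      proof (rule sum.cong[OF refl])
        fix n assume n: "n \<in> N"
        have nc: "n \<in> T" "n \<in> carrier G" "inv n \<in> N" "inv n \<in> T" using n N_T N_carrier N_closed by auto
        have "inv (z \<otimes> n) \<otimes> x = inv n \<otimes> ?w" using z nc x T_carrier by (simp add: inv_mult_group m_assoc)
        moreover have "q1 (z \<otimes> n) = q1 z" by (rule coset_right[OF Q1(2) z n])
        moreover have "mat_trace (P z * P n) = mat_trace (P n * P z)"
          using z nc by (intro mat_trace_mult_comm[of _ d d]) auto
        ultimately show "pt q1 (z \<otimes> n) * pt q2 (inv (z \<otimes> n) \<otimes> x) =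
            q1 z * q2 ?w * (mat_trace (P n * P z) * mat_trace (P (inv n) * P ?w))"
          using z w n nc Q2(2)[OF w nc(3)] by (simp add: pt_def tr_def P_N_left P_N_right)
      qed
      also have "\<dots> = q1 z * q2 ?w * (of_nat (card N) / of_nat d * mat_trace (P z * P ?w))"
        unfolding sum_distrib_left[symmetric] using z w by (subst schur_trace_prod[OF sr N_sub]) auto
      also have "mat_trace (P z * P ?w) = \<alpha> z ?w * tr x"
        using z w x zw by (simp add: P_mult tr_def mat_trace_smult[OF P_carrier])
      finally show "(\<Sum>n\<in>N. pt q1 (z \<otimes> n) * pt q2 (inv (z \<otimes> n) \<otimes> x)) =
        of_nat (card N) / of_nat d * (q1 z * q2 ?w * \<alpha> z ?w * tr x)" by simp
    qed
    also have "\<dots> = of_nat (card N) * (1 / of_nat d * pt (tw G T \<alpha> q1 q2) x)"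
      using x by (simp add: pt_def tw_def sum_distrib_left sum_distrib_right mult_ac)
    finally show ?thesis by (rule mult_left_cancel[OF cardN_nz, THEN iffD1])
  next
    case False
    have "pt q1 \<in> ZC T" "pt q2 \<in> ZC T" using pt_ZCe q1 q2 by (auto simp: ZCe_def)
    then show ?thesis using ZC_outside[OF ZC_conv[OF T_sub]] False by (simp add: pt_def tr_def)
  qed
qed

lemma pt_inj:
  assumes "\<And>x. x \<notin> T \<Longrightarrow> q x = 0" "\<And>n x. n \<in> N \<Longrightarrow> x \<in> T \<Longrightarrow> q (n \<otimes> x) = q x"
    "\<And>x. x \<notin> T \<Longrightarrow> q' x = 0" "\<And>n x. n \<in> N \<Longrightarrow> x \<in> T \<Longrightarrow> q' (n \<otimes> x) = q' x" "pt q = pt q'"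
  shows "q = q'"
proof -
  have "qf (pt q) = q" by (rule qf_pt[OF assms(1,2)])
  moreover have "qf (pt q') = q'" by (rule qf_pt[OF assms(3,4)])
  ultimately show ?thesis unfolding assms(5) by (rule trans[OF sym])
qed

lemma pt_one: "pt q \<one> = q \<one> * of_nat d"
  by (simp add: pt_def tr_def P_one)

lemma pt_scale: "pt (\<lambda>x. c * q x) = (\<lambda>x. c * pt q x)"
  by (simp add: pt_def mult_ac)

text \<open>Multiplication of \<open>pt q\<close> by a class function sees only its product with
  \<open>e\<close>, and this product is \<open>pt\<close> of a twisted class function.\<close>

lemma pt_over_T:
  assumes q: "q \<in> twirr G T N \<alpha>"
  shows "pt q \<in> over_T"
proof -
  have qc: "q \<in> twcls G T N \<alpha>" and idem: "tw G T \<alpha> q q = (\<lambda>x. of_nat (card T) / q \<one> * q x)"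
    and id: "\<And>f. f \<in> twcls G T N \<alpha> \<Longrightarrow> \<exists>c. tw G T \<alpha> q f = (\<lambda>x. c * q x)"
    using q by (auto simp: twirr_def)
  obtain r where r: "r > 0" "q \<one> = of_real r" using q by (auto simp: twirr_def)
  have Z: "pt q \<in> ZC T" and ep: "conv e (pt q) = pt q" using pt_ZCe[OF qc] by (auto simp: ZCe_def)
  have "irrfun T (pt q)"
    unfolding irrfun_def
  proof (intro conjI ballI Z)
    show "\<exists>r::real. r > 0 \<and> pt q \<one> = of_real r"
      using r d_pos by (intro exI[of _ "r * real d"]) (simp add: pt_one)
    show "conv (pt q) (pt q) = (\<lambda>x. of_nat (card T) / pt q \<one> * pt q x)"
      unfolding conv_pt[OF qc qc] idem pt_scale pt_one by (simp add: mult.commute)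
    fix f assume f: "f \<in> ZC T"
    have ef: "conv e f \<in> ZCe" by (rule ZCe_I[OF f])
    then have qe: "qf (conv e f) \<in> twcls G T N \<alpha>" by (intro qf_twcls) (simp add: ZCe_def)
    obtain c where c: "tw G T \<alpha> q (qf (conv e f)) = (\<lambda>x. c * q x)" using id[OF qe] by blast
    have "conv (pt q) f = conv (conv e (pt q)) f" using ep by simp
    also have "\<dots> = conv (pt q) (conv e f)"
      using ZC_commute[OF T_sub e_ZC_T Z] by (simp add: conv_assoc)
    also have "\<dots> = conv (pt q) (pt (qf (conv e f)))" using pt_qf[OF ef] by simp
    also have "\<dots> = (\<lambda>x. 1 / of_nat d * (c * pt q x))" unfolding conv_pt[OF qc qe] c pt_scale ..
    finally show "\<exists>c. conv (pt q) f = (\<lambda>x. c * pt q x)" by (intro exI[of _ "1 / of_nat d * c"]) simp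
  qed
  then show ?thesis using ep by (simp add: over_T_def)
qed

lemma qf_twirr:
  assumes psi: "\<psi> \<in> over_T"
  shows "qf \<psi> \<in> twirr G T N \<alpha>" "pt (qf \<psi>) = \<psi>"
proof -
  have irrP: "irrfun T \<psi>" and ep: "conv e \<psi> = \<psi>" using psi by (auto simp: over_T_def)
  note Ps = irrfunD[OF irrP]
  have Ze: "\<psi> \<in> ZCe" using Ps(1) ep by (simp add: ZCe_def)
  let ?q = "qf \<psi>"
  have qc: "?q \<in> twcls G T N \<alpha>" by (rule qf_twcls[OF Ps(1)])
  note Q = twclsD[OF qc]
  show pq: "pt ?q = \<psi>" by (rule pt_qf[OF Ze])
  have dnz: "of_nat d \<noteq> (0::complex)" using d_pos by simp
  have one: "\<psi> \<one> = ?q \<one> * of_nat d" using pt_one[of ?q] pq by simp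
  \<comment> \<open>Identities in the group algebra descend to the twisted algebra because
    \<open>pt\<close> is injective on functions that are supported on \<open>T\<close> and constant
    on cosets of \<open>N\<close>.\<close>
  have cancel: "tw G T \<alpha> ?q f = (\<lambda>x. c * ?q x)"
    if f: "f \<in> twcls G T N \<alpha>" and eq: "pt (tw G T \<alpha> ?q f) = (\<lambda>x. c * \<psi> x)" for f c
  proof (rule pt_inj)
    show "pt (tw G T \<alpha> ?q f) = pt (\<lambda>x. c * ?q x)" using eq pq by (simp add: pt_scale)
  qed (use tw_outside tw_coset[OF qc f] Q in auto)
  have tww: "pt (tw G T \<alpha> ?q f) = (\<lambda>x. of_nat d * conv \<psi> (pt f) x)" if f: "f \<in> twcls G T N \<alpha>" for f
    using conv_pt[OF qc f] pq dnz by simp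
  show "?q \<in> twirr G T N \<alpha>"
    unfolding twirr_def
  proof (intro CollectI conjI ballI qc)
    obtain r where r: "r > 0" "\<psi> \<one> = of_real r" using irrP by (auto simp: irrfun_def)
    then have "?q \<one> = of_real (r / real d)" using one dnz by (simp add: field_simps)
    then show "\<exists>r::real. r > 0 \<and> ?q \<one> = of_real r" using r d_pos by (intro exI[of _ "r / real d"]) simp
    show "tw G T \<alpha> ?q ?q = (\<lambda>x. of_nat (card T) / ?q \<one> * ?q x)"
      using Ps(3) one dnz by (intro cancel[OF qc]) (simp add: tww[OF qc] pq)
    fix f assume f: "f \<in> twcls G T N \<alpha>"
    have "pt f \<in> ZC T" using pt_ZCe[OF f] by (simp add: ZCe_def)
    then obtain c where "conv \<psi> (pt f) = (\<lambda>x. c * \<psi> x)" using Ps(4) by blast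
    then have "tw G T \<alpha> ?q f = (\<lambda>x. (of_nat d * c) * ?q x)" by (intro cancel[OF f]) (simp add: tww[OF f] mult.assoc)
    then show "\<exists>c. tw G T \<alpha> ?q f = (\<lambda>x. c * ?q x)" by blast
  qed
qed

text \<open>The trace of the projective factor Q when the Clifford correspondent
  \<open>conv \<chi> e\<close> is written as the trace of Q \<otimes> P. This function alone is
  carried from \<open>G\<close> to \<open>H\<close>.\<close>

definition qchar :: "('a \<Rightarrow> complex) \<Rightarrow> 'a \<Rightarrow> complex" where
  "qchar \<chi> = qf (conv \<chi> e)"

lemma qchar_bij: "bij_betw qchar over (twirr G T N \<alpha>)"
proof (rule bij_betw_byWitness[where f' = "\<lambda>q. ind (pt q)"])
  show "\<forall>\<chi>\<in>over. ind (pt (qchar \<chi>)) = \<chi>"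
    using qf_twirr(2)[OF clifford_res(1)] clifford_res(2) by (simp add: qchar_def)
  show "\<forall>q\<in>twirr G T N \<alpha>. qchar (ind (pt q)) = q"
  proof
    fix q assume q: "q \<in> twirr G T N \<alpha>"
    then have "q \<in> twcls G T N \<alpha>" by (simp add: twirr_def)
    then have "qf (pt q) = q" using twclsD by (intro qf_pt) auto
    then show "qchar (ind (pt q)) = q" using clifford_ind(2)[OF pt_over_T[OF q]] by (simp add: qchar_def)
  qed
  show "qchar ` over \<subseteq> twirr G T N \<alpha>" using qf_twirr(1)[OF clifford_res(1)] by (auto simp: qchar_def)
  show "(\<lambda>q. ind (pt q)) ` twirr G T N \<alpha> \<subseteq> over" using clifford_ind(1)[OF pt_over_T] by auto
qed

text \<open>Both factors on the right have a counterpart for \<open>H\<close> of the same value,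
  which is the source of the equality of degree ratios.\<close>

lemma qchar_one:
  assumes chi: "\<chi> \<in> over"
  shows "\<chi> \<one> / \<theta> \<one> = of_nat (card (carrier G)) / of_nat (card T) * qchar \<chi> \<one>"
proof -
  have cG: "of_nat (card (carrier G)) \<noteq> (0::complex)" using one_closed by auto
  have "qchar \<chi> \<one> * of_nat d = conv \<chi> e \<one>"
    using pt_one[of "qchar \<chi>"] qf_twirr(2)[OF clifford_res(1)[OF chi]] by (simp add: qchar_def)
  then show ?thesis using clifford_res(3)[OF chi] d_pos cG cardT_nz by (simp add: \<theta>_one field_simps)
qed

end

section \<open>The Galois group of the abelian closure\<close>

lemma subfield_Qab: "subfield_C Qab"
  unfolding subfield_C_def Qab_def by blast

lemma Qab_closed:
  "0 \<in> Qab" "1 \<in> Qab" "x \<in> Qab \<Longrightarrow> y \<in> Qab \<Longrightarrow> x + y \<in> Qab" "x \<in> Qab \<Longrightarrow> y \<in> Qab \<Longrightarrow> x * y \<in> Qab"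
  "x \<in> Qab \<Longrightarrow> inverse x \<in> Qab"
  using subfield_Qab by (auto simp: subfield_C_def)

lemma Qab_divide: "x \<in> Qab \<Longrightarrow> y \<in> Qab \<Longrightarrow> x / y \<in> Qab"
  using Qab_closed(4,5) by (simp add: field_class.field_divide_inverse)

lemma Qab_root: "root_of_unity z \<Longrightarrow> z \<in> Qab"
  by (auto simp: Qab_def)

lemma Qab_sum: "(\<And>i. i \<in> I \<Longrightarrow> f i \<in> Qab) \<Longrightarrow> sum f I \<in> Qab"
  by (induction I rule: infinite_finite_induct) (auto simp: Qab_closed)

lemma Qab_of_nat: "of_nat n \<in> Qab"
  by (induction n) (auto simp: Qab_closed)

context
  fixes \<sigma> assumes \<sigma>: "\<sigma> \<in> GalQab"
begin

lemma Gal_closed: "x \<in> Qab \<Longrightarrow> \<sigma> x \<in> Qab"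
  using \<sigma> by (auto simp: GalQab_def bij_betw_def)

lemma Gal_inj: "x \<in> Qab \<Longrightarrow> y \<in> Qab \<Longrightarrow> \<sigma> x = \<sigma> y \<Longrightarrow> x = y"
  using \<sigma> by (auto simp: GalQab_def bij_betw_def inj_on_def)

lemma Gal_add: "x \<in> Qab \<Longrightarrow> y \<in> Qab \<Longrightarrow> \<sigma> (x + y) = \<sigma> x + \<sigma> y"
  using \<sigma> by (auto simp: GalQab_def)

lemma Gal_mult: "x \<in> Qab \<Longrightarrow> y \<in> Qab \<Longrightarrow> \<sigma> (x * y) = \<sigma> x * \<sigma> y"
  using \<sigma> by (auto simp: GalQab_def)

lemma Gal_zero: "\<sigma> 0 = 0"
  using Gal_add[of 0 0] Qab_closed by simp

lemma Gal_one: "\<sigma> 1 = 1"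
proof -
  have "\<sigma> 1 \<noteq> 0" using Gal_inj[of 1 0] Gal_zero Qab_closed by auto
  then show ?thesis using Gal_mult[of 1 1] Qab_closed by simp
qed

lemma Gal_zero_iff: "x \<in> Qab \<Longrightarrow> \<sigma> x = 0 \<longleftrightarrow> x = 0"
  using Gal_inj[of x 0] Gal_zero Qab_closed by auto

lemma Gal_sum: "(\<And>i. i \<in> I \<Longrightarrow> f i \<in> Qab) \<Longrightarrow> \<sigma> (sum f I) = (\<Sum>i\<in>I. \<sigma> (f i))"
  by (induction I rule: infinite_finite_induct) (auto simp: Gal_zero Gal_add Qab_sum)

lemma Gal_of_nat: "\<sigma> (of_nat n) = of_nat n"
  by (induction n) (auto simp: Gal_zero Gal_add Gal_one Qab_of_nat Qab_closed)

lemma Gal_divide: "x \<in> Qab \<Longrightarrow> y \<in> Qab \<Longrightarrow> \<sigma> (x / y) = \<sigma> x / \<sigma> y"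
proof (cases "y = 0")
  case False
  assume x: "x \<in> Qab" and y: "y \<in> Qab"
  have "\<sigma> (x / y) * \<sigma> y = \<sigma> x"
    using Gal_mult[OF Qab_divide[OF x y] y] False by simp
  moreover have "\<sigma> y \<noteq> 0" using Gal_zero_iff[OF y] False by simp
  ultimately show ?thesis by (simp add: eq_divide_eq)
qed (simp add: Gal_zero)

lemma Gal_power: "x \<in> Qab \<Longrightarrow> \<sigma> (x ^ n) = \<sigma> x ^ n \<and> x ^ n \<in> Qab"
  by (induction n) (auto simp: Gal_one Gal_mult Qab_closed)

end

lemma Gal_comp: "\<sigma> \<in> GalQab \<Longrightarrow> \<tau> \<in> GalQab \<Longrightarrow> \<sigma> \<circ> \<tau> \<in> GalQab"
  unfolding GalQab_def by (auto intro: bij_betw_trans) (metis bij_betwE)+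

lemma Gal_id: "id \<in> GalQab"
  by (auto simp: GalQab_def)

lemma Gal_inverse:
  assumes s: "\<sigma> \<in> GalQab"
  obtains \<tau> where "\<tau> \<in> GalQab" "\<sigma> \<circ> \<tau> = id" "\<tau> \<circ> \<sigma> = id"
proof -
  have bij: "bij_betw \<sigma> Qab Qab" and out: "\<And>x. x \<notin> Qab \<Longrightarrow> \<sigma> x = x" using s by (auto simp: GalQab_def)
  define \<tau> where "\<tau> x = (if x \<in> Qab then the_inv_into Qab \<sigma> x else x)" for x
  have tin: "\<tau> x \<in> Qab" "\<sigma> (\<tau> x) = x" if "x \<in> Qab" for x
    using bij that by (auto simp: \<tau>_def bij_betw_def the_inv_into_into f_the_inv_into_f)
  have ts: "\<tau> (\<sigma> x) = x" if "x \<in> Qab" for x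
    using bij that Gal_closed[OF s that] by (simp add: \<tau>_def bij_betw_def the_inv_into_f_f)
  have 1: "\<sigma> (\<tau> x) = x" for x using tin(2)[of x] out by (cases "x \<in> Qab") (auto simp: \<tau>_def)
  have 2: "\<tau> (\<sigma> x) = x" for x using ts[of x] out by (cases "x \<in> Qab") (auto simp: \<tau>_def)
  have "bij_betw \<tau> Qab Qab"
    by (rule bij_betw_byWitness[where f' = \<sigma>]) (use tin ts Gal_closed[OF s] in auto)
  moreover have "\<tau> (x + y) = \<tau> x + \<tau> y" "\<tau> (x * y) = \<tau> x * \<tau> y" if "x \<in> Qab" "y \<in> Qab" for x y
    using tin(1)[OF that(1)] tin(1)[OF that(2)] Gal_add[OF s] Gal_mult[OF s] 1 2
    by (metis, metis)
  ultimately have "\<tau> \<in> GalQab" by (auto simp: GalQab_def \<tau>_def)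
  then show ?thesis using that 1 2 by fastforce
qed

text \<open>With both exponents natural numbers the defining condition becomes symmetric and
  is visibly stable under composition and inversion.\<close>
lemma Hgal_iff:
  assumes p: "prime p"
  shows "\<sigma> \<in> Hgal p \<longleftrightarrow> \<sigma> \<in> GalQab \<and> (\<exists>a b. \<forall>\<xi> (n::nat). n > 0 \<and> coprime n p \<and> \<xi> ^ n = 1 \<longrightarrow> \<sigma> \<xi> ^ (p ^ a) = \<xi> ^ (p ^ b))"
    (is "_ \<longleftrightarrow> _ \<and> (\<exists>a b. ?Q a b)")
proof (intro iffI conjI)
  assume s: "\<sigma> \<in> Hgal p"
  then show "\<sigma> \<in> GalQab" by (simp add: Hgal_def)
  obtain f :: int where f: "\<And>\<xi> (n::nat). n > 0 \<and> coprime n p \<and> \<xi> ^ n = 1 \<Longrightarrow>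
      (if f \<ge> 0 then \<sigma> \<xi> = \<xi> ^ (p ^ nat f) else (\<sigma> \<xi>) ^ (p ^ nat (- f)) = \<xi>)"
    using s by (auto simp: Hgal_def)
  show "\<exists>a b. ?Q a b"
  proof (cases "f \<ge> 0")
    case True
    then have "?Q 0 (nat f)" using f by auto
    then show ?thesis by blast
  next
    case False
    then have "?Q (nat (-f)) 0" using f by auto
    then show ?thesis by blast
  qed
next
  assume "\<sigma> \<in> GalQab \<and> (\<exists>a b. ?Q a b)"
  then obtain a b where s: "\<sigma> \<in> GalQab" and Q: "?Q a b" by blast
  have rQ: "\<xi> \<in> Qab" if "n > 0" "\<xi> ^ n = 1" for \<xi> and n :: nat
    using that Qab_root by (auto simp: root_of_unity_def)
  have sn: "\<sigma> \<xi> ^ n = 1" if "n > 0" "\<xi> ^ n = 1" for \<xi> and n :: nat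
    using Gal_power[OF s rQ[OF that], of n] that Gal_one[OF s] by simp
  \<comment> \<open>For \<open>n\<close> prime to \<open>p\<close>, the number \<open>p ^ k\<close>
    is invertible modulo \<open>n\<close>, so an \<open>n\<close>-th root of unity can be recovered
    from its power. This allows a common exponent to be cancelled.\<close>
  have inj: "u = v" if n: "n > 0" "coprime n p" and u: "u ^ n = 1" and v: "v ^ n = 1" and eq: "u ^ (p ^ k) = v ^ (p ^ k)"
    for u v :: complex and n k :: nat
  proof -
    have "coprime (p ^ k) n" using n by (simp add: coprime_commute)
    moreover have "p ^ k \<noteq> 0" using p prime_gt_0_nat[of p] by simp
    ultimately obtain m q where q: "p ^ k * m = n * q + 1"
      using bezout_nat[of "p ^ k" n] by (metis coprime_iff_gcd_eq_1)
    have ex: "w = (w ^ (p ^ k)) ^ m" if w: "w ^ n = 1" for w :: complex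
    proof -
      have "(w ^ (p ^ k)) ^ m = w ^ (n * q + 1)" by (simp only: power_mult[symmetric] q)
      also have "\<dots> = w" using w by (simp add: power_add power_mult)
      finally show ?thesis by simp
    qed
    show ?thesis using ex[OF u] ex[OF v] eq by simp
  qed
  have "\<exists>f::int. \<forall>\<xi> (n::nat). n > 0 \<and> coprime n p \<and> \<xi> ^ n = 1 \<longrightarrow>
      (if f \<ge> 0 then \<sigma> \<xi> = \<xi> ^ (p ^ nat f) else (\<sigma> \<xi>) ^ (p ^ nat (- f)) = \<xi>)"
  \<comment> \<open>The integer exponent is the difference of the two natural ones; the smaller of
    these is cancelled by \<open>inj\<close>.\<close>
  proof (intro exI[of _ "int b - int a"] allI impI)
    fix \<xi> :: complex and n :: nat
    assume n: "n > 0 \<and> coprime n p \<and> \<xi> ^ n = 1"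
    then have n1: "n > 0" "coprime n p" "\<xi> ^ n = 1" by auto
    have Q': "\<sigma> \<xi> ^ (p ^ a) = \<xi> ^ (p ^ b)" using Q n by blast
    have s1: "\<sigma> \<xi> ^ n = 1" using sn n by blast
    have pw: "(w ^ k) ^ n = 1" if "w ^ n = 1" for w :: complex and k
    proof -
      have "(w ^ k) ^ n = (w ^ n) ^ k" by (simp only: power_mult[symmetric] mult.commute)
      then show ?thesis using that by simp
    qed
    show "if int b - int a \<ge> 0 then \<sigma> \<xi> = \<xi> ^ (p ^ nat (int b - int a)) else (\<sigma> \<xi>) ^ (p ^ nat (- (int b - int a))) = \<xi>"
    proof (cases "a \<le> b")
      case True
      then have "nat (int b - int a) = b - a" by linarith
      moreover have "\<sigma> \<xi> ^ (p ^ a) = (\<xi> ^ (p ^ (b - a))) ^ (p ^ a)"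
        using Q' True by (simp flip: power_mult power_add)
      then have "\<sigma> \<xi> = \<xi> ^ (p ^ (b - a))" by (rule inj[OF n1(1,2) s1 pw[OF n1(3)]])
      ultimately show ?thesis using True by simp
    next
      case False
      then have "nat (- (int b - int a)) = a - b" by linarith
      moreover have "(\<sigma> \<xi> ^ (p ^ (a - b))) ^ (p ^ b) = \<xi> ^ (p ^ b)"
        using Q' False by (simp flip: power_mult power_add)
      then have "\<sigma> \<xi> ^ (p ^ (a - b)) = \<xi>" by (rule inj[OF n1(1,2) pw[OF s1] n1(3)])
      ultimately show ?thesis using False by simp
    qed
  qed
  then show "\<sigma> \<in> Hgal p" using s by (simp add: Hgal_def)
qed

lemma Hgal_Gal: "\<sigma> \<in> Hgal p \<Longrightarrow> \<sigma> \<in> GalQab"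
  by (simp add: Hgal_def)

lemma Hgal_id: "prime p \<Longrightarrow> id \<in> Hgal p"
  unfolding Hgal_iff using Gal_id by (auto intro!: exI[of _ 0])

lemma Hgal_comp:
  assumes p: "prime p" and s: "\<sigma> \<in> Hgal p" and t: "\<tau> \<in> Hgal p"
  shows "\<sigma> \<circ> \<tau> \<in> Hgal p"
proof -
  obtain a b where 1: "\<And>\<xi> (n::nat). n > 0 \<Longrightarrow> coprime n p \<Longrightarrow> \<xi> ^ n = 1 \<Longrightarrow> \<sigma> \<xi> ^ (p ^ a) = \<xi> ^ (p ^ b)"
    using s unfolding Hgal_iff[OF p] by blast
  obtain a' b' where 2: "\<And>\<xi> (n::nat). n > 0 \<Longrightarrow> coprime n p \<Longrightarrow> \<xi> ^ n = 1 \<Longrightarrow> \<tau> \<xi> ^ (p ^ a') = \<xi> ^ (p ^ b')"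
    using t unfolding Hgal_iff[OF p] by blast
  have "\<sigma> (\<tau> \<xi>) ^ (p ^ (a + a')) = \<xi> ^ (p ^ (b + b'))" if n: "n > 0" "coprime n p" "\<xi> ^ n = 1" for \<xi> and n :: nat
  proof -
    have "\<xi> \<in> Qab" using n Qab_root by (auto simp: root_of_unity_def)
    then have tn: "\<tau> \<xi> ^ n = 1" using Gal_power[OF Hgal_Gal[OF t], of \<xi> n] n Gal_one[OF Hgal_Gal[OF t]] by simp
    have "\<sigma> (\<tau> \<xi>) ^ (p ^ (a + a')) = (\<sigma> (\<tau> \<xi>) ^ (p ^ a)) ^ (p ^ a')" by (simp add: power_add power_mult)
    also have "\<dots> = (\<tau> \<xi> ^ (p ^ a')) ^ (p ^ b)" using 1[OF n(1,2) tn] by (metis mult.commute power_mult)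
    also have "\<dots> = \<xi> ^ (p ^ (b + b'))" using 2[OF n] by (simp add: power_add power_mult mult.commute flip: power_mult)
    finally show ?thesis .
  qed
  then show ?thesis unfolding Hgal_iff[OF p] using Gal_comp[OF Hgal_Gal[OF s] Hgal_Gal[OF t]] by auto
qed

lemma Hgal_inverse:
  assumes p: "prime p" and s: "\<sigma> \<in> Hgal p"
  obtains \<tau> where "\<tau> \<in> Hgal p" "\<sigma> \<circ> \<tau> = id" "\<tau> \<circ> \<sigma> = id"
proof -
  obtain a b where 1: "\<And>\<xi> (n::nat). n > 0 \<Longrightarrow> coprime n p \<Longrightarrow> \<xi> ^ n = 1 \<Longrightarrow> \<sigma> \<xi> ^ (p ^ a) = \<xi> ^ (p ^ b)"
    using s unfolding Hgal_iff[OF p] by blast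
  obtain \<tau> where t: "\<tau> \<in> GalQab" "\<sigma> \<circ> \<tau> = id" "\<tau> \<circ> \<sigma> = id" using Gal_inverse[OF Hgal_Gal[OF s]] by blast
  have "\<tau> \<xi> ^ (p ^ b) = \<xi> ^ (p ^ a)" if n: "n > 0" "coprime n p" "\<xi> ^ n = 1" for \<xi> and n :: nat
  proof -
    have "\<xi> \<in> Qab" using n Qab_root by (auto simp: root_of_unity_def)
    then have tn: "\<tau> \<xi> ^ n = 1" using Gal_power[OF t(1), of \<xi> n] n Gal_one[OF t(1)] by simp
    show ?thesis using 1[OF n(1,2) tn] fun_cong[OF t(2), of \<xi>] by simp
  qed
  then have "\<tau> \<in> Hgal p" unfolding Hgal_iff[OF p] using t(1) by auto
  then show ?thesis using that t by blast
qed

section \<open>Extending a bijection equivariantly\<close>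

text \<open>An element of the union may have several expressions \<open>\<sigma> \<circ> a\<close>.
  Two of them differ by some \<rho> in \<open>HH\<close> that maps one element of \<open>A\<close>
  to another, and by \<open>iff\<close> and \<open>eqv\<close> the map \<open>t\<close> respects
  such moves in both directions. This gives well-definedness and injectivity at once.\<close>

lemma extend_equivariantly:
  fixes HH :: "(complex \<Rightarrow> complex) set" and A :: "('a \<Rightarrow> complex) set" and A' :: "('c \<Rightarrow> complex) set"
  assumes comp: "\<And>\<sigma> \<tau>. \<sigma> \<in> HH \<Longrightarrow> \<tau> \<in> HH \<Longrightarrow> \<sigma> \<circ> \<tau> \<in> HH"
    and inv: "\<And>\<sigma>. \<sigma> \<in> HH \<Longrightarrow> \<exists>\<tau>\<in>HH. \<sigma> \<circ> \<tau> = id \<and> \<tau> \<circ> \<sigma> = id"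
    and bij: "bij_betw t A A'"
    and iff: "\<And>\<sigma> a. \<sigma> \<in> HH \<Longrightarrow> a \<in> A \<Longrightarrow> \<sigma> \<circ> a \<in> A \<longleftrightarrow> \<sigma> \<circ> t a \<in> A'"
    and eqv: "\<And>\<sigma> a. \<sigma> \<in> HH \<Longrightarrow> a \<in> A \<Longrightarrow> \<sigma> \<circ> a \<in> A \<Longrightarrow> t (\<sigma> \<circ> a) = \<sigma> \<circ> t a"
  obtains T where "bij_betw T (\<Union>\<sigma>\<in>HH. (\<circ>) \<sigma> ` A) (\<Union>\<sigma>\<in>HH. (\<circ>) \<sigma> ` A')"
    "\<And>\<sigma> a. \<sigma> \<in> HH \<Longrightarrow> a \<in> A \<Longrightarrow> T (\<sigma> \<circ> a) = \<sigma> \<circ> t a"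
proof -
  have tA: "t a \<in> A'" if "a \<in> A" for a using bij that by (auto simp: bij_betw_def)
  have key: "\<sigma> \<circ> a = \<sigma>' \<circ> b \<longleftrightarrow> \<sigma> \<circ> t a = \<sigma>' \<circ> t b"
    if s: "\<sigma> \<in> HH" "\<sigma>' \<in> HH" and ab: "a \<in> A" "b \<in> A" for \<sigma> \<sigma>' a b
  proof -
    obtain \<tau> where t: "\<tau> \<in> HH" "\<sigma>' \<circ> \<tau> = id" "\<tau> \<circ> \<sigma>' = id" using inv[OF s(2)] by blast
    define \<rho> where "\<rho> = \<tau> \<circ> \<sigma>"
    have r: "\<rho> \<in> HH" unfolding \<rho>_def by (rule comp[OF t(1) s(1)])
    have sr: "\<sigma> = \<sigma>' \<circ> \<rho>" unfolding \<rho>_def using t by (simp flip: comp_assoc)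
    show ?thesis
    proof
      assume "\<sigma> \<circ> a = \<sigma>' \<circ> b"
      then have "\<tau> \<circ> (\<sigma> \<circ> a) = (\<tau> \<circ> \<sigma>') \<circ> b" by (simp add: comp_assoc)
      then have b: "b = \<rho> \<circ> a" using t by (simp add: \<rho>_def comp_assoc)
      then have "t b = \<rho> \<circ> t a" using eqv[OF r ab(1)] ab by simp
      then show "\<sigma> \<circ> t a = \<sigma>' \<circ> t b" unfolding sr by (simp add: comp_assoc)
    next
      assume "\<sigma> \<circ> t a = \<sigma>' \<circ> t b"
      then have "\<tau> \<circ> (\<sigma> \<circ> t a) = (\<tau> \<circ> \<sigma>') \<circ> t b" by (simp add: comp_assoc)
      then have tb: "t b = \<rho> \<circ> t a" using t by (simp add: \<rho>_def comp_assoc)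
      then have ra: "\<rho> \<circ> a \<in> A" using iff[OF r ab(1)] tA[OF ab(2)] by simp
      have "t (\<rho> \<circ> a) = t b" using eqv[OF r ab(1) ra] tb by simp
      then have "\<rho> \<circ> a = b" using bij ra ab by (auto simp: bij_betw_def inj_on_def)
      then show "\<sigma> \<circ> a = \<sigma>' \<circ> b" unfolding sr by (simp add: comp_assoc)
    qed
  qed
  define T where "T x = (SOME y. \<exists>\<sigma>\<in>HH. \<exists>a\<in>A. x = \<sigma> \<circ> a \<and> y = \<sigma> \<circ> t a)" for x
  have T: "T (\<sigma> \<circ> a) = \<sigma> \<circ> t a" if "\<sigma> \<in> HH" "a \<in> A" for \<sigma> a
  proof -
    have "\<exists>\<sigma>'\<in>HH. \<exists>b\<in>A. \<sigma> \<circ> a = \<sigma>' \<circ> b \<and> T (\<sigma> \<circ> a) = \<sigma>' \<circ> t b"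
      unfolding T_def by (rule someI[of _ "\<sigma> \<circ> t a"]) (use that in blast)
    then show ?thesis using key that by metis
  qed
  have "bij_betw T (\<Union>\<sigma>\<in>HH. (\<circ>) \<sigma> ` A) (\<Union>\<sigma>\<in>HH. (\<circ>) \<sigma> ` A')"
  proof (rule bij_betw_imageI)
    show "inj_on T (\<Union>\<sigma>\<in>HH. (\<circ>) \<sigma> ` A)"
      by (rule inj_onI) (auto simp: T key)
    have "t ` A = A'" using bij by (simp add: bij_betw_def)
    then show "T ` (\<Union>\<sigma>\<in>HH. (\<circ>) \<sigma> ` A) = (\<Union>\<sigma>\<in>HH. (\<circ>) \<sigma> ` A')"
      by (auto simp: image_UN image_image T)
  qed
  then show ?thesis using that T by blast
qed

section \<open>Restriction to a supplement\<close>

context fin_group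
begin

text \<open>The expression of \<open>x\<close> as a product is unique up to an element of
  \<open>N \<inter> S\<close>.\<close>

lemma card_product_section:
  assumes N: "subgroup N G" and S: "subgroup S G" and n: "n \<in> N" and s: "s \<in> S" and x: "x = n \<otimes> s"
  shows "card {s \<in> S. x \<otimes> inv s \<in> N} = card (N \<inter> S)"
proof -
  note Nc = subgroup.m_closed[OF N] subgroup.m_inv_closed[OF N] subgroup.mem_carrier[OF N]
  note Sc = subgroup.m_closed[OF S] subgroup.m_inv_closed[OF S] subgroup.mem_carrier[OF S]
  have nc: "n \<in> carrier G" "s \<in> carrier G" using n s Nc Sc by auto
  have "bij_betw (\<lambda>m. m \<otimes> s) (N \<inter> S) {s \<in> S. x \<otimes> inv s \<in> N}"
  proof (rule bij_betw_byWitness[where f' = "\<lambda>r. r \<otimes> inv s"])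
    show "\<forall>a\<in>N \<inter> S. a \<otimes> s \<otimes> inv s = a" "\<forall>r\<in>{r \<in> S. x \<otimes> inv r \<in> N}. r \<otimes> inv s \<otimes> s = r"
      using nc Sc by (auto simp: m_assoc)
    show "(\<lambda>m. m \<otimes> s) ` (N \<inter> S) \<subseteq> {s \<in> S. x \<otimes> inv s \<in> N}"
    proof clarsimp
      fix m assume mN: "m \<in> N" "m \<in> S"
      have "x \<otimes> inv (m \<otimes> s) = n \<otimes> inv m" using x nc mN Nc by (simp add: inv_mult_group m_assoc)
      then show "m \<otimes> s \<in> S \<and> x \<otimes> inv (m \<otimes> s) \<in> N" using mN n s Nc Sc by simp
    qed
    show "(\<lambda>r. r \<otimes> inv s) ` {s \<in> S. x \<otimes> inv s \<in> N} \<subseteq> N \<inter> S"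
    proof (rule image_subsetI)
      fix r assume "r \<in> {s \<in> S. x \<otimes> inv s \<in> N}"
      then have r: "r \<in> S" "x \<otimes> inv r \<in> N" by auto
      have rc: "r \<in> carrier G" by (rule Sc(3)[OF r(1)])
      have "inv (x \<otimes> inv r) \<otimes> n \<in> N" using r n Nc by simp
      moreover have "inv (x \<otimes> inv r) \<otimes> n = r \<otimes> inv s" using x nc rc by (simp add: inv_mult_group m_assoc)
      ultimately show "r \<otimes> inv s \<in> N \<inter> S" using r s Sc by simp
    qed
  qed
  then show ?thesis by (simp add: bij_betw_same_card)
qed

text \<open>Pairs of \<open>x\<close> and \<open>s\<close> with \<open>x \<otimes> inv s\<close> in
  \<open>N\<close> are counted in two ways: each \<open>x\<close> has
  \<open>card (N \<inter> S)\<close> partners, and the partners of \<open>s\<close> form its coset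
  of \<open>N\<close>, on which \<open>F\<close> is constant.\<close>

lemma sum_subgroup_product:
  fixes F :: "'a \<Rightarrow> complex"
  assumes N: "subgroup N G" and S: "subgroup S G" and T: "T = {n \<otimes> s |n s. n \<in> N \<and> s \<in> S}"
    and F: "\<And>n x. n \<in> N \<Longrightarrow> x \<in> T \<Longrightarrow> F (n \<otimes> x) = F x"
  shows "of_nat (card (N \<inter> S)) * sum F T = of_nat (card N) * sum F S"
proof -
  have T_eq: "T = (\<lambda>(n,s). n \<otimes> s) ` (N \<times> S)" unfolding T by auto
  have fin: "finite T" "finite S" unfolding T_eq using subgroup_finite N S by auto
  have ST: "s \<in> T" if "s \<in> S" for s
    unfolding T using that subgroup.one_closed[OF N] subgroup.mem_carrier[OF S that] by force
  have "of_nat (card (N \<inter> S)) * sum F T = (\<Sum>x\<in>T. \<Sum>s\<in>S. if x \<otimes> inv s \<in> N then F x else 0)"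
    unfolding sum_distrib_left
  proof (rule sum.cong[OF refl])
    fix x assume "x \<in> T"
    then obtain n s where "n \<in> N" "s \<in> S" "x = n \<otimes> s" unfolding T by blast
    note card_product_section[OF N S this]
    moreover have "(\<Sum>s\<in>S. if x \<otimes> inv s \<in> N then F x else 0) = of_nat (card {s \<in> S. x \<otimes> inv s \<in> N}) * F x"
      using fin by (simp flip: sum.inter_filter)
    ultimately show "of_nat (card (N \<inter> S)) * F x = (\<Sum>s\<in>S. if x \<otimes> inv s \<in> N then F x else 0)"
      by simp
  qed
  also have "\<dots> = (\<Sum>s\<in>S. \<Sum>x\<in>T. if x \<otimes> inv s \<in> N then F x else 0)" by (rule sum.swap)
  also have "\<dots> = (\<Sum>s\<in>S. of_nat (card N) * F s)"
  proof (rule sum.cong[OF refl])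
    fix s assume s: "s \<in> S"
    have sc: "s \<in> carrier G" using subgroup.mem_carrier[OF S s] .
    have TN: "x \<in> carrier G" if "x \<in> T" for x
      using that subgroup.mem_carrier[OF N] subgroup.mem_carrier[OF S] unfolding T by auto
    have bij: "bij_betw (\<lambda>n. n \<otimes> s) N {x \<in> T. x \<otimes> inv s \<in> N}"
    proof (rule bij_betw_byWitness[where f' = "\<lambda>x. x \<otimes> inv s"])
      show "(\<lambda>n. n \<otimes> s) ` N \<subseteq> {x \<in> T. x \<otimes> inv s \<in> N}"
        using s sc subgroup.mem_carrier[OF N] unfolding T by (auto simp: m_assoc)
    qed (use sc subgroup.mem_carrier[OF N] TN in \<open>auto simp: m_assoc\<close>)
    have "(\<Sum>x\<in>T. if x \<otimes> inv s \<in> N then F x else 0) = sum F {x \<in> T. x \<otimes> inv s \<in> N}"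
      using fin by (simp flip: sum.inter_filter)
    also have "\<dots> = (\<Sum>n\<in>N. F (n \<otimes> s))" by (rule sum.reindex_bij_betw[OF bij, symmetric])
    also have "\<dots> = of_nat (card N) * F s" using F ST[OF s] by simp
    finally show "(\<Sum>x\<in>T. if x \<otimes> inv s \<in> N then F x else 0) = of_nat (card N) * F s" .
  qed
  finally show ?thesis by (simp add: sum_distrib_left)
qed

end

locale restricted_char_data = char_data G N \<theta> T d P \<alpha> for G (structure) and N \<theta> T d P \<alpha> +
  fixes S M :: "'a set" and \<alpha>' :: "'a \<Rightarrow> 'a \<Rightarrow> complex"
  assumes S_sub: "subgroup S G" and S_T: "S \<subseteq> T" and M_def: "M = N \<inter> S"
    and T_NS: "\<And>x. x \<in> T \<Longrightarrow> \<exists>n\<in>N. \<exists>s\<in>S. x = n \<otimes> s"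
    and \<alpha>_eq: "\<And>x y. x \<in> S \<Longrightarrow> y \<in> S \<Longrightarrow> \<alpha>' x y = \<alpha> x y"
begin

lemma S_closed [simp]: "x \<in> S \<Longrightarrow> y \<in> S \<Longrightarrow> x \<otimes> y \<in> S" "x \<in> S \<Longrightarrow> inv x \<in> S" "\<one> \<in> S"
  using S_sub by (auto intro: subgroup.m_closed subgroup.m_inv_closed subgroup.one_closed)

lemma S_carrier: "x \<in> S \<Longrightarrow> x \<in> carrier G"
  using S_T T_carrier by blast

lemma M_sub: "subgroup M G"
  unfolding M_def by (rule subgroups_Inter_pair[OF N_sub S_sub])

lemma sum_T_S:
  fixes F :: "'a \<Rightarrow> complex"
  assumes F: "\<And>n x. n \<in> N \<Longrightarrow> x \<in> T \<Longrightarrow> F (n \<otimes> x) = F x"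
  shows "of_nat (card M) * sum F T = of_nat (card N) * sum F S"
  unfolding M_def
proof (rule sum_subgroup_product[OF N_sub S_sub _ F])
  have "n \<otimes> s \<in> T" if "n \<in> N" "s \<in> S" for n s
    using T_closed(1)[OF N_T[OF that(1)] subsetD[OF S_T that(2)]] .
  then show "T = {n \<otimes> s |n s. n \<in> N \<and> s \<in> S}" using T_NS by blast
qed

lemma cardM_nz: "of_nat (card M) \<noteq> (0::complex)"
  using subgroup_card[OF M_sub] by simp

lemma card_T_S: "of_nat (card T) = of_nat (card N) / of_nat (card M) * (of_nat (card S) :: complex)"
  using sum_T_S[of "\<lambda>_. 1"] cardM_nz by (simp add: field_simps)

definition rst :: "('a \<Rightarrow> complex) \<Rightarrow> 'a \<Rightarrow> complex" where
  "rst q = (\<lambda>x. if x \<in> S then q x else 0)"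

text \<open>\<open>SOME\<close> picks a representative in \<open>S\<close> of the coset of
  \<open>x\<close>. For \<open>q\<close> in \<open>twcls G S M \<alpha>'\<close> the value does not
  depend on the choice, since two representatives differ by an element of \<open>M\<close>; see
  \<open>ext_NS\<close>.\<close>

definition ext :: "('a \<Rightarrow> complex) \<Rightarrow> 'a \<Rightarrow> complex" where
  "ext q = (\<lambda>x. if x \<in> T then q (SOME s. s \<in> S \<and> x \<otimes> inv s \<in> N) else 0)"

lemma rst_twcls: "q \<in> twcls G T N \<alpha> \<Longrightarrow> rst q \<in> twcls G S M \<alpha>'"
  using S_T by (auto simp: twcls_def rst_def M_def \<alpha>_eq) (meson subsetD)

lemma ext_NS:
  assumes q: "q \<in> twcls G S M \<alpha>'" and n: "n \<in> N" and s: "s \<in> S"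
  shows "ext q (n \<otimes> s) = q s"
proof -
  let ?x = "n \<otimes> s"
  let ?r = "SOME r. r \<in> S \<and> ?x \<otimes> inv r \<in> N"
  have c: "n \<in> carrier G" "s \<in> carrier G" using n s N_carrier S_carrier by auto
  have "?r \<in> S \<and> ?x \<otimes> inv ?r \<in> N"
    by (rule someI[of _ s]) (use n s c in \<open>simp add: m_assoc\<close>)
  then have r: "?r \<in> S" "?x \<otimes> inv ?r \<in> N" by auto
  have rc: "?r \<in> carrier G" by (rule S_carrier[OF r(1)])
  have "inv n \<otimes> (?x \<otimes> inv ?r) \<in> N" using n r N_closed by simp
  moreover have eq: "inv n \<otimes> (?x \<otimes> inv ?r) = s \<otimes> inv ?r" using c rc by (simp add: m_assoc)
  ultimately have "s \<otimes> inv ?r \<in> M" using s r by (simp add: M_def)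
  then have "q (s \<otimes> inv ?r \<otimes> ?r) = q ?r" using q r(1) unfolding twcls_def by blast
  moreover have "s \<otimes> inv ?r \<otimes> ?r = s" using c rc by (simp add: m_assoc)
  ultimately have "q ?r = q s" by simp
  moreover have "?x \<in> T" using n s N_T S_T by auto
  ultimately show ?thesis by (simp add: ext_def)
qed

lemma ext_twcls:
  assumes q: "q \<in> twcls G S M \<alpha>'"
  shows "ext q \<in> twcls G T N \<alpha>"
  unfolding twcls_def
proof (intro CollectI conjI allI impI ballI)
  show "ext q x = 0" if "x \<notin> T" for x using that by (simp add: ext_def)
  fix x n assume x: "x \<in> T" and n: "n \<in> N"
  obtain m s where ms: "m \<in> N" "s \<in> S" "x = m \<otimes> s" using T_NS[OF x] by blast
  have "n \<otimes> x = (n \<otimes> m) \<otimes> s" using n ms N_carrier S_carrier by (simp add: m_assoc)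
  then show "ext q (n \<otimes> x) = ext q x" using ext_NS[OF q _ ms(2)] n ms N_closed by simp
next
  fix g x assume g: "g \<in> T" and x: "x \<in> T"
  obtain m s where ms: "m \<in> N" "s \<in> S" "x = m \<otimes> s" using T_NS[OF x] by blast
  obtain k r where kr: "k \<in> N" "r \<in> S" "g = k \<otimes> r" using T_NS[OF g] by blast
  have c: "m \<in> carrier G" "s \<in> carrier G" "k \<in> carrier G" "r \<in> carrier G"
    using ms kr N_carrier S_carrier by auto
  have cT: "m \<in> T" "s \<in> T" "k \<in> T" "r \<in> T" using ms kr N_T S_T by auto
  let ?y = "r \<otimes> s \<otimes> inv r"
  \<comment> \<open>Obtained by moving all factors from \<open>N\<close> in the conjugate of
    \<open>m \<otimes> s\<close> by \<open>k \<otimes> r\<close> to the left of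
    \<open>?y\<close>.\<close>
  let ?n = "k \<otimes> (r \<otimes> m \<otimes> inv r) \<otimes> (?y \<otimes> inv k \<otimes> inv ?y)"
  have y: "?y \<in> S" "?y \<in> T" "?y \<in> carrier G" using ms kr cT c by auto
  have nN: "?n \<in> N" using N_conj[OF c(4) ms(1)] N_conj[OF y(3), of "inv k"] kr N_closed by simp
  have gx: "g \<otimes> x \<otimes> inv g = ?n \<otimes> ?y"
    using ms(3) kr(3) c by (simp add: inv_mult_group m_assoc)
  have a1: "\<alpha> (?n \<otimes> ?y) (k \<otimes> r) = \<alpha> ?y r"
    using \<alpha>_N_left[OF nN y(2), of "k \<otimes> r"] \<alpha>_N_mid[OF kr(1) y(2), of r] cT by simp
  have a2: "\<alpha> (k \<otimes> r) (m \<otimes> s) = \<alpha> r s"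
    using \<alpha>_N_left[OF kr(1), of r "m \<otimes> s"] \<alpha>_N_mid[OF ms(1), of r s] cT by simp
  have "q ?y * \<alpha>' ?y r = \<alpha>' r s * q s" using q kr ms unfolding twcls_def by blast
  then show "ext q (g \<otimes> x \<otimes> inv g) * \<alpha> (g \<otimes> x \<otimes> inv g) g = \<alpha> g x * ext q x"
    unfolding gx ext_NS[OF q nN y(1)] unfolding ms(3) kr(3) a1 a2 ext_NS[OF q ms(1,2)]
    using \<alpha>_eq y(1) kr ms by simp
qed

lemma rst_ext: "q \<in> twcls G S M \<alpha>' \<Longrightarrow> rst (ext q) = q"
proof
  fix x assume q: "q \<in> twcls G S M \<alpha>'"
  show "rst (ext q) x = q x"
  proof (cases "x \<in> S")
    case True
    then show ?thesis using ext_NS[OF q N_closed(3) True] S_carrier by (simp add: rst_def)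
  next
    case False
    then show ?thesis using q by (simp add: rst_def twcls_def)
  qed
qed

lemma rst_inj:
  assumes "\<And>x. x \<notin> T \<Longrightarrow> f x = (g x :: complex)" "\<And>n x. n \<in> N \<Longrightarrow> x \<in> T \<Longrightarrow> f (n \<otimes> x) = f x"
    "\<And>n x. n \<in> N \<Longrightarrow> x \<in> T \<Longrightarrow> g (n \<otimes> x) = g x" and eq: "\<And>s. s \<in> S \<Longrightarrow> f s = g s"
  shows "f = g"
proof
  fix x show "f x = g x"
  proof (cases "x \<in> T")
    case True
    then obtain n s where "n \<in> N" "s \<in> S" "x = n \<otimes> s" using T_NS by blast
    then show ?thesis using assms(2,3)[of n s] eq S_T by auto
  qed (rule assms(1))
qed

lemma ext_rst:
  assumes q: "q \<in> twcls G T N \<alpha>"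
  shows "ext (rst q) = q"
proof (rule rst_inj)
  have e: "ext (rst q) \<in> twcls G T N \<alpha>" by (rule ext_twcls[OF rst_twcls[OF q]])
  show "ext (rst q) x = q x" if "x \<notin> T" for x using twclsD(1)[OF q that] twclsD(1)[OF e that] by simp
  show "ext (rst q) (n \<otimes> x) = ext (rst q) x" if "n \<in> N" "x \<in> T" for n x by (rule twclsD(2)[OF e that(2,1)])
  show "q (n \<otimes> x) = q x" if "n \<in> N" "x \<in> T" for n x by (rule twclsD(2)[OF q that(2,1)])
  show "ext (rst q) s = q s" if "s \<in> S" for s
    using fun_cong[OF rst_ext[OF rst_twcls[OF q]], of s] that by (simp add: rst_def)
qed

text \<open>The summands depend only on the coset of \<open>z\<close> modulo \<open>N\<close>, so
  \<open>sum_T_S\<close> compares the sum over \<open>T\<close> with the one over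
  \<open>S\<close>.\<close>

lemma tw_S:
  assumes q1: "q1 \<in> twcls G T N \<alpha>" and q2: "q2 \<in> twcls G T N \<alpha>" and s: "s \<in> S"
  shows "tw G T \<alpha> q1 q2 s = of_nat (card N) / of_nat (card M) * tw G S \<alpha>' (rst q1) (rst q2) s"
proof -
  have sT: "s \<in> T" using s S_T by blast
  let ?F = "\<lambda>z. q1 z * q2 (inv z \<otimes> s) * \<alpha> z (inv z \<otimes> s)"
  have "?F (n \<otimes> z) = ?F z" if n: "n \<in> N" and z: "z \<in> T" for n z
  proof -
    have c: "n \<in> carrier G" "z \<in> carrier G" "s \<in> carrier G" "n \<in> T" using n z s N_carrier T_carrier S_carrier N_T by auto
    obtain n' where n': "n' \<in> N" "inv z \<otimes> inv n = n' \<otimes> inv z"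
      using move_right[of "inv z" "inv n"] n z N_closed by auto
    have "inv (n \<otimes> z) \<otimes> s = n' \<otimes> (inv z \<otimes> s)"
      using n' c N_carrier by (simp add: inv_mult_group flip: m_assoc)
    moreover have "inv z \<otimes> s \<in> T" using z sT by simp
    ultimately show ?thesis
      using twclsD(2)[OF q1 z n] twclsD(2)[OF q2, of "inv z \<otimes> s" n'] n' n z c
        \<alpha>_N_left[OF n z, of "n' \<otimes> (inv z \<otimes> s)"] \<alpha>_N_mid[OF n'(1) z, of "inv z \<otimes> s"] N_T by simp
  qed
  then have "of_nat (card M) * sum ?F T = of_nat (card N) * sum ?F S" by (rule sum_T_S)
  moreover have "tw G T \<alpha> q1 q2 s = sum ?F T" using sT by (simp add: tw_def)
  moreover have "tw G S \<alpha>' (rst q1) (rst q2) s = sum ?F S"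
    using s by (auto simp: tw_def rst_def \<alpha>_eq intro!: sum.cong)
  ultimately show ?thesis using cardM_nz by (simp add: field_simps)
qed

lemma tw_iff:
  assumes q1: "q1 \<in> twcls G T N \<alpha>" and q2: "q2 \<in> twcls G T N \<alpha>"
  shows "tw G T \<alpha> q1 q2 = (\<lambda>x. of_nat (card N) / of_nat (card M) * c * q1 x) \<longleftrightarrow>
    tw G S \<alpha>' (rst q1) (rst q2) = (\<lambda>x. c * rst q1 x)"
proof
  assume a: "tw G T \<alpha> q1 q2 = (\<lambda>x. of_nat (card N) / of_nat (card M) * c * q1 x)"
  show "tw G S \<alpha>' (rst q1) (rst q2) = (\<lambda>x. c * rst q1 x)"
  proof
    fix x show "tw G S \<alpha>' (rst q1) (rst q2) x = c * rst q1 x"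
    proof (cases "x \<in> S")
      case True
      then have "of_nat (card N) / of_nat (card M) * tw G S \<alpha>' (rst q1) (rst q2) x =
          of_nat (card N) / of_nat (card M) * (c * rst q1 x)"
        using tw_S[OF q1 q2 True] a by (auto simp: rst_def)
      then show ?thesis using cardM_nz cardN_nz by simp
    qed (simp add: tw_def rst_def)
  qed
next
  assume a: "tw G S \<alpha>' (rst q1) (rst q2) = (\<lambda>x. c * rst q1 x)"
  show "tw G T \<alpha> q1 q2 = (\<lambda>x. of_nat (card N) / of_nat (card M) * c * q1 x)"
  proof (rule rst_inj)
    show "tw G T \<alpha> q1 q2 s = of_nat (card N) / of_nat (card M) * c * q1 s" if "s \<in> S" for s
      using tw_S[OF q1 q2 that] a that by (simp add: rst_def)
  qed (use twclsD[OF q1] tw_outside tw_coset[OF q1 q2] in auto)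
qed

text \<open>The factor between the two products is also the ratio of \<open>card T\<close> to
  \<open>card S\<close>, so the normalisation in \<open>twirr\<close> is preserved; in the ideal
  property it is absorbed by the scalar.\<close>

lemma rst_twirr_iff:
  assumes q: "q \<in> twcls G T N \<alpha>"
  shows "rst q \<in> twirr G S M \<alpha>' \<longleftrightarrow> q \<in> twirr G T N \<alpha>"
proof -
  let ?k = "of_nat (card N) / of_nat (card M) :: complex"
  have k: "?k \<noteq> 0" using cardM_nz cardN_nz by simp
  have one: "rst q \<one> = q \<one>" by (simp add: rst_def)
  have idem: "tw G S \<alpha>' (rst q) (rst q) = (\<lambda>x. of_nat (card S) / rst q \<one> * rst q x) \<longleftrightarrow>
      tw G T \<alpha> q q = (\<lambda>x. of_nat (card T) / q \<one> * q x)"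
    using tw_iff[OF q q, of "of_nat (card S) / q \<one>"] by (simp add: one card_T_S)
  have ideal: "(\<exists>c. tw G S \<alpha>' (rst q) (rst f) = (\<lambda>x. c * rst q x)) \<longleftrightarrow> (\<exists>c. tw G T \<alpha> q f = (\<lambda>x. c * q x))"
    if f: "f \<in> twcls G T N \<alpha>" for f
  proof
    assume "\<exists>c. tw G T \<alpha> q f = (\<lambda>x. c * q x)"
    then obtain c where "tw G T \<alpha> q f = (\<lambda>x. ?k * (c / ?k) * q x)" using k by auto
    then show "\<exists>c. tw G S \<alpha>' (rst q) (rst f) = (\<lambda>x. c * rst q x)" using tw_iff[OF q f] by blast
  qed (use tw_iff[OF q f] in blast)
  have all: "(\<forall>f\<in>twcls G S M \<alpha>'. R f) \<longleftrightarrow> (\<forall>f\<in>twcls G T N \<alpha>. R (rst f))" for R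
    using rst_twcls ext_twcls rst_ext by metis
  show ?thesis
    unfolding twirr_def using q rst_twcls[OF q] idem ideal one by (simp add: all)
qed

lemma rst_bij: "bij_betw rst (twirr G T N \<alpha>) (twirr G S M \<alpha>')"
proof (rule bij_betw_byWitness[where f' = ext])
  have cls: "q \<in> twcls G T N \<alpha>" if "q \<in> twirr G T N \<alpha>" for q using that by (simp add: twirr_def)
  have cls': "q \<in> twcls G S M \<alpha>'" if "q \<in> twirr G S M \<alpha>'" for q using that by (simp add: twirr_def)
  show "\<forall>a\<in>twirr G T N \<alpha>. ext (rst a) = a" using ext_rst cls by blast
  show "\<forall>a\<in>twirr G S M \<alpha>'. rst (ext a) = a" using rst_ext cls' by blast
  show "rst ` twirr G T N \<alpha> \<subseteq> twirr G S M \<alpha>'" using rst_twirr_iff cls by blast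
  show "ext ` twirr G S M \<alpha>' \<subseteq> twirr G T N \<alpha>"
    using rst_twirr_iff[OF ext_twcls[OF cls']] rst_ext[OF cls'] by auto
qed

end

section \<open>Galois action on characters and projective representations\<close>

lemma map_mat_Gal_mult:
  assumes s: "\<sigma> \<in> GalQab" and A: "A \<in> carrier_mat n m" and B: "B \<in> carrier_mat m k"
    and AQ: "\<And>i j. i < n \<Longrightarrow> j < m \<Longrightarrow> A $$ (i,j) \<in> Qab" and BQ: "\<And>i j. i < m \<Longrightarrow> j < k \<Longrightarrow> B $$ (i,j) \<in> Qab"
  shows "map_mat \<sigma> (A * B) = map_mat \<sigma> A * map_mat \<sigma> B"
proof (rule eq_matI)
  fix i j assume "i < dim_row (map_mat \<sigma> A * map_mat \<sigma> B)" "j < dim_col (map_mat \<sigma> A * map_mat \<sigma> B)"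
  then have ij: "i < n" "j < k" using A B by auto
  have "map_mat \<sigma> (A * B) $$ (i,j) = \<sigma> (\<Sum>l<m. A $$ (i,l) * B $$ (l,j))"
    using ij A B mat_mult_index[OF A B ij] by simp
  also have "\<dots> = (\<Sum>l<m. \<sigma> (A $$ (i,l) * B $$ (l,j)))"
    using ij AQ BQ by (intro Gal_sum[OF s]) (auto intro: Qab_closed)
  also have "\<dots> = (\<Sum>l<m. map_mat \<sigma> A $$ (i,l) * map_mat \<sigma> B $$ (l,j))"
    using ij A B AQ BQ by (intro sum.cong) (auto simp: Gal_mult[OF s])
  also have "\<dots> = (map_mat \<sigma> A * map_mat \<sigma> B) $$ (i,j)"
    using ij A B by (intro mat_mult_index[symmetric]) auto
  finally show "map_mat \<sigma> (A * B) $$ (i,j) = (map_mat \<sigma> A * map_mat \<sigma> B) $$ (i,j)" .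
qed (use A B in auto)

lemma map_mat_Gal_one: "\<sigma> \<in> GalQab \<Longrightarrow> map_mat \<sigma> (1\<^sub>m d) = 1\<^sub>m d"
  by (rule eq_matI) (auto simp: Gal_one Gal_zero)

lemma trace_map_mat_Gal:
  assumes "\<sigma> \<in> GalQab" "A \<in> carrier_mat d d" "\<And>i j. i < d \<Longrightarrow> j < d \<Longrightarrow> A $$ (i,j) \<in> Qab"
  shows "mat_trace (map_mat \<sigma> A) = \<sigma> (mat_trace A)"
  using assms Gal_sum[OF assms(1), of "{..<d}" "\<lambda>i. A $$ (i,i)"] by (simp add: mat_trace_def)

context fin_group
begin

section \<open>Character values and their Galois conjugates\<close>

lemma rep_power:
  assumes K: "subgroup K G" and rep: "is_rep G K d \<rho>" and x: "x \<in> K"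
  shows "\<rho> (x [^] (k::nat)) = \<rho> x ^\<^sub>m k \<and> x [^] k \<in> K"
proof (induction k)
  case 0
  have "\<rho> x \<in> carrier_mat d d" using rep x by (simp add: is_rep_def)
  then show ?case using rep subgroup.one_closed[OF K] by (simp add: is_rep_def)
next
  case (Suc k)
  then show ?case using rep x subgroup.m_closed[OF K] by (simp add: is_rep_def)
qed

lemma finite_order:
  assumes x: "x \<in> carrier G"
  obtains m :: nat where "m > 0" "x [^] m = \<one>"
proof -
  have "\<not> inj (\<lambda>k::nat. x [^] k)"
  proof
    assume "inj (\<lambda>k::nat. x [^] k)"
    moreover have "finite (range (\<lambda>k::nat. x [^] k))"
      by (rule finite_subset[OF _ fin]) (use x in auto)
    ultimately show False using finite_imageD infinite_UNIV_nat by blast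
  qed
  then obtain i j :: nat where ij: "x [^] i = x [^] j" "i \<noteq> j" by (auto simp: inj_def)
  then have "x [^] (i - j) = \<one>" "x [^] (j - i) = \<one>" using pow_eq_div2[OF x, of i j] pow_eq_div2[OF x, of j i] by auto
  then show ?thesis using that[of "i - j"] that[of "j - i"] ij(2) by (cases "i < j") auto
qed

text \<open>The eigenvalues of \<open>\<rho> x\<close> are \<open>m\<close>-th roots of unity.
  Having modulus 1, each has its \<open>(m - 1)\<close>-th power as complex conjugate, and these
  powers are the eigenvalues at \<open>x [^] (m - 1)\<close>, which is \<open>inv x\<close>.\<close>

lemma rep_trace_values:
  assumes K: "subgroup K G" and rep: "is_rep G K d \<rho>" and x: "x \<in> K"
  shows "mat_trace (\<rho> x) \<in> Qab" "cnj (mat_trace (\<rho> x)) = mat_trace (\<rho> (inv x))"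
proof -
  have xc: "x \<in> carrier G" by (rule subgroup.mem_carrier[OF K x])
  obtain m :: nat where m: "m > 0" and xm: "x [^] m = \<one>" by (rule finite_order[OF xc])
  have c: "\<rho> x \<in> carrier_mat d d" using rep x by (simp add: is_rep_def)
  have "\<rho> x ^\<^sub>m m = 1\<^sub>m d" using rep_power[OF K rep x, of m] xm rep by (simp add: is_rep_def)
  then obtain l where l: "\<And>i. i < d \<Longrightarrow> l i ^ m = 1" and tr: "\<And>k. mat_trace (\<rho> x ^\<^sub>m k) = (\<Sum>i<d. l i ^ k)"
    using finite_order_traces[OF c] by metis
  have t1: "mat_trace (\<rho> x) = (\<Sum>i<d. l i)" using tr[of 1] c by simp
  have "l i \<in> Qab" if "i < d" for i
    using Qab_root l[OF that] m by (auto simp: root_of_unity_def)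
  then show "mat_trace (\<rho> x) \<in> Qab" unfolding t1 by (intro Qab_sum) auto
  have "x [^] (m - 1) = inv x"
  proof -
    have "x [^] (m - 1) \<otimes> x = \<one>" using xm m nat_pow_Suc[of x "m - 1"] by simp
    then show ?thesis using inv_equality[of "x [^] (m - 1)" x] xc by simp
  qed
  then have "mat_trace (\<rho> (inv x)) = (\<Sum>i<d. l i ^ (m - 1))"
    using rep_power[OF K rep x, of "m - 1"] tr[of "m - 1"] by simp
  also have "\<dots> = (\<Sum>i<d. cnj (l i))"
  proof (intro sum.cong refl)
    fix i assume "i \<in> {..<d}"
    then have li: "l i ^ m = 1" using l by simp
    have "norm (l i) ^ m = 1" using li by (metis norm_one norm_power)
    then have "norm (l i) = 1" using m power_eq_iff_eq_base[of m "norm (l i)" 1] by simp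
    then have "cnj (l i) * l i = 1" by (simp add: complex_norm_square[symmetric] mult.commute)
    moreover have "l i ^ (m - 1) * l i = 1" using li m by (metis power_minus_mult)
    moreover have "l i \<noteq> 0" using \<open>norm (l i) = 1\<close> by auto
    ultimately show "l i ^ (m - 1) = cnj (l i)" by (metis mult_right_cancel)
  qed
  also have "\<dots> = cnj (mat_trace (\<rho> x))" unfolding t1 by simp
  finally show "cnj (mat_trace (\<rho> x)) = mat_trace (\<rho> (inv x))" by simp
qed

text \<open>Rationality and the effect of complex conjugation are read off from eigenvalues, so
  \<open>irrfun\<close> is traded here for a representation through
  \<open>Irr_eq_irrfun\<close>.\<close>

lemma irrfun_values:
  assumes K: "subgroup K G" and irr: "irrfun K \<chi>"
  shows "\<chi> x \<in> Qab" "x \<in> K \<Longrightarrow> cnj (\<chi> x) = \<chi> (inv x)" "\<exists>d. \<chi> \<one> = of_nat d"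
proof -
  have "\<chi> \<in> Irr G K" using Irr_eq_irrfun[OF K] irr by simp
  then obtain d \<rho> where r: "irreducible_rep G K d \<rho>" and chi: "\<chi> = char_of K \<rho>" by (auto simp: Irr_def)
  have rep: "is_rep G K d \<rho>" using r by (simp add: irreducible_rep_def)
  show "\<chi> x \<in> Qab" using rep_trace_values(1)[OF K rep] Qab_closed(1) by (simp add: chi char_of_def)
  show "cnj (\<chi> x) = \<chi> (inv x)" if "x \<in> K"
    using rep_trace_values(2)[OF K rep that] that subgroup.m_inv_closed[OF K] by (simp add: chi char_of_def)
  show "\<exists>d. \<chi> \<one> = of_nat d" using char_of_irrfun(2)[OF r K] chi by blast
qed

lemma Gal_conv:
  assumes s: "\<sigma> \<in> GalQab" and f: "\<And>x. f x \<in> Qab" and g: "\<And>x. g x \<in> Qab"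
  shows "\<sigma> \<circ> conv f g = conv (\<sigma> \<circ> f) (\<sigma> \<circ> g)"
proof
  fix x
  have "\<sigma> (\<Sum>y\<in>carrier G. f y * g (inv y \<otimes> x)) = (\<Sum>y\<in>carrier G. \<sigma> (f y * g (inv y \<otimes> x)))"
    using f g by (intro Gal_sum[OF s]) (auto intro: Qab_closed)
  then show "(\<sigma> \<circ> conv f g) x = conv (\<sigma> \<circ> f) (\<sigma> \<circ> g) x"
    using f g by (simp add: conv_def Gal_zero[OF s] Gal_mult[OF s])
qed

lemma conv_Qab: "(\<And>x. f x \<in> Qab) \<Longrightarrow> (\<And>x. g x \<in> Qab) \<Longrightarrow> conv f g x \<in> Qab"
  by (auto simp: conv_def intro!: Qab_sum Qab_closed)

lemma cj_Gal: "\<sigma> \<in> GalQab \<Longrightarrow> cj g (\<sigma> \<circ> f) = \<sigma> \<circ> cj g f"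
  by (rule ext) (simp add: cj_def Gal_zero)

lemma Gal_irrfun_one:
  "\<sigma> \<in> GalQab \<Longrightarrow> subgroup K G \<Longrightarrow> irrfun K \<chi> \<Longrightarrow> \<sigma> (\<chi> \<one>) = \<chi> \<one>"
  using irrfun_values(3) Gal_of_nat by metis

text \<open>Galois conjugates of irreducible characters are obtained without realising the
  representation over the abelian closure: the class-sum identities characterising \<open>irrfun\<close>
  are polynomial.\<close>
lemma Gal_irrfun:
  assumes s: "\<sigma> \<in> GalQab" and K: "subgroup K G" and irr: "irrfun K \<chi>"
  shows "irrfun K (\<sigma> \<circ> \<chi>)"
proof -
  note X = irrfunD[OF irr] and V = irrfun_values[OF K irr]
  note cl = subgroup.m_closed[OF K] subgroup.m_inv_closed[OF K]
  have one: "(\<sigma> \<circ> \<chi>) \<one> = \<chi> \<one>" using Gal_irrfun_one[OF s K irr] by simp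
  have Z: "\<sigma> \<circ> \<chi> \<in> ZC K" using X(1) by (auto simp: ZC_def Gal_zero[OF s])
  have q: "of_nat (card K) / \<chi> \<one> \<in> Qab" using V(1) by (intro Qab_divide Qab_of_nat)
  have sq: "\<sigma> (of_nat (card K) / \<chi> \<one>) = of_nat (card K) / \<chi> \<one>"
    using V(1) one by (simp add: Gal_divide[OF s] Gal_of_nat[OF s] Qab_of_nat)
  have FE: "(\<Sum>g\<in>K. (\<sigma> \<circ> \<chi>) (x \<otimes> (g \<otimes> y \<otimes> inv g))) = of_nat (card K) / (\<sigma> \<circ> \<chi>) \<one> * (\<sigma> \<circ> \<chi>) x * (\<sigma> \<circ> \<chi>) y"
    if "x \<in> K" "y \<in> K" for x y
  proof -
    have "(\<Sum>g\<in>K. (\<sigma> \<circ> \<chi>) (x \<otimes> (g \<otimes> y \<otimes> inv g))) = \<sigma> (\<Sum>g\<in>K. \<chi> (x \<otimes> (g \<otimes> y \<otimes> inv g)))"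
      using V(1) by (simp add: Gal_sum[OF s])
    also have "\<dots> = \<sigma> (of_nat (card K) / \<chi> \<one> * \<chi> x * \<chi> y)"
      using irrfun_class_sums[OF K irr that] by simp
    also have "\<dots> = of_nat (card K) / \<chi> \<one> * \<sigma> (\<chi> x) * \<sigma> (\<chi> y)"
      by (simp only: Gal_mult[OF s Qab_closed(4)[OF q V(1)] V(1)] Gal_mult[OF s q V(1)] sq)
    finally show ?thesis using one by simp
  qed
  show ?thesis
    unfolding irrfun_def
  proof (intro conjI ballI Z)
    show "\<exists>r::real. r > 0 \<and> (\<sigma> \<circ> \<chi>) \<one> = of_real r" using irr unfolding one by (simp add: irrfun_def)
    have "conv (\<sigma> \<circ> \<chi>) (\<sigma> \<circ> \<chi>) = \<sigma> \<circ> conv \<chi> \<chi>" by (rule Gal_conv[OF s V(1) V(1), symmetric])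
    then show "conv (\<sigma> \<circ> \<chi>) (\<sigma> \<circ> \<chi>) = (\<lambda>x. of_nat (card K) / (\<sigma> \<circ> \<chi>) \<one> * (\<sigma> \<circ> \<chi>) x)"
      unfolding X(3) one by (simp add: fun_eq_iff Gal_mult[OF s q V(1), unfolded sq] del: times_divide_eq_left)
    show "\<exists>c. conv (\<sigma> \<circ> \<chi>) f = (\<lambda>x. c * (\<sigma> \<circ> \<chi>) x)" if "f \<in> ZC K" for f
      by (rule ideal_from_class_sums[OF K Z _ FE that]) (use one X(2) in auto)
  qed
qed

lemma conj_char_one:
  assumes s: "\<sigma> \<in> GalQab" and K: "subgroup K G" and chi: "\<chi> \<in> ZC K"
  shows "conj_char G K \<one> \<sigma> \<chi> = \<sigma> \<circ> \<chi>"
  using ZC_outside[OF chi] subgroup.mem_carrier[OF K] Gal_zero[OF s] by (auto simp: conj_char_def fun_eq_iff)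

end

context clifford
begin

section \<open>Characters above the Galois conjugates of \<theta>\<close>

lemma conj_char_cj:
  assumes s: "\<sigma> \<in> GalQab" and g: "g \<in> carrier G" and f: "f \<in> ZC N"
  shows "conj_char G N g \<sigma> f = \<sigma> \<circ> cj g f"
proof
  fix x show "conj_char G N g \<sigma> f x = (\<sigma> \<circ> cj g f) x"
    using ZC_outside[OF cj_ZC_N[OF f g], of x] N_carrier[of x] Gal_zero[OF s]
    by (auto simp: conj_char_def cj_def)
qed

lemma stab_eq_T: "stab G (carrier G) N \<theta> = T"
  using conj_char_cj[OF Gal_id _ irrfunD(1)[OF irr]] by (auto simp: stab_def T_def)

text \<open>Complex conjugation of the values amounts to inversion of the argument. The inner
  product thereby becomes polynomial in the character values, and a Galois automorphism can be
  applied to it.\<close>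

lemma inner_prod_conv:
  assumes a: "irrfun N \<theta>'"
  shows "inner_prod N \<chi> \<theta>' = conv \<chi> \<theta>' \<one> / of_nat (card N)"
proof -
  have "conv \<chi> \<theta>' \<one> = (\<Sum>y\<in>N. \<chi> (\<one> \<otimes> inv y) * \<theta>' y)"
    by (rule conv_on_subgroup_right[OF N_sub ZC_outside[OF irrfunD(1)[OF a]]]) auto
  also have "\<dots> = (\<Sum>y\<in>N. \<chi> (inv y) * \<theta>' y)" using N_carrier by (intro sum.cong) auto
  also have "\<dots> = (\<Sum>y\<in>N. \<chi> (inv (inv y)) * \<theta>' (inv y))" by (rule sum_inv[OF N_sub, symmetric])
  also have "\<dots> = (\<Sum>y\<in>N. \<chi> y * cnj (\<theta>' y))"
    using N_carrier irrfun_values(2)[OF N_sub a] by (intro sum.cong) auto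
  finally show ?thesis by (simp add: inner_prod_def)
qed

text \<open>A convolution can be nonzero and still vanish at \<one>. Here it cannot: by
  \<open>clifford_res\<close> the value of \<open>conv \<chi> e\<close> at \<one> is a positive
  multiple of the degree of \<chi>.\<close>

lemma Irr_over_eq: "Irr_over G (carrier G) N \<theta> = over"
proof -
  have "inner_prod N \<chi> \<theta> \<noteq> 0 \<longleftrightarrow> conv \<chi> \<theta> \<noteq> (\<lambda>x. 0)" if chi: "irrfun (carrier G) \<chi>" for \<chi>
  proof
    assume "conv \<chi> \<theta> \<noteq> (\<lambda>x. 0)"
    then have "\<chi> \<in> over" using chi by (simp add: over_def)
    then have "conv \<chi> e \<one> \<noteq> 0"
      using clifford_res(3) cardT_nz irrfunD(2)[OF chi] subgroup_card[OF subgroup_self] by auto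
    then have "conv \<chi> \<theta> \<one> \<noteq> 0" by (auto simp: e_def scale_simps)
    then show "inner_prod N \<chi> \<theta> \<noteq> 0" using cardN_nz by (simp add: inner_prod_conv[OF irr])
  qed (auto simp: inner_prod_conv[OF irr])
  then show ?thesis by (auto simp: Irr_over_def over_def Irr_eq_irrfun[OF subgroup_self])
qed

lemma Gal_Irr_over:
  assumes s: "\<sigma> \<in> GalQab" and a: "irrfun N \<theta>'" and chi: "\<chi> \<in> Irr_over G (carrier G) N \<theta>'"
  shows "\<sigma> \<circ> \<chi> \<in> Irr_over G (carrier G) N (\<sigma> \<circ> \<theta>')"
proof -
  have X: "irrfun (carrier G) \<chi>" and nz: "inner_prod N \<chi> \<theta>' \<noteq> 0"
    using chi by (auto simp: Irr_over_def Irr_eq_irrfun[OF subgroup_self])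
  note V = irrfun_values(1)[OF subgroup_self X] irrfun_values(1)[OF N_sub a]
  have "conv \<chi> \<theta>' \<one> \<noteq> 0" using nz by (auto simp: inner_prod_conv[OF a])
  then have "conv (\<sigma> \<circ> \<chi>) (\<sigma> \<circ> \<theta>') \<one> \<noteq> 0"
  proof -
    have "conv \<chi> \<theta>' \<one> \<in> Qab" by (rule conv_Qab[OF V])
    moreover assume "conv \<chi> \<theta>' \<one> \<noteq> 0"
    ultimately show ?thesis using Gal_zero_iff[OF s] by (simp flip: Gal_conv[OF s V])
  qed
  then have "inner_prod N (\<sigma> \<circ> \<chi>) (\<sigma> \<circ> \<theta>') \<noteq> 0"
    using cardN_nz by (simp add: inner_prod_conv[OF Gal_irrfun[OF s N_sub a]])
  then show ?thesis
    using Gal_irrfun[OF s subgroup_self X] by (simp add: Irr_over_def Irr_eq_irrfun[OF subgroup_self])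
qed

text \<open>The right side is the shape to which \<open>extend_equivariantly\<close> applies. That
  every character above \<open>\<sigma> \<circ> \<theta>\<close> arises from one above \<theta> is
  seen by applying the inverse automorphism.\<close>

lemma Irr_over_orbit_eq:
  assumes p: "prime p"
  shows "Irr_over_orbit p G (carrier G) N \<theta> = (\<Union>\<sigma>\<in>Hgal p. (\<circ>) \<sigma> ` over)"
proof -
  have "Irr_over G (carrier G) N (conj_char G N \<one> \<sigma> \<theta>) = (\<circ>) \<sigma> ` over" if s: "\<sigma> \<in> Hgal p" for \<sigma>
  proof -
    have sG: "\<sigma> \<in> GalQab" by (rule Hgal_Gal[OF s])
    obtain \<tau> where t: "\<tau> \<in> Hgal p" "\<sigma> \<circ> \<tau> = id" "\<tau> \<circ> \<sigma> = id" using Hgal_inverse[OF p s] by blast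
    have cc: "conj_char G N \<one> \<sigma> \<theta> = \<sigma> \<circ> \<theta>"
      by (rule conj_char_one[OF sG N_sub irrfunD(1)[OF irr]])
    show ?thesis
      unfolding cc
    proof (intro equalityI subsetI)
      fix \<chi> assume "\<chi> \<in> Irr_over G (carrier G) N (\<sigma> \<circ> \<theta>)"
      then have "\<tau> \<circ> \<chi> \<in> Irr_over G (carrier G) N (\<tau> \<circ> (\<sigma> \<circ> \<theta>))"
        by (rule Gal_Irr_over[OF Hgal_Gal[OF t(1)] Gal_irrfun[OF sG N_sub irr]])
      then have "\<tau> \<circ> \<chi> \<in> over" using t by (simp add: Irr_over_eq flip: comp_assoc)
      moreover have "\<chi> = \<sigma> \<circ> (\<tau> \<circ> \<chi>)" using t by (simp flip: comp_assoc)
      ultimately show "\<chi> \<in> (\<circ>) \<sigma> ` over" by blast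
    next
      fix \<chi> assume "\<chi> \<in> (\<circ>) \<sigma> ` over"
      then show "\<chi> \<in> Irr_over G (carrier G) N (\<sigma> \<circ> \<theta>)"
        using Gal_Irr_over[OF sG irr] by (auto simp: Irr_over_eq)
    qed
  qed
  then show ?thesis by (simp add: Irr_over_orbit_def)
qed

text \<open>\<open>\<sigma> \<circ> \<chi>\<close> always lies above
  \<open>\<sigma> \<circ> \<theta>\<close>, so it lies above \<theta> exactly if these two are
  conjugate in \<open>G\<close>. The criterion does not involve \<chi>, which permits a comparison
  with \<phi>.\<close>

lemma over_Gal_iff:
  assumes s: "\<sigma> \<in> GalQab" and chi: "\<chi> \<in> over"
  shows "\<sigma> \<circ> \<chi> \<in> over \<longleftrightarrow> (\<exists>g\<in>carrier G. \<sigma> \<circ> cj g \<theta> = \<theta>)"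
proof -
  have X: "irrfun (carrier G) \<chi>" using chi by (simp add: over_def)
  have irr': "irrfun N (\<sigma> \<circ> \<theta>)" by (rule Gal_irrfun[OF s N_sub irr])
  have X': "irrfun (carrier G) (\<sigma> \<circ> \<chi>)" by (rule Gal_irrfun[OF s subgroup_self X])
  have "\<sigma> \<circ> \<chi> \<in> Irr_over G (carrier G) N (\<sigma> \<circ> \<theta>)" using Gal_Irr_over[OF s irr] chi by (simp add: Irr_over_eq)
  then have nz: "conv (\<sigma> \<circ> \<chi>) (\<sigma> \<circ> \<theta>) \<noteq> (\<lambda>x. 0)" by (auto simp: Irr_over_def inner_prod_conv[OF irr'])
  show ?thesis
  proof
    assume "\<sigma> \<circ> \<chi> \<in> over"
    then obtain g where g: "g \<in> carrier G" "\<sigma> \<circ> \<theta> = cj g \<theta>"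
      using clifford_conjugate[OF _ irr' nz] by blast
    have "\<sigma> \<circ> cj (inv g) \<theta> = cj (inv g) (cj g \<theta>)" using g(2) by (simp flip: cj_Gal[OF s])
    also have "\<dots> = \<theta>" using g(1) cj_one[OF N_outside[OF irrfunD(1)[OF irr]]] by (simp add: cj_cj)
    finally show "\<exists>g\<in>carrier G. \<sigma> \<circ> cj g \<theta> = \<theta>" using g(1) by blast
  next
    assume "\<exists>g\<in>carrier G. \<sigma> \<circ> cj g \<theta> = \<theta>"
    then obtain g where g: "g \<in> carrier G" "cj g (\<sigma> \<circ> \<theta>) = \<theta>" by (auto simp: cj_Gal[OF s])
    have cx: "cj k (\<sigma> \<circ> \<chi>) = \<sigma> \<circ> \<chi>" if "k \<in> carrier G" for k
      by (rule ZC_cj[OF irrfunD(1)[OF X'] subgroup_self that])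
    have "conv (\<sigma> \<circ> \<chi>) \<theta> = cj g (conv (\<sigma> \<circ> \<chi>) (\<sigma> \<circ> \<theta>))"
      using cj_conv[OF g(1), of "\<sigma> \<circ> \<chi>" "\<sigma> \<circ> \<theta>"] g cx by simp
    moreover have "cj (inv g) (cj g (conv (\<sigma> \<circ> \<chi>) (\<sigma> \<circ> \<theta>))) = conv (\<sigma> \<circ> \<chi>) (\<sigma> \<circ> \<theta>)"
      using g(1) cj_one[of "conv (\<sigma> \<circ> \<chi>) (\<sigma> \<circ> \<theta>)"] by (simp add: cj_cj)
    moreover have "cj k (\<lambda>x. 0) = (\<lambda>x. 0)" for k by (auto simp: cj_def)
    ultimately have "conv (\<sigma> \<circ> \<chi>) \<theta> \<noteq> (\<lambda>x. 0)" using nz by metis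
    then show "\<sigma> \<circ> \<chi> \<in> over" using X' by (simp add: over_def)
  qed
qed

end

section \<open>The conjugate of \<open>P\<close> under a pair fixing \<theta>\<close>

locale galois_char_data = char_data G N \<theta> T d P \<alpha> for G (structure) and N \<theta> T d P \<alpha> +
  fixes h :: 'a and \<sigma> :: "complex \<Rightarrow> complex"
  assumes h: "h \<in> carrier G" and \<sigma>: "\<sigma> \<in> GalQab" and fixed: "\<sigma> \<circ> cj h \<theta> = \<theta>"
    and entries: "entries_in_Qab T d P" and roots: "root_of_unity_factor_set T \<alpha>"
begin

lemma \<theta>_Qab: "\<theta> x \<in> Qab"
  by (rule irrfun_values(1)[OF N_sub irr])

lemma cj_Qab: "(\<And>x. f x \<in> Qab) \<Longrightarrow> cj g f x \<in> Qab"
  by (simp add: cj_def Qab_closed)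

lemma P_Qab: "x \<in> T \<Longrightarrow> i < d \<Longrightarrow> j < d \<Longrightarrow> P x $$ (i,j) \<in> Qab"
  using entries by (simp add: entries_in_Qab_def)

text \<open>Conjugation by \<open>h\<close> followed by \<sigma> fixes \<theta>, so \<open>h\<close>
  normalises the stabiliser; \<sigma> is cancelled by its injectivity on \<open>Qab\<close>, which
  contains all values of \<theta>.\<close>

lemma h_T: "x \<in> T \<Longrightarrow> h \<otimes> x \<otimes> inv h \<in> T"
proof -
  assume x: "x \<in> T"
  have xc: "x \<in> carrier G" and xt: "cj x \<theta> = \<theta>" using x by (auto simp: T_def)
  let ?y = "h \<otimes> x \<otimes> inv h"
  have yc: "?y \<in> carrier G" using h xc by simp
  have "\<sigma> \<circ> cj h (cj ?y \<theta>) = \<sigma> \<circ> cj x (cj h \<theta>)" using h xc by (simp add: cj_cj m_assoc)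
  also have "\<dots> = cj x (\<sigma> \<circ> cj h \<theta>)" by (simp add: cj_Gal[OF \<sigma>])
  also have "\<dots> = \<sigma> \<circ> cj h \<theta>" using fixed xt by simp
  finally have eq: "\<sigma> \<circ> cj h (cj ?y \<theta>) = \<sigma> \<circ> cj h \<theta>" .
  have hy: "cj h (cj ?y \<theta>) = cj h \<theta>"
  proof (rule ext)
    fix z
    have "\<sigma> (cj h (cj ?y \<theta>) z) = \<sigma> (cj h \<theta> z)" using fun_cong[OF eq, of z] by (simp only: comp_apply)
    then show "cj h (cj ?y \<theta>) z = cj h \<theta> z"
      by (rule Gal_inj[OF \<sigma> cj_Qab[OF cj_Qab[OF \<theta>_Qab]] cj_Qab[OF \<theta>_Qab]])
  qed
  have inverse: "cj (inv h) (cj h f) = f" if "\<And>x. x \<notin> carrier G \<Longrightarrow> f x = 0" for f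
    using h cj_one[OF that] by (simp add: cj_cj)
  have "cj (inv h) (cj h (cj ?y \<theta>)) = cj ?y \<theta>" by (rule inverse) simp
  moreover have "cj (inv h) (cj h \<theta>) = \<theta>" by (rule inverse[OF N_outside[OF irrfunD(1)[OF irr]]])
  ultimately have "cj ?y \<theta> = \<theta>" using hy by simp
  then show ?thesis using yc by (simp add: T_def)
qed

definition R :: "'a \<Rightarrow> complex mat" where
  "R = proj_conj G h \<sigma> P"

lemma R_eq: "R x = map_mat \<sigma> (P (h \<otimes> x \<otimes> inv h))"
  by (simp add: R_def proj_conj_def)

lemma R_carrier [simp]: "x \<in> T \<Longrightarrow> R x \<in> carrier_mat d d"
  using h_T by (simp add: R_eq)

lemma h_mult: "x \<in> carrier G \<Longrightarrow> y \<in> carrier G \<Longrightarrow> h \<otimes> (x \<otimes> y) \<otimes> inv h = (h \<otimes> x \<otimes> inv h) \<otimes> (h \<otimes> y \<otimes> inv h)"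
  using h by (simp add: m_assoc)

lemma R_N_left: "n \<in> N \<Longrightarrow> x \<in> T \<Longrightarrow> R (n \<otimes> x) = R n * R x"
proof -
  assume n: "n \<in> N" and x: "x \<in> T"
  have "R (n \<otimes> x) = map_mat \<sigma> (P (h \<otimes> n \<otimes> inv h) * P (h \<otimes> x \<otimes> inv h))"
    using P_N_left[OF N_conj[OF h n] h_T[OF x]] h_mult[of n x] N_carrier[OF n] T_carrier[OF x] by (simp add: R_eq)
  also have "\<dots> = R n * R x"
    unfolding R_eq using h_T[OF x] h_T[OF N_T[OF n]] P_Qab by (intro map_mat_Gal_mult[OF \<sigma>, of _ d d _ d]) auto
  finally show ?thesis .
qed

lemma R_N_right: "n \<in> N \<Longrightarrow> x \<in> T \<Longrightarrow> R (x \<otimes> n) = R x * R n"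
proof -
  assume n: "n \<in> N" and x: "x \<in> T"
  have "R (x \<otimes> n) = map_mat \<sigma> (P (h \<otimes> x \<otimes> inv h) * P (h \<otimes> n \<otimes> inv h))"
    using P_N_right[OF N_conj[OF h n] h_T[OF x]] h_mult[of x n] N_carrier[OF n] T_carrier[OF x] by (simp add: R_eq)
  also have "\<dots> = R x * R n"
    unfolding R_eq using h_T[OF x] h_T[OF N_T[OF n]] P_Qab by (intro map_mat_Gal_mult[OF \<sigma>, of _ d d _ d]) auto
  finally show ?thesis .
qed

lemma R_rep: "is_rep G N d R"
  unfolding is_rep_def using R_N_left N_T h
  by (auto simp: R_eq[of \<one>] P_one map_mat_Gal_one[OF \<sigma>])

lemma R_trace: "n \<in> N \<Longrightarrow> mat_trace (R n) = \<theta> n"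
proof -
  assume n: "n \<in> N"
  let ?w = "h \<otimes> n \<otimes> inv h"
  have w: "?w \<in> N" by (rule N_conj[OF h n])
  have "mat_trace (R n) = \<sigma> (\<theta> ?w)"
    unfolding R_eq using trace_map_mat_Gal[OF \<sigma> P_carrier[OF N_T[OF w]]] P_Qab N_T[OF w] P_trace[OF w] by simp
  also have "\<dots> = (\<sigma> \<circ> cj h \<theta>) n" using N_carrier[OF n] by (simp add: cj_def)
  finally show ?thesis using fixed by simp
qed

lemma Pinv_Qab: "x \<in> T \<Longrightarrow> i < d \<Longrightarrow> j < d \<Longrightarrow> Pinv x $$ (i,j) \<in> Qab"
proof -
  assume x: "x \<in> T" and ij: "i < d" "j < d"
  have "\<alpha> x (inv x) \<in> Qab" using roots x by (auto simp: root_of_unity_factor_set_def intro: Qab_root)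
  moreover have "P (inv x) $$ (i,j) \<in> Qab" using P_Qab x ij by simp
  moreover have "P (inv x) \<in> carrier_mat d d" using x by simp
  ultimately show ?thesis using ij Qab_closed by (auto simp: Pinv_def intro!: Qab_closed Qab_divide)
qed

definition Rinv :: "'a \<Rightarrow> complex mat" where
  "Rinv x = map_mat \<sigma> (Pinv (h \<otimes> x \<otimes> inv h))"

lemma Rinv_carrier [simp]: "x \<in> T \<Longrightarrow> Rinv x \<in> carrier_mat d d"
  using h_T by (simp add: Rinv_def)

lemma R_Rinv: "x \<in> T \<Longrightarrow> R x * Rinv x = 1\<^sub>m d"
proof -
  assume x: "x \<in> T"
  have "R x * Rinv x = map_mat \<sigma> (P (h \<otimes> x \<otimes> inv h) * Pinv (h \<otimes> x \<otimes> inv h))"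
    unfolding R_eq Rinv_def using h_T[OF x] P_Qab Pinv_Qab by (intro map_mat_Gal_mult[OF \<sigma>, of _ d d _ d, symmetric]) auto
  then show ?thesis by (simp add: P_Pinv[OF h_T[OF x]] map_mat_Gal_one[OF \<sigma>])
qed

lemma str_Rinv: "x \<in> T \<Longrightarrow> mat_trace (Rinv x) = \<sigma> (str (h \<otimes> x \<otimes> inv h))"
  unfolding Rinv_def str_def using h_T Pinv_Qab by (intro trace_map_mat_Gal[OF \<sigma>, of _ d]) auto

text \<open>Up to the factor \<open>card N\<close>, a matrix commuting with \<open>P\<close> on
  \<open>N\<close> is its own average, and \<open>schur_rep\<close> makes averages scalar.\<close>

lemma commuting_scalar:
  assumes C: "C \<in> carrier_mat d d" and comm: "\<And>n. n \<in> N \<Longrightarrow> P n * C = C * P n"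
  obtains c where "C = c \<cdot>\<^sub>m 1\<^sub>m d"
proof -
  have "msum d (\<lambda>g. P g * C * P (inv g)) N = msum d (\<lambda>g. C) N"
  proof (rule msum_cong)
    fix g assume g: "g \<in> N"
    have "P g * C * P (inv g) = C * (P g * P (inv g))"
      using g N_T N_closed C comm[OF g] by (simp add: assoc_mult_mat[of _ d d _ d _ d])
    then show "P g * C * P (inv g) = C" using P_N_inv[OF g] C by simp
  qed
  also have "\<dots> = of_nat (card N) \<cdot>\<^sub>m C"
    using C by (intro eq_matI) (auto simp: msum_def)
  finally have "of_nat (card N) \<cdot>\<^sub>m C = (of_nat (card N) * mat_trace C / of_nat d) \<cdot>\<^sub>m 1\<^sub>m d"
    using sr C by (simp add: schur_rep_def)
  moreover have "C = (1 / of_nat (card N)) \<cdot>\<^sub>m (of_nat (card N) \<cdot>\<^sub>m C)"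
    using cardN_nz by (auto intro!: eq_matI)
  ultimately have "C = (1 / of_nat (card N)) \<cdot>\<^sub>m ((of_nat (card N) * mat_trace C / of_nat d) \<cdot>\<^sub>m 1\<^sub>m d)"
    by simp
  also have "\<dots> = (mat_trace C / of_nat d) \<cdot>\<^sub>m 1\<^sub>m d" using cardN_nz by (auto intro!: eq_matI)
  finally have "C = (mat_trace C / of_nat d) \<cdot>\<^sub>m 1\<^sub>m d" .
  then show ?thesis using that by blast
qed

text \<open>Both \<open>P\<close> and its conjugate afford \<open>\<theta>\<close> on \<open>N\<close>, so after a change of basis they agree
  on \<open>N\<close>; then \<open>P(x)\<^sup>-\<^sup>1 R(x)\<close> commutes with \<open>P(N)\<close> and is scalar.\<close>
lemma mu_exists: "\<exists>\<mu>. is_mu G T N d P h \<sigma> \<mu>"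
proof -
  have "\<theta> \<in> Irr G N" using Irr_eq_irrfun[OF N_sub] irr by simp
  then obtain d0 \<rho> where r: "irreducible_rep G N d0 \<rho>" and th: "\<theta> = char_of N \<rho>" by (auto simp: Irr_def)
  have tr: "mat_trace (\<rho> n) = \<theta> n" if "n \<in> N" for n using that th by (simp add: char_of_def)
  have rP: "is_rep G N d P" using sr by (simp add: schur_rep_def)
  obtain X Y where XY: "d = d0" "X \<in> carrier_mat d d" "Y \<in> carrier_mat d d" "X * Y = 1\<^sub>m d" "Y * X = 1\<^sub>m d"
    "\<And>n. n \<in> N \<Longrightarrow> P n = X * \<rho> n * Y"
    using rep_similar_irreducible[OF r N_sub rP] tr P_trace by metis
  obtain X' Y' where XY': "X' \<in> carrier_mat d d" "Y' \<in> carrier_mat d d" "X' * Y' = 1\<^sub>m d" "Y' * X' = 1\<^sub>m d"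
    "\<And>n. n \<in> N \<Longrightarrow> R n = X' * \<rho> n * Y'"
    using rep_similar_irreducible[OF r N_sub R_rep] tr R_trace XY(1) by metis
  have \<rho>c: "\<rho> n \<in> carrier_mat d d" if "n \<in> N" for n using r that XY(1) by (simp add: irreducible_rep_def is_rep_def)
  \<comment> \<open>Both restrictions to \<open>N\<close> are similar to the representation \<rho>
    affording \<theta>; going from one to the other through \<rho> gives the change of basis that
    takes \<open>R\<close> to \<open>P\<close> on \<open>N\<close>.\<close>
  define A where "A = X * Y'"
  define B where "B = X' * Y"
  have A: "A \<in> carrier_mat d d" and B: "B \<in> carrier_mat d d" using XY XY' by (auto simp: A_def B_def)
  have AB: "A * B = 1\<^sub>m d"
  proof -
    have "A * B = X * (Y' * X') * Y" unfolding A_def B_def using XY(2,3) XY'(1,2) by (simp add: assoc_mult_mat[of _ d d _ d _ d])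
    then show ?thesis using XY XY' by simp
  qed
  have BA: "B * A = 1\<^sub>m d" by (rule mat_mult_left_right_inverse[OF A B AB])
  have RP: "A * R n * B = P n" if n: "n \<in> N" for n
  proof -
    have "A * R n * B = X * (Y' * X') * \<rho> n * (Y' * X') * Y"
      unfolding A_def B_def XY'(5)[OF n] using XY(2,3) XY'(1,2) \<rho>c[OF n] by (simp add: assoc_mult_mat[of _ d d _ d _ d])
    also have "\<dots> = X * \<rho> n * Y"
      unfolding XY'(4) using XY(2,3) \<rho>c[OF n] by (simp add: right_mult_one_mat[of _ d d])
    finally show ?thesis using XY(6)[OF n] by simp
  qed
  let ?R = "\<lambda>x. A * R x * B"
  have Rc: "?R x \<in> carrier_mat d d" if "x \<in> T" for x using that A B by simp
  have Rmult: "?R x * ?R y = A * (R x * R y) * B" if "x \<in> T" "y \<in> T" for x y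
  proof -
    have "?R x * ?R y = A * R x * (B * A) * R y * B"
      using that A B by (simp add: assoc_mult_mat[of _ d d _ d _ d])
    also have "\<dots> = A * (R x * R y) * B"
      unfolding BA using that A B by (simp add: right_mult_one_mat[of _ d d] assoc_mult_mat[of _ d d _ d _ d])
    finally show ?thesis .
  qed
  have "\<exists>c. Pinv x * ?R x = c \<cdot>\<^sub>m 1\<^sub>m d" if x: "x \<in> T" for x
  proof -
    have "P n * (Pinv x * ?R x) = Pinv x * ?R x * P n" if n: "n \<in> N" for n
    proof -
      \<comment> \<open>\<open>P x\<close> and \<open>?R x\<close> both intertwine
        \<open>P n\<close> with \<open>P n'\<close>, so \<open>Pinv x * ?R x\<close> commutes with
        \<open>P n\<close>.\<close>
      obtain n' where n': "n' \<in> N" "x \<otimes> n = n' \<otimes> x" using move_right[OF x n] by blast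
      have c: "P n \<in> carrier_mat d d" "P n' \<in> carrier_mat d d" using n n' N_T by auto
      have PP: "P x * P n = P n' * P x"
        using P_N_right[OF n x] P_N_left[OF n'(1) x] n'(2) by simp
      have "P n * Pinv x = Pinv x * P x * (P n * Pinv x)" using x c by (simp add: Pinv_P left_mult_one_mat[of _ d d])
      also have "\<dots> = Pinv x * (P x * P n) * Pinv x" using x c by (simp add: assoc_mult_mat[of _ d d _ d _ d])
      also have "\<dots> = Pinv x * P n' * (P x * Pinv x)" unfolding PP using x c by (simp add: assoc_mult_mat[of _ d d _ d _ d])
      also have "\<dots> = Pinv x * P n'" unfolding P_Pinv[OF x] using x c by (simp add: right_mult_one_mat[of _ d d])
      finally have 1: "P n * Pinv x = Pinv x * P n'" .
      have 2: "?R x * P n = P n' * ?R x"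
      proof -
        have "?R x * P n = A * (R x * R n) * B" unfolding RP[OF n, symmetric] by (rule Rmult[OF x N_T[OF n]])
        also have "R x * R n = R n' * R x" using R_N_right[OF n x] R_N_left[OF n'(1) x] n'(2) by simp
        also have "A * (R n' * R x) * B = P n' * ?R x"
          unfolding RP[OF n'(1), symmetric] by (rule Rmult[OF N_T[OF n'(1)] x, symmetric])
        finally show ?thesis .
      qed
      have "P n * (Pinv x * ?R x) = P n * Pinv x * ?R x"
        by (rule assoc_mult_mat[symmetric, of _ d d _ d _ d]) (use x c Rc in auto)
      also have "\<dots> = Pinv x * (P n' * ?R x)"
        unfolding 1 by (rule assoc_mult_mat[of _ d d _ d _ d]) (use x c Rc in auto)
      also have "\<dots> = Pinv x * ?R x * P n"
        unfolding 2[symmetric] by (rule assoc_mult_mat[symmetric, of _ d d _ d _ d]) (use x c Rc in auto)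
      finally show ?thesis .
    qed
    then show ?thesis using commuting_scalar[of "Pinv x * ?R x"] x Rc by (metis Pinv_carrier sq_mult_carrier)
  qed
  then obtain \<mu> where mu: "\<And>x. x \<in> T \<Longrightarrow> Pinv x * ?R x = \<mu> x \<cdot>\<^sub>m 1\<^sub>m d" by metis
  have R_mu: "R x = \<mu> x \<cdot>\<^sub>m (B * P x * A)" if x: "x \<in> T" for x
  proof -
    have "?R x = P x * Pinv x * ?R x" unfolding P_Pinv[OF x] by (rule left_mult_one_mat[OF Rc[OF x], symmetric])
    also have "\<dots> = P x * (Pinv x * ?R x)" by (rule assoc_mult_mat[of _ d d _ d _ d]) (use x Rc in auto)
    also have "\<dots> = \<mu> x \<cdot>\<^sub>m P x" unfolding mu[OF x] using x by (simp add: mult_smult_distrib[of _ d d _ d] right_mult_one_mat[of _ d d])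
    finally have "B * ?R x * A = B * (\<mu> x \<cdot>\<^sub>m P x) * A" by simp
    also have "\<dots> = \<mu> x \<cdot>\<^sub>m (B * P x * A)"
      using x A B by (simp add: mult_smult_distrib[of _ d d _ d] mult_smult_assoc_mat[of _ d d _ d])
    also have "B * ?R x * A = (B * A) * R x * (B * A)"
      using x A B by (simp add: assoc_mult_mat[of _ d d _ d _ d])
    finally show ?thesis unfolding BA using x by (simp add: left_mult_one_mat[of _ d d] right_mult_one_mat[of _ d d])
  qed
  note BPA = P_Pinv_conj[OF A B AB BA]
  have cancel: "c = c'" if x: "x \<in> T" and eq: "c \<cdot>\<^sub>m (B * P x * A) = c' \<cdot>\<^sub>m (B * P x * A)" for x c c'
    by (rule smult_cancel[OF _ _ BPA[OF x] d_pos eq]) (use x A B in auto)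
  have "is_mu G T N d P h \<sigma> \<mu>"
    unfolding is_mu_def
  proof (intro conjI ballI)
    show "\<mu> y \<noteq> 0" if y: "y \<in> T" for y
    proof
      assume "\<mu> y = 0"
      then have "R y = 0\<^sub>m d d" using R_mu[OF y] A B y by (auto intro!: eq_matI)
      then have "(1\<^sub>m d :: complex mat) = 0\<^sub>m d d * Rinv y" using R_Rinv[OF y] by simp
      then have "(1\<^sub>m d :: complex mat) = 0\<^sub>m d d" using y by (simp add: left_mult_zero_mat[of _ d d])
      then have "(1\<^sub>m d :: complex mat) $$ (0,0) = 0" using d_pos by simp
      then show False using d_pos by simp
    qed
    show "\<mu> (n \<otimes> y) = \<mu> y" if y: "y \<in> T" and n: "n \<in> N" for y n
    proof (rule cancel)
      have nT: "n \<in> T" by (rule N_T[OF n])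
      show ny: "n \<otimes> y \<in> T" using nT y by simp
      have "\<mu> (n \<otimes> y) \<cdot>\<^sub>m (B * P (n \<otimes> y) * A) = R n * R y" using R_mu[OF ny] R_N_left[OF n y] by simp
      also have "R n = B * P n * A"
      proof -
        have "B * P n * A = (B * A) * R n * (B * A)"
          unfolding RP[OF n, symmetric] using nT A B by (simp add: assoc_mult_mat[of _ d d _ d _ d])
        then show ?thesis unfolding BA using nT by (simp add: left_mult_one_mat[of _ d d] right_mult_one_mat[of _ d d])
      qed
      also have "B * P n * A * R y = \<mu> y \<cdot>\<^sub>m (B * P n * A * (B * P y * A))"
        unfolding R_mu[OF y] using nT y A B by (intro mult_smult_distrib[of _ d d _ d]) auto
      also have "B * P n * A * (B * P y * A) = B * P n * (A * B) * P y * A"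
        using nT y A B by (simp add: assoc_mult_mat[of _ d d _ d _ d])
      also have "\<dots> = B * P (n \<otimes> y) * A"
        unfolding AB P_N_left[OF n y] using nT y A B by (simp add: right_mult_one_mat[of _ d d] assoc_mult_mat[of _ d d _ d _ d])
      finally show "\<mu> (n \<otimes> y) \<cdot>\<^sub>m (B * P (n \<otimes> y) * A) = \<mu> y \<cdot>\<^sub>m (B * P (n \<otimes> y) * A)" .
    qed
    have "\<mu> \<one> \<cdot>\<^sub>m (B * P \<one> * A) = 1 \<cdot>\<^sub>m (B * P \<one> * A)"
      using R_mu[OF T_closed(3)] R_rep A B BA by (simp add: P_one is_rep_def right_mult_one_mat[of _ d d]) (auto intro!: eq_matI)
    then show "\<mu> \<one> = 1" by (rule cancel[OF T_closed(3)])
    show "sim_mu T d (proj_conj G h \<sigma> P) \<mu> P"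
      unfolding sim_mu_def R_def[symmetric] using A B AB BA R_mu by blast
  qed
  then show ?thesis by blast
qed

text \<open>Since \<open>R x\<close> is \<open>\<mu> x\<close> times a conjugate of
  \<open>P x\<close>, its inverse is \<open>1 / \<mu> x\<close> times a conjugate of
  \<open>Pinv x\<close>; the trace of the same inverse is also the Galois image of
  \<open>str\<close>. The identity holds for every \<mu> with \<open>is_mu\<close>.\<close>

lemma str_mu:
  assumes mu: "is_mu G T N d P h \<sigma> \<mu>" and x: "x \<in> T"
  shows "str x = \<mu> x * \<sigma> (str (h \<otimes> x \<otimes> inv h))"
proof -
  obtain A B where AB: "A \<in> carrier_mat d d" "B \<in> carrier_mat d d" "A * B = 1\<^sub>m d" "B * A = 1\<^sub>m d"
    and R: "\<And>x. x \<in> T \<Longrightarrow> R x = \<mu> x \<cdot>\<^sub>m (B * P x * A)"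
    using mu unfolding is_mu_def sim_mu_def R_def by blast
  have nz: "\<mu> x \<noteq> 0" using mu x by (simp add: is_mu_def)
  note BPA = P_Pinv_conj[OF AB x]
  have c: "B * P x * A \<in> carrier_mat d d" "B * Pinv x * A \<in> carrier_mat d d" using x AB by auto
  have "Rinv x = (1 / \<mu> x) \<cdot>\<^sub>m (B * Pinv x * A)"
  proof (rule mat_inv_unique[OF _ _ _ R_Rinv[OF x]])
    show "R x * ((1 / \<mu> x) \<cdot>\<^sub>m (B * Pinv x * A)) = 1\<^sub>m d"
      unfolding R[OF x] using c BPA nz
      by (simp add: mult_smult_assoc_mat[of _ d d _ d] mult_smult_distrib[of _ d d _ d]) (auto intro!: eq_matI)
  qed (use x c in auto)
  then have "\<sigma> (str (h \<otimes> x \<otimes> inv h)) = 1 / \<mu> x * mat_trace (B * Pinv x * A)"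
    using str_Rinv[OF x] c by (simp add: mat_trace_smult[of _ d])
  also have "mat_trace (B * Pinv x * A) = str x"
    unfolding str_def using x AB by (intro mat_trace_conj[of _ d]) auto
  finally show ?thesis using nz by simp
qed

lemma e_Qab: "e x \<in> Qab"
  unfolding e_def \<theta>_one by (rule Qab_closed(4)[OF Qab_divide[OF Qab_of_nat Qab_of_nat] \<theta>_Qab])

lemma e_fixed: "\<sigma> \<circ> cj h e = e"
proof
  fix x
  have q: "\<theta> \<one> / of_nat (card N) \<in> Qab" by (intro Qab_divide \<theta>_Qab Qab_of_nat)
  have "\<sigma> (\<theta> \<one> / of_nat (card N)) = \<theta> \<one> / of_nat (card N)"
    by (simp add: \<theta>_one Gal_divide[OF \<sigma>] Gal_of_nat[OF \<sigma>] Qab_of_nat)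
  then have "(\<sigma> \<circ> cj h e) x = \<theta> \<one> / of_nat (card N) * (\<sigma> \<circ> cj h \<theta>) x"
    unfolding e_def cj_scale comp_apply using Gal_mult[OF \<sigma> q cj_Qab[OF \<theta>_Qab]] by simp
  then show "(\<sigma> \<circ> cj h e) x = e x" by (simp add: fixed e_def)
qed

text \<open>The pair fixes \<open>e\<close>, and \<chi> is invariant under conjugation, so
  multiplication by \<open>e\<close> commutes with the action of the pair. In the average over
  \<open>N\<close> the scalar from \<open>str_mu\<close> is constant, and \<open>n\<close> is
  replaced by its conjugate under \<open>h\<close>.\<close>

lemma qchar_Gal:
  assumes mu: "is_mu G T N d P h \<sigma> \<mu>" and chi: "irrfun (carrier G) \<chi>" and x: "x \<in> T"
  shows "qchar (\<sigma> \<circ> \<chi>) x = \<mu> x * \<sigma> (qchar \<chi> (h \<otimes> x \<otimes> inv h))"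
proof -
  let ?f = "conv \<chi> e" and ?y = "h \<otimes> x \<otimes> inv h"
  have xc: "x \<in> carrier G" by (rule T_carrier[OF x])
  have VX: "\<chi> z \<in> Qab" for z by (rule irrfun_values(1)[OF subgroup_self chi])
  have fQ: "?f z \<in> Qab" for z by (rule conv_Qab[OF VX e_Qab])
  have sQ: "str z \<in> Qab" if "z \<in> T" for z
    unfolding str_def mat_trace_def carrier_matD(1)[OF Pinv_carrier[OF that]] using that Pinv_Qab
    by (intro Qab_sum) auto
  have "conv (\<sigma> \<circ> \<chi>) e = conv (\<sigma> \<circ> \<chi>) (\<sigma> \<circ> cj h e)" by (simp add: e_fixed)
  also have "\<dots> = \<sigma> \<circ> conv \<chi> (cj h e)" by (rule Gal_conv[OF \<sigma> VX cj_Qab[OF e_Qab], symmetric])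
  also have "conv \<chi> (cj h e) = cj h ?f"
    using cj_conv[OF h, of \<chi> e] ZC_cj[OF irrfunD(1)[OF chi] subgroup_self h] by simp
  finally have conv_eq: "conv (\<sigma> \<circ> \<chi>) e = \<sigma> \<circ> cj h ?f" .
  have f': "conv (\<sigma> \<circ> \<chi>) e z = \<sigma> (?f (h \<otimes> z \<otimes> inv h))" if "z \<in> carrier G" for z
    using that unfolding conv_eq by (simp add: cj_def)
  have hn: "h \<otimes> (x \<otimes> n) \<otimes> inv h = ?y \<otimes> (h \<otimes> n \<otimes> inv h)" if "n \<in> N" for n
    using h_mult[OF xc N_carrier[OF that]] .
  have muN: "\<mu> (x \<otimes> n) = \<mu> x" if "n \<in> N" for n
    using mu by (intro coset_right[OF _ x that]) (auto simp: is_mu_def)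
  have "(\<Sum>n\<in>N. conv (\<sigma> \<circ> \<chi>) e (x \<otimes> n) * str (x \<otimes> n)) =
    (\<Sum>n\<in>N. \<mu> x * \<sigma> (?f (?y \<otimes> (h \<otimes> n \<otimes> inv h)) * str (?y \<otimes> (h \<otimes> n \<otimes> inv h))))"
  proof (rule sum.cong[OF refl])
    fix n assume n: "n \<in> N"
    have xn: "x \<otimes> n \<in> T" "x \<otimes> n \<in> carrier G" using x N_T[OF n] T_carrier by auto
    have "h \<otimes> (x \<otimes> n) \<otimes> inv h \<in> T" by (rule h_T[OF xn(1)])
    then show "conv (\<sigma> \<circ> \<chi>) e (x \<otimes> n) * str (x \<otimes> n) =
        \<mu> x * \<sigma> (?f (?y \<otimes> (h \<otimes> n \<otimes> inv h)) * str (?y \<otimes> (h \<otimes> n \<otimes> inv h)))"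
      unfolding f'[OF xn(2)] str_mu[OF mu xn(1)] muN[OF n] hn[OF n]
      using Gal_mult[OF \<sigma> fQ sQ] by simp
  qed
  also have "\<dots> = \<mu> x * (\<Sum>n\<in>N. \<sigma> (?f (?y \<otimes> n) * str (?y \<otimes> n)))"
    using sum.reindex_bij_betw[OF N_conj_bij[OF h], of "\<lambda>n. \<sigma> (?f (?y \<otimes> n) * str (?y \<otimes> n))"] by (simp flip: sum_distrib_left)
  also have "(\<Sum>n\<in>N. \<sigma> (?f (?y \<otimes> n) * str (?y \<otimes> n))) = \<sigma> (\<Sum>n\<in>N. ?f (?y \<otimes> n) * str (?y \<otimes> n))"
    using fQ sQ h_T[OF x] N_T by (intro Gal_sum[OF \<sigma>, symmetric] Qab_closed) auto
  finally have main: "(\<Sum>n\<in>N. conv (\<sigma> \<circ> \<chi>) e (x \<otimes> n) * str (x \<otimes> n)) =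
    \<mu> x * \<sigma> (\<Sum>n\<in>N. ?f (?y \<otimes> n) * str (?y \<otimes> n))" .
  have SQ: "(\<Sum>n\<in>N. ?f (?y \<otimes> n) * str (?y \<otimes> n)) \<in> Qab"
    using fQ sQ h_T[OF x] N_T by (intro Qab_sum Qab_closed) auto
  show ?thesis
    unfolding qchar_def qf_def using x h_T[OF x] main
    by (simp add: Gal_divide[OF \<sigma> SQ Qab_of_nat] Gal_of_nat[OF \<sigma>])
qed

end

section \<open>The character correspondence\<close>

text \<open>The data of \<open>H\<close> form an instance of \<open>char_data\<close> for the group
  with carrier \<open>H\<close>, so all results for \<open>G\<close> hold for them as well. Twisted
  algebras and projective conjugates involve only products and inverses inside \<open>H\<close> and
  agree in both groups.\<close>

locale character_correspondence = restricted_char_data G N \<theta> T d P \<alpha> S M \<alpha>'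
  for G (structure) and N \<theta> T d P \<alpha> S M \<alpha>' +
  fixes p :: nat and H :: "'a set" and \<phi> :: "'a \<Rightarrow> complex" and d' :: nat and P' :: "'a \<Rightarrow> complex mat"
  assumes p: "prime p" and H: "subgroup H G" and B: "char_data (G\<lparr>carrier := H\<rparr>) M \<phi> S d' P' \<alpha>'"
    and G_NH: "N <#> H = carrier G" and N_H: "N \<inter> H = M" and S_eq: "S = stab G H N \<theta>"
    and pair: "pair_stab p G H N \<theta> = pair_stab p G H M \<phi>"
    and entries: "entries_in_Qab T d P" "entries_in_Qab S d' P'"
    and roots: "root_of_unity_factor_set T \<alpha>" "root_of_unity_factor_set S \<alpha>'"
    and mu_eq: "\<And>x \<sigma> \<mu> \<mu>' y. (x, \<sigma>) \<in> pair_stab p G H N \<theta> \<Longrightarrow> is_mu G T N d P x \<sigma> \<mu> \<Longrightarrow>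
      is_mu G S M d' P' x \<sigma> \<mu>' \<Longrightarrow> y \<in> S \<Longrightarrow> \<mu> y = \<mu>' y"
begin

sublocale B: char_data "G\<lparr>carrier := H\<rparr>" M \<phi> S d' P' \<alpha>'
  by (rule B)

lemma inv_H: "h \<in> H \<Longrightarrow> inv\<^bsub>G\<lparr>carrier := H\<rparr>\<^esub> h = inv h"
  by (rule m_inv_consistent[OF H])

lemma H_carrier: "h \<in> H \<Longrightarrow> h \<in> carrier G"
  by (rule subgroup.mem_carrier[OF H])

lemma S_H: "x \<in> S \<Longrightarrow> x \<in> H"
  by (simp add: S_eq stab_def)

lemma twirr_H: "twirr (G\<lparr>carrier := H\<rparr>) S M \<alpha>' = twirr G S M \<alpha>'"
proof -
  have "twcls (G\<lparr>carrier := H\<rparr>) S M \<alpha>' = twcls G S M \<alpha>'"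
    by (simp add: twcls_def inv_H S_H cong: ball_cong)
  moreover have "tw (G\<lparr>carrier := H\<rparr>) S \<alpha>' = tw G S \<alpha>'"
    by (intro ext) (simp add: tw_def inv_H S_H cong: sum.cong)
  ultimately show ?thesis by (simp add: twirr_def)
qed

section \<open>Matching the characters above \<theta> and \<phi>\<close>

definition corr :: "('a \<Rightarrow> complex) \<Rightarrow> 'a \<Rightarrow> complex" where
  "corr \<chi> = inv_into B.over B.qchar (rst (qchar \<chi>))"

lemma corr_bij: "bij_betw corr over B.over"
proof -
  have "bij_betw (inv_into B.over B.qchar) (twirr G S M \<alpha>') B.over"
    using bij_betw_inv_into[OF B.qchar_bij] by (simp add: twirr_H)
  then have "bij_betw (inv_into B.over B.qchar \<circ> (rst \<circ> qchar)) over B.over"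
    using bij_betw_trans[OF bij_betw_trans[OF qchar_bij rst_bij]] by blast
  then show ?thesis by (simp add: corr_def comp_def cong: bij_betw_cong)
qed

lemma corr_in: "\<chi> \<in> over \<Longrightarrow> corr \<chi> \<in> B.over"
  using corr_bij by (auto simp: bij_betw_def)

lemma qchar_corr:
  assumes "\<chi> \<in> over"
  shows "B.qchar (corr \<chi>) = rst (qchar \<chi>)"
proof -
  have "qchar \<chi> \<in> twirr G T N \<alpha>" using qchar_bij assms by (auto simp: bij_betw_def)
  then have "rst (qchar \<chi>) \<in> twirr G S M \<alpha>'" using rst_bij by (auto simp: bij_betw_def)
  then show ?thesis
    unfolding corr_def using bij_betw_inv_into_right[OF B.qchar_bij] by (simp add: twirr_H)
qed

lemma corr_unique:
  assumes "\<chi> \<in> over" "\<psi> \<in> B.over" "B.qchar \<psi> = rst (qchar \<chi>)"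
  shows "corr \<chi> = \<psi>"
proof -
  have "inj_on B.qchar B.over" using B.qchar_bij by (simp add: bij_betw_def)
  then show ?thesis
    using assms qchar_corr corr_in by (metis inj_onD)
qed

lemma pair_stab_N: "\<sigma> \<in> Hgal p \<Longrightarrow> (h, \<sigma>) \<in> pair_stab p G H N \<theta> \<longleftrightarrow> h \<in> H \<and> \<sigma> \<circ> cj h \<theta> = \<theta>"
  using conj_char_cj[OF Hgal_Gal _ irrfunD(1)[OF irr]] H_carrier by (auto simp: pair_stab_def)

lemma conj_char_H: "h \<in> H \<Longrightarrow> conj_char (G\<lparr>carrier := H\<rparr>) K h \<sigma> f = conj_char G K h \<sigma> f"
  by (simp add: conj_char_def inv_H cong: if_cong)

lemma pair_stab_M: "\<sigma> \<in> Hgal p \<Longrightarrow> (h, \<sigma>) \<in> pair_stab p G H M \<phi> \<longleftrightarrow> h \<in> H \<and> \<sigma> \<circ> B.cj h \<phi> = \<phi>"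
  using B.conj_char_cj[OF Hgal_Gal _ B.irrfunD(1)[OF B.irr]] conj_char_H by (auto simp: pair_stab_def)

text \<open>\<open>G\<close> is the product of \<open>N\<close> and \<open>H\<close>, and
  \<open>N\<close> fixes \<theta>, so the conjugating element may be taken from
  \<open>H\<close>.\<close>

lemma fixed_by_H:
  assumes s: "\<sigma> \<in> Hgal p"
  shows "(\<exists>g\<in>carrier G. \<sigma> \<circ> cj g \<theta> = \<theta>) \<longleftrightarrow> (\<exists>h. (h, \<sigma>) \<in> pair_stab p G H N \<theta>)"
proof
  assume "\<exists>g\<in>carrier G. \<sigma> \<circ> cj g \<theta> = \<theta>"
  then obtain g where g: "g \<in> carrier G" "\<sigma> \<circ> cj g \<theta> = \<theta>" by blast
  then obtain n h where nh: "n \<in> N" "h \<in> H" "g = n \<otimes> h" using G_NH by (force simp: set_mult_def)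
  have c: "n \<in> carrier G" "h \<in> carrier G" using nh N_carrier H_carrier by auto
  have "cj g \<theta> = cj h (cj n \<theta>)" using c nh(3) by (simp add: cj_cj)
  also have "cj n \<theta> = \<theta>" by (rule ZC_cj[OF irrfunD(1)[OF irr] N_sub nh(1)])
  finally have "\<sigma> \<circ> cj h \<theta> = \<theta>" using g(2) by simp
  then show "\<exists>h. (h, \<sigma>) \<in> pair_stab p G H N \<theta>" using pair_stab_N[OF s] nh(2) by blast
next
  assume "\<exists>h. (h, \<sigma>) \<in> pair_stab p G H N \<theta>"
  then show "\<exists>g\<in>carrier G. \<sigma> \<circ> cj g \<theta> = \<theta>" using pair_stab_N[OF s] H_carrier by blast
qed

text \<open>Here the equality of the pair stabilisers enters: it turns the criterion of
  \<open>over_Gal_iff\<close> for \<theta> into the one for \<phi>.\<close>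

lemma corr_Gal_iff:
  assumes s: "\<sigma> \<in> Hgal p" and chi: "\<chi> \<in> over"
  shows "\<sigma> \<circ> \<chi> \<in> over \<longleftrightarrow> \<sigma> \<circ> corr \<chi> \<in> B.over"
proof -
  have "\<sigma> \<circ> corr \<chi> \<in> B.over \<longleftrightarrow> (\<exists>h\<in>H. \<sigma> \<circ> B.cj h \<phi> = \<phi>)"
    using B.over_Gal_iff[OF Hgal_Gal[OF s] corr_in[OF chi]] by simp
  also have "\<dots> \<longleftrightarrow> (\<exists>h. (h, \<sigma>) \<in> pair_stab p G H N \<theta>)"
    unfolding pair using pair_stab_M[OF s] by blast
  also have "\<dots> \<longleftrightarrow> \<sigma> \<circ> \<chi> \<in> over"
    using over_Gal_iff[OF Hgal_Gal[OF s] chi] fixed_by_H[OF s] by simp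
  finally show ?thesis by simp
qed

text \<open>One element \<open>h\<close> serves both groups, since the pair fixes \<theta> and
  \<phi>. By \<open>qchar_Gal\<close> both twisted functions then change in the same way, because
  the two scalars agree on \<open>S\<close>, and a character of \<open>H\<close> above \<phi> is
  determined by its twisted function.\<close>

lemma corr_Gal:
  assumes s: "\<sigma> \<in> Hgal p" and chi: "\<chi> \<in> over" and schi: "\<sigma> \<circ> \<chi> \<in> over"
  shows "corr (\<sigma> \<circ> \<chi>) = \<sigma> \<circ> corr \<chi>"
proof (rule corr_unique[OF schi])
  have sG: "\<sigma> \<in> GalQab" by (rule Hgal_Gal[OF s])
  show "\<sigma> \<circ> corr \<chi> \<in> B.over" using corr_Gal_iff[OF s chi] schi by simp
  obtain h where h: "(h, \<sigma>) \<in> pair_stab p G H N \<theta>"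
    using over_Gal_iff[OF sG chi] schi fixed_by_H[OF s] by blast
  have hH: "h \<in> H" and fA: "\<sigma> \<circ> cj h \<theta> = \<theta>" using pair_stab_N[OF s] h by auto
  have fB: "\<sigma> \<circ> B.cj h \<phi> = \<phi>" using pair_stab_M[OF s] h unfolding pair by auto
  interpret A: galois_char_data G N \<theta> T d P \<alpha> h \<sigma>
    by unfold_locales (use H_carrier[OF hH] sG fA entries roots in auto)
  interpret C: galois_char_data "G\<lparr>carrier := H\<rparr>" M \<phi> S d' P' \<alpha>' h \<sigma>
    by unfold_locales (use hH sG fB entries roots in auto)
  obtain \<mu> where mu: "is_mu G T N d P h \<sigma> \<mu>" using A.mu_exists by blast
  obtain \<mu>' where mu': "is_mu (G\<lparr>carrier := H\<rparr>) S M d' P' h \<sigma> \<mu>'" using C.mu_exists by blast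
  have "proj_conj (G\<lparr>carrier := H\<rparr>) h \<sigma> P' = proj_conj G h \<sigma> P'"
    by (simp add: proj_conj_def inv_H[OF hH])
  then have mu'G: "is_mu G S M d' P' h \<sigma> \<mu>'" using mu' by (simp add: is_mu_def)
  have irrA: "irrfun (carrier G) \<chi>" using chi by (simp add: over_def)
  have irrB: "B.irrfun (carrier (G\<lparr>carrier := H\<rparr>)) (corr \<chi>)" using corr_in[OF chi] by (simp add: B.over_def)
  show "B.qchar (\<sigma> \<circ> corr \<chi>) = rst (qchar (\<sigma> \<circ> \<chi>))"
  proof
    fix x show "B.qchar (\<sigma> \<circ> corr \<chi>) x = rst (qchar (\<sigma> \<circ> \<chi>)) x"
    proof (cases "x \<in> S")
      case x: True
      \<comment> \<open>\<open>h\<close> normalises \<open>S\<close>, so the restriction to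
        \<open>S\<close> keeps the value at the conjugate.\<close>
      have hx: "h \<otimes> x \<otimes> inv h \<in> S" using C.h_T[OF x] by (simp add: inv_H[OF hH])
      have "B.qchar (\<sigma> \<circ> corr \<chi>) x = \<mu>' x * \<sigma> (rst (qchar \<chi>) (h \<otimes> x \<otimes> inv h))"
        using C.qchar_Gal[OF mu' irrB x] by (simp add: inv_H[OF hH] qchar_corr[OF chi])
      also have "\<dots> = \<mu> x * \<sigma> (qchar \<chi> (h \<otimes> x \<otimes> inv h))"
        using mu_eq[OF h mu mu'G x] hx by (simp add: rst_def)
      also have "\<dots> = rst (qchar (\<sigma> \<circ> \<chi>)) x"
        using A.qchar_Gal[OF mu irrA] x S_T by (auto simp: rst_def)
      finally show ?thesis .
    next
      case False
      then show ?thesis by (simp add: rst_def B.qchar_def B.qf_def)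
    qed
  qed
qed

text \<open>\<open>G\<close> is the product of \<open>N\<close> and \<open>H\<close>,
  \<open>T\<close> the product of \<open>N\<close> and \<open>S\<close>, and both intersections are
  \<open>M\<close>; the ratio \<open>card N / card M\<close> occurs in both orders and
  cancels.\<close>

lemma card_G_H: "of_nat (card (carrier G)) / of_nat (card T) = (of_nat (card H) / of_nat (card S) :: complex)"
proof -
  have "of_nat (card (N \<inter> H)) * (\<Sum>x\<in>carrier G. 1) = of_nat (card N) * (\<Sum>x\<in>H. 1 :: complex)"
  proof (rule sum_subgroup_product[OF N_sub H])
    show "carrier G = {n \<otimes> s |n s. n \<in> N \<and> s \<in> H}"
      unfolding G_NH[symmetric] by (auto simp: set_mult_def)
  qed simp
  then have "of_nat (card M) * of_nat (card (carrier G)) = of_nat (card N) * (of_nat (card H) :: complex)"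
    by (simp add: N_H)
  then have G: "of_nat (card (carrier G)) = of_nat (card N) / of_nat (card M) * (of_nat (card H) :: complex)"
    using cardM_nz by (simp add: field_simps)
  show ?thesis unfolding card_T_S G using cardM_nz cardN_nz by simp
qed

lemma corr_one: "\<chi> \<in> over \<Longrightarrow> \<chi> \<one> / \<theta> \<one> = corr \<chi> \<one> / \<phi> \<one>"
  using qchar_one[of \<chi>] B.qchar_one[OF corr_in, of \<chi>] card_G_H by (simp add: qchar_corr rst_def)

theorem equivariant_correspondence:
  "\<exists>\<tau>. bij_betw \<tau> (Irr_over_orbit p G (carrier G) N \<theta>) (Irr_over_orbit p G H M \<phi>) \<and>
    (\<forall>\<chi>\<in>Irr_over_orbit p G (carrier G) N \<theta>. \<forall>\<sigma>\<in>Hgal p.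
       \<tau> (conj_char G (carrier G) \<one> \<sigma> \<chi>) = conj_char G H \<one> \<sigma> (\<tau> \<chi>)) \<and>
    (\<forall>\<chi>\<in>Irr_over_orbit p G (carrier G) N \<theta>. \<chi> \<one> / \<theta> \<one> = \<tau> \<chi> \<one> / \<phi> \<one>)"
proof -
  have oneH: "\<one> \<in> H" by (rule subgroup.one_closed[OF H])
  have XA: "Irr_over_orbit p G (carrier G) N \<theta> = (\<Union>\<sigma>\<in>Hgal p. (\<circ>) \<sigma> ` over)"
    by (rule Irr_over_orbit_eq[OF p])
  \<comment> \<open>Of the operations in this definition only the inverse in
    \<open>conj_char\<close> depends on the carrier of the group.\<close>
  have "Irr_over_orbit p (G\<lparr>carrier := H\<rparr>) H M \<phi> = Irr_over_orbit p G H M \<phi>"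
    using conj_char_H[OF oneH]
    by (simp add: Irr_over_orbit_def Irr_over_def Irr_def irreducible_rep_def is_rep_def)
  then have XB: "Irr_over_orbit p G H M \<phi> = (\<Union>\<sigma>\<in>Hgal p. (\<circ>) \<sigma> ` B.over)"
    using B.Irr_over_orbit_eq[OF p] by simp
  have inv: "\<exists>\<tau>\<in>Hgal p. \<sigma> \<circ> \<tau> = id \<and> \<tau> \<circ> \<sigma> = id" if "\<sigma> \<in> Hgal p" for \<sigma>
    using Hgal_inverse[OF p that] by blast
  obtain \<tau> where bij: "bij_betw \<tau> (\<Union>\<sigma>\<in>Hgal p. (\<circ>) \<sigma> ` over) (\<Union>\<sigma>\<in>Hgal p. (\<circ>) \<sigma> ` B.over)"
    and \<tau>: "\<And>\<sigma> a. \<sigma> \<in> Hgal p \<Longrightarrow> a \<in> over \<Longrightarrow> \<tau> (\<sigma> \<circ> a) = \<sigma> \<circ> corr a"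
  proof (rule extend_equivariantly[of "Hgal p" corr over B.over])
    show "\<sigma> \<circ> \<rho> \<in> Hgal p" if "\<sigma> \<in> Hgal p" "\<rho> \<in> Hgal p" for \<sigma> \<rho> by (rule Hgal_comp[OF p that])
  qed (use inv corr_bij corr_Gal_iff corr_Gal in blast)+
  have "\<tau> (conj_char G (carrier G) \<one> \<sigma> \<chi>) = conj_char G H \<one> \<sigma> (\<tau> \<chi>) \<and> \<chi> \<one> / \<theta> \<one> = \<tau> \<chi> \<one> / \<phi> \<one>"
    if "\<chi> \<in> Irr_over_orbit p G (carrier G) N \<theta>" and s: "\<sigma> \<in> Hgal p" for \<chi> \<sigma>
  proof -
    \<comment> \<open>Every character in question is a Galois conjugate of some \<open>a\<close>
      above \<theta>. Equivariance thus reduces to composing automorphisms, and the degrees are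
      integers and hence fixed.\<close>
    from that obtain \<rho> a where r: "\<rho> \<in> Hgal p" and a: "a \<in> over" and chi: "\<chi> = \<rho> \<circ> a" unfolding XA by blast
    note sG = Hgal_Gal[OF s] and rG = Hgal_Gal[OF r]
    have ia: "irrfun (carrier G) a" and ib: "B.irrfun (carrier (G\<lparr>carrier := H\<rparr>)) (corr a)"
      using a corr_in[OF a] by (auto simp: over_def B.over_def)
    have "conj_char G (carrier G) \<one> \<sigma> \<chi> = \<sigma> \<circ> \<chi>"
      using irrfunD(1)[OF Gal_irrfun[OF rG subgroup_self ia]] unfolding chi
      by (rule conj_char_one[OF sG subgroup_self])
    moreover have "conj_char (G\<lparr>carrier := H\<rparr>) (carrier (G\<lparr>carrier := H\<rparr>)) \<one>\<^bsub>G\<lparr>carrier := H\<rparr>\<^esub> \<sigma> (\<rho> \<circ> corr a) = \<sigma> \<circ> (\<rho> \<circ> corr a)"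
      using B.irrfunD(1)[OF B.Gal_irrfun[OF rG B.subgroup_self ib]]
      by (rule B.conj_char_one[OF sG B.subgroup_self])
    then have "conj_char G H \<one> \<sigma> (\<rho> \<circ> corr a) = \<sigma> \<circ> (\<rho> \<circ> corr a)"
      using conj_char_H[OF oneH] by simp
    moreover have "\<tau> (\<sigma> \<circ> (\<rho> \<circ> a)) = \<sigma> \<circ> (\<rho> \<circ> corr a)"
      using \<tau>[OF Hgal_comp[OF p s r] a] by (simp add: comp_assoc)
    moreover have "\<chi> \<one> = a \<one>" using Gal_irrfun_one[OF rG subgroup_self ia] chi by simp
    moreover have "\<tau> \<chi> \<one> = corr a \<one>"
      using B.Gal_irrfun_one[OF rG B.subgroup_self ib] \<tau>[OF r a] chi by simp
    ultimately show ?thesis using \<tau>[OF r a] corr_one[OF a] by (simp add: chi)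
  qed
  then show ?thesis using bij Hgal_id[OF p] unfolding XA XB by blast
qed

end

text \<open>The trace of \<open>P\<close> on \<open>N\<close> is that of an irreducible
  representation affording \<theta>, which yields \<open>schur_rep\<close>; factor sets with roots
  of unity as values have no zeros.\<close>

lemma (in fin_group) char_dataI:
  assumes N: "N \<lhd> G" and th: "\<theta> \<in> Irr G N" and assoc: "assoc_proj G (stab G (carrier G) N \<theta>) N \<theta> d P \<alpha>"
    and roots: "root_of_unity_factor_set (stab G (carrier G) N \<theta>) \<alpha>"
  shows "char_data G N \<theta> (stab G (carrier G) N \<theta>) d P \<alpha>"
proof -
  have N_sub: "subgroup N G" using N by (simp add: normal_imp_subgroup)
  have irr: "irrfun N \<theta>" using th Irr_eq_irrfun[OF N_sub] by simp
  interpret C: clifford G N \<theta> "{g \<in> carrier G. cj g \<theta> = \<theta>}"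
    using N irr by (intro clifford.intro clifford_axioms.intro fin_group_axioms) auto
  obtain d0 \<rho> where r: "irreducible_rep G N d0 \<rho>" and chi: "\<theta> = char_of N \<rho>" using th by (auto simp: Irr_def)
  have "schur_rep N d P"
    by (rule schur_rep_if_same_char[OF r N_sub]) (use assoc chi in \<open>auto simp: assoc_proj_def char_of_def\<close>)
  moreover have "\<alpha> x y \<noteq> 0" if xy: "x \<in> stab G (carrier G) N \<theta>" "y \<in> stab G (carrier G) N \<theta>" for x y
  proof
    assume "\<alpha> x y = 0"
    moreover obtain n :: nat where "n > 0" "\<alpha> x y ^ n = 1"
      using roots xy unfolding root_of_unity_factor_set_def root_of_unity_def by blast
    ultimately show False by (simp add: zero_power)
  qed
  ultimately show ?thesis
    using assoc C.clifford_axioms unfolding C.stab_eq_T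
    by (intro char_data.intro char_data_axioms.intro) auto
qed

theorem theorem1p10:
  fixes p :: nat and G :: "('a, 'b) monoid_scheme" and N H M :: "'a set"
    and \<theta> \<phi> :: "'a \<Rightarrow> complex"
  assumes "prime p" and "group G" and "finite (carrier G)"
    and "central_order p G N \<theta> H M \<phi>"
  shows "\<exists>\<tau>. bij_betw \<tau> (Irr_over_orbit p G (carrier G) N \<theta>) (Irr_over_orbit p G H M \<phi>) \<and>
      (\<forall>\<chi>\<in>Irr_over_orbit p G (carrier G) N \<theta>. \<forall>\<sigma>\<in>Hgal p.
          \<tau> (conj_char G (carrier G) \<one>\<^bsub>G\<^esub> \<sigma> \<chi>) = conj_char G H \<one>\<^bsub>G\<^esub> \<sigma> (\<tau> \<chi>)) \<and>
      (\<forall>\<chi>\<in>Irr_over_orbit p G (carrier G) N \<theta>. \<chi> \<one>\<^bsub>G\<^esub> / \<theta> \<one>\<^bsub>G\<^esub> = \<tau> \<chi> \<one>\<^bsub>G\<^esub> / \<phi> \<one>\<^bsub>G\<^esub>)"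
proof -
  interpret fin_group G
    using assms(2,3) by (simp add: fin_group_def fin_group_axioms_def)
  let ?T = "stab G (carrier G) N \<theta>" and ?S = "stab G H M \<phi>" and ?G' = "G\<lparr>carrier := H\<rparr>"
  note co = assms(4)[unfolded central_order_def H_triple_def]
  have N: "N \<lhd> G" and th: "\<theta> \<in> Irr G N" and H: "subgroup H G" and M: "M \<lhd> ?G'" and ph: "\<phi> \<in> Irr G M"
    and NH: "N <#>\<^bsub>G\<^esub> H = carrier G" and N_H: "N \<inter> H = M"
    and pair: "pair_stab p G H N \<theta> = pair_stab p G H M \<phi>"
    using co by auto
  from co obtain d P \<alpha> d' P' \<alpha>' where
    assoc: "assoc_proj G ?T N \<theta> d P \<alpha>" "assoc_proj G ?S M \<phi> d' P' \<alpha>'"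
    and entries: "entries_in_Qab ?T d P" "entries_in_Qab ?S d' P'"
    and roots: "root_of_unity_factor_set ?T \<alpha>" "root_of_unity_factor_set ?S \<alpha>'"
    and al: "\<forall>x\<in>stab G H N \<theta>. \<forall>y\<in>stab G H N \<theta>. \<alpha> x y = \<alpha>' x y"
    and mu: "\<forall>x \<sigma>. (x, \<sigma>) \<in> pair_stab p G H N \<theta> \<longrightarrow> (\<forall>\<mu> \<mu>'. is_mu G ?T N d P x \<sigma> \<mu> \<and>
      is_mu G ?S M d' P' x \<sigma> \<mu>' \<longrightarrow> (\<forall>y\<in>stab G H N \<theta>. \<mu> y = \<mu>' y))"
    by (elim conjE exE) (rule that)
  \<comment> \<open>The component at \<open>id\<close> of the equality of the pair
    stabilisers.\<close>
  have S_eq: "?S = stab G H N \<theta>"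
    using pair Hgal_id[OF assms(1)] by (auto simp: pair_stab_def stab_def set_eq_iff)
  interpret A: char_data G N \<theta> ?T d P \<alpha>
    by (rule char_dataI[OF N th assoc(1) roots(1)])
  have finH: "finite H" by (rule subgroup_finite[OF H])
  interpret G': fin_group ?G'
    using subgroup.subgroup_is_group[OF H assms(2)] finH by (simp add: fin_group_def fin_group_axioms_def)
  have "conj_char ?G' M h id \<phi> = conj_char G M h id \<phi>" if "h \<in> H" for h
    using that by (simp add: conj_char_def m_inv_consistent[OF H] cong: if_cong)
  then have stabH: "stab ?G' H M \<phi> = ?S"
    by (auto simp: stab_def)
  have B: "char_data ?G' M \<phi> ?S d' P' \<alpha>'"
    using G'.char_dataI[OF M, of \<phi> d' P' \<alpha>'] ph assoc(2) roots(2)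
    by (simp add: stabH Irr_def irreducible_rep_def is_rep_def assoc_proj_def proj_rep_def)
  have S_T: "?S = ?T \<inter> H"
    unfolding S_eq using subgroup.subset[OF H] by (auto simp: stab_def)
  have S_sub: "subgroup ?S G" unfolding S_T by (rule subgroups_Inter_pair[OF A.T_sub H])
  have M_eq: "M = N \<inter> ?S" unfolding S_T using N_H A.N_T by blast
  \<comment> \<open>Dedekind's modular law: \<open>N\<close> lies in the stabiliser, so the factor
    from \<open>H\<close> lies in it too.\<close>
  have T_NS: "\<exists>n\<in>N. \<exists>s\<in>?S. x = n \<otimes>\<^bsub>G\<^esub> s" if x: "x \<in> ?T" for x
  proof -
    have "x \<in> N <#>\<^bsub>G\<^esub> H" using A.T_carrier[OF x] NH by simp
    then obtain n h where nh: "n \<in> N" "h \<in> H" "x = n \<otimes>\<^bsub>G\<^esub> h" by (auto simp: set_mult_def)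
    have "inv\<^bsub>G\<^esub> n \<otimes>\<^bsub>G\<^esub> x \<in> ?T" using A.T_closed x A.N_T[OF nh(1)] by blast
    moreover have "inv\<^bsub>G\<^esub> n \<otimes>\<^bsub>G\<^esub> x = h"
      unfolding nh(3) by (rule inv_mult_cancel(1)[OF A.N_carrier[OF nh(1)] subgroup.mem_carrier[OF H nh(2)]])
    ultimately have "h \<in> ?S" unfolding S_T using nh by simp
    then show ?thesis using nh by blast
  qed
  have restricted: "restricted_char_data G N \<theta> ?T d P \<alpha> ?S M \<alpha>'"
  proof (intro restricted_char_data.intro A.char_data_axioms restricted_char_data_axioms.intro S_sub M_eq T_NS)
    show "?S \<subseteq> ?T" unfolding S_T by blast
    show "\<alpha>' x y = \<alpha> x y" if "x \<in> ?S" "y \<in> ?S" for x y using that al unfolding S_eq by simp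
  qed
  interpret character_correspondence G N \<theta> ?T d P \<alpha> ?S M \<alpha>' p H \<phi> d' P'
  proof (intro character_correspondence.intro restricted character_correspondence_axioms.intro
      assms(1) H B NH N_H S_eq pair entries roots)
    show "\<mu> y = \<mu>' y" if "(x, \<sigma>) \<in> pair_stab p G H N \<theta>" "is_mu G ?T N d P x \<sigma> \<mu>"
      "is_mu G ?S M d' P' x \<sigma> \<mu>'" "y \<in> ?S" for x \<sigma> \<mu> \<mu>' y
      using mu that unfolding S_eq by blast
  qed
  show ?thesis by (rule equivariant_correspondence)
qed

end
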